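(* The parity virtual Alexander polynomial $\Phi\Delta_K(s,t,q,\theta)$ is an invariant of the virtual knot $K$: if two virtual knot diagrams are related by a finite sequence of diagrammatic moves (Reidemeister moves and virtual Reidemeister moves), then their parity virtual Alexander polynomials are equal up to multiplication by a unit of $\mathbb{Z}[s^{\pm1},t^{\pm1},q^{\pm1},\theta^{\pm1}]$.
   Context: A virtual knot diagram is an immersion of an oriented circle $S^1$ into the plane whose double points are decorated either as classical crossings (over/under information) or as virtual crossings (circled, no over/under information). The diagrammatic moves are the usual Reidemeister moves I, II, III on classical crossings, the virtual Reidemeister moves I, II, III (the same moves with all crossings virtual), and virtual Reidemeister move IV (an arc with two consecutive virtual crossings is moved past a classical crossing). A virtual knot is an equivalence class of virtual knot diagrams under these moves. Parity: label the classical crossings, choose a base point, traverse the knot and record the label of each classical crossing when encountered; each label occurs twice in the resulting cyclic word. A classical crossing is even (respectively odd) if the number of letters between its two occurrences is even (respectively odd). Virtual semi-arcs are the edges of the diagram that begin and end at a (classical or virtual) crossing, with no crossing in the interior; a diagram with $n\ge 1$ crossings in total has $2n$ virtual semi-arcs. A diagram without crossings is regarded as having a single semi-arc and no crossing relations. The virtual parity group of a diagram $K$ with $n$ crossings in total is $$PG_K=\langle a_1,\dots,a_{2n},s,q,\theta \mid r_1,\dots,r_{2n},\,r_{2n+1}=[s,q],\,r_{2n+2}=[s,\theta],\,r_{2n+3}=[\theta,q]\rangle ,$$ where $a_1,\dots,a_{2n}$ are labels of the virtual semi-arcs, $[a,b]=aba^{-1}b^{-1}$, and each crossing gives two of the relations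 $r_1,\dots,r_{2n}$ as follows. Draw the crossing with both strands oriented upward; let $x,y$ be the labels of the incoming bottom-left and bottom-right semi-arcs, and $z,w$ the labels of the outgoing top-left and top-right semi-arcs. A classical crossing is positive if the over strand runs from $x$ to $w$, and negative if the over strand runs from $y$ to $z$. The relations are: - even positive crossing: $z=xysx^{-1}s^{-1}$, $w=sxs^{-1}$; - even negative crossing: $z=s^{-1}ys$, $w=s^{-1}y^{-1}sxy$; - odd crossing of either sign: $z=\theta^{-1}y\theta$, $w=\theta x\theta^{-1}$; - virtual crossing: $z=q^{-1}yq$, $w=qxq^{-1}$. A relation $u=W$ is written as the relator $Wu^{-1}$. Let $M$ be the $(2n+3)\times(2n+3)$ matrix whose rows correspond to $r_1,\dots,r_{2n+3}$, whose columns correspond to the generators $a_1,\dots,a_{2n},s,q,\theta$, and whose entries are the Fox free derivatives of the relators with respect to the generators, evaluated in the commutative Laurent polynomial ring $\mathbb{Z}[s^{\pm1},t^{\pm1},q^{\pm1},\theta^{\pm1}]$ by sending every $a_i$ to $t$ and $s,q,\theta$ to themselves. The parity virtual Alexander polynomial $\Phi\Delta_K(s,t,q,\theta)$ is the greatest common divisor of the minors of $M$ of size (number of generators) $-1$, i.e. the $(2n+2)\times(2n+2)$ minors when $n\ge1$. For a diagram without crossings, $M$ is the $3\times4$ matrix of the presentation $\langle a_1,s,q,\theta\mid [s,q],[s,\theta],[\theta,q]\rangle$ and the $3\times3$ minors are used. The polynomial is defined up to units of the ring. *)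

theory Defs
  imports
    "HOL-Library.Poly_Mapping"
    "HOL-Library.Product_Plus"
    "HOL-Combinatorics.Orbits"
    "Jordan_Normal_Form.Determinant"
    "Jordan_Normal_Form.DL_Submatrix"
begin

section \<open>Virtual knot diagrams\<close>

text \<open>
  A diagram, up to isotopy, is recorded by walking once along the oriented circle from a base
  point.  Draw each double point with both strands oriented upward.  Passing it along the strand
  from bottom left to top right is recorded as \<open>(c, Lft)\<close>, along the strand from bottom right to
  top left as \<open>(c, Rgt)\<close>.  Virtual crossings are recorded as well, so the word determines the
  underlying 4-valent ribbon graph, and the diagram is drawn without further double points
  exactly when this graph has genus 0.  The empty word is the circle without crossings.
\<close>

datatype side = Lft | Rgt

fun flip :: "side \<Rightarrow> side" where
  "flip Lft = Rgt"
| "flip Rgt = Lft"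

datatype kind = Pos | Neg | Virt

type_synonym gauss_word = "(nat \<times> side) list"

type_synonym vdiagram = "gauss_word \<times> (nat \<Rightarrow> kind)"

definition closed_word :: "gauss_word \<Rightarrow> bool" where
  "closed_word w \<longleftrightarrow> distinct w \<and> (\<forall>c s. (c, s) \<in> set w \<longrightarrow> (c, flip s) \<in> set w)"

definition crossings :: "gauss_word \<Rightarrow> nat list" where
  "crossings w = remdups (map fst w)"

definition passage_pos :: "gauss_word \<Rightarrow> nat \<times> side \<Rightarrow> nat" where
  "passage_pos w p = (THE i. i < length w \<and> w ! i = p)"

text \<open>
  Semi-arc \<open>i\<close> ends at the \<open>i\<close>-th passage and begins at the one before it (cyclically).
\<close>

definition arc_in :: "gauss_word \<Rightarrow> nat \<times> side \<Rightarrow> nat" where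
  "arc_in w p = passage_pos w p"

definition arc_out :: "gauss_word \<Rightarrow> nat \<times> side \<Rightarrow> nat" where
  "arc_out w p = Suc (passage_pos w p) mod length w"

text \<open>
  Planarity is Euler's formula for the (connected) 4-valent graph with \<open>n\<close> vertices and \<open>2 n\<close>
  edges.  A dart \<open>(i, True)\<close> or \<open>(i, False)\<close> is semi-arc \<open>i\<close> traversed along or against the
  orientation; \<open>face_step\<close> follows the boundary of the face lying to the left of the dart.
  In terms of the four corners of a crossing (bottom left \<open>x\<close>, bottom right \<open>y\<close>, top left \<open>z\<close>,
  top right \<open>w\<close>): arriving along \<open>x\<close> one leaves along \<open>z\<close>, arriving along \<open>z\<close> along \<open>w\<close>,
  arriving along \<open>w\<close> along \<open>y\<close>, and arriving along \<open>y\<close> along \<open>x\<close>.  Which face is unbounded is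
  not recorded; this does not affect the equivalence of diagrams, since a semi-arc can be swung
  around the rest of the diagram by virtual moves.
\<close>

fun face_step :: "gauss_word \<Rightarrow> nat \<times> bool \<Rightarrow> nat \<times> bool" where
  "face_step w (i, True) =
     (case w ! i of
        (c, Lft) \<Rightarrow> (arc_out w (c, Rgt), True)
      | (c, Rgt) \<Rightarrow> (arc_in w (c, Lft), False))"
| "face_step w (i, False) =
     (case w ! ((i + length w - 1) mod length w) of
        (c, Lft) \<Rightarrow> (arc_in w (c, Rgt), False)
      | (c, Rgt) \<Rightarrow> (arc_out w (c, Lft), True))"

definition faces :: "gauss_word \<Rightarrow> (nat \<times> bool) set set" where
  "faces w = orbit (face_step w) ` ({..<length w} \<times> UNIV)"

definition planar :: "gauss_word \<Rightarrow> bool" where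
  "planar w \<longleftrightarrow> w = [] \<or> card (faces w) = length (crossings w) + 2"

definition virtual_knot_diagram :: "vdiagram \<Rightarrow> bool" where
  "virtual_knot_diagram K \<longleftrightarrow> closed_word (fst K) \<and> planar (fst K)"

text \<open>At a positive crossing the over strand is the one from bottom left to top right.\<close>

definition classical :: "(nat \<Rightarrow> kind) \<Rightarrow> nat \<Rightarrow> bool" where
  "classical \<kappa> c \<longleftrightarrow> \<kappa> c \<noteq> Virt"

fun over :: "(nat \<Rightarrow> kind) \<Rightarrow> nat \<times> side \<Rightarrow> bool" where
  "over \<kappa> (c, s) \<longleftrightarrow> \<kappa> c = Pos \<and> s = Lft \<or> \<kappa> c = Neg \<and> s = Rgt"


section \<open>Moves\<close>

text \<open>Two descriptions of one and the same diagram: change of base point, renaming of crossings.\<close>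

inductive same_diagram :: "vdiagram \<Rightarrow> vdiagram \<Rightarrow> bool" where
  rebase: "same_diagram (u @ v, \<kappa>) (v @ u, \<kappa>)"
| relabel: "inj_on f (fst ` set w) \<Longrightarrow> (\<And>c. c \<in> fst ` set w \<Longrightarrow> \<kappa>' (f c) = \<kappa> c) \<Longrightarrow>
    same_diagram (w, \<kappa>) (map (map_prod f id) w, \<kappa>')"

text \<open>
  Three strands 1, 2, 3 that bound a triangle and are met in this order when going round it
  counterclockwise; strand \<open>i\<close> is oriented counterclockwise along the triangle iff \<open>d\<^sub>i\<close>.  If
  strands \<open>i\<close> and \<open>i + 1\<close> cross at a corner of the triangle, then strand \<open>i\<close> passes it from
  bottom left to top right iff \<open>d\<^sub>i = d\<^sub>i\<^sub>+\<^sub>1\<close>.  \<open>triangle_strand e d f a b\<close> lists the two passages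
  of a strand with flag \<open>d\<close> which has the predecessor (flag \<open>e\<close>) crossing it at \<open>a\<close> and the
  successor (flag \<open>f\<close>) crossing it at \<open>b\<close>.  Moving a strand across the opposite corner reverses
  the order of the two passages on each of the three strands.
\<close>

definition turn :: "bool \<Rightarrow> bool \<Rightarrow> side" where
  "turn d e = (if d = e then Lft else Rgt)"

definition triangle_strand :: "bool \<Rightarrow> bool \<Rightarrow> bool \<Rightarrow> nat \<Rightarrow> nat \<Rightarrow> gauss_word" where
  "triangle_strand e d f a b =
     (let p = [(a, flip (turn e d)), (b, turn d f)] in if d then p else rev p)"

text \<open>
  Which crossings may occur in a third move: in Reidemeister III one of the strands is on top,
  one in the middle and one at the bottom, i.e. the relation ``over'' is not cyclic; in virtual
  Reidemeister III all crossings are virtual; in virtual Reidemeister IV the one classical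
  crossing is that of the two strands passed by the arc with two virtual crossings.
\<close>

definition layered ::
    "(nat \<Rightarrow> kind) \<Rightarrow> bool \<Rightarrow> bool \<Rightarrow> bool \<Rightarrow> nat \<Rightarrow> nat \<Rightarrow> nat \<Rightarrow> bool" where
  "layered \<kappa> d1 d2 d3 c12 c23 c31 \<longleftrightarrow>
     \<not> (over \<kappa> (c12, turn d1 d2) = over \<kappa> (c23, turn d2 d3) \<and>
        over \<kappa> (c23, turn d2 d3) = over \<kappa> (c31, turn d3 d1))"

definition third_move_admissible ::
    "(nat \<Rightarrow> kind) \<Rightarrow> bool \<Rightarrow> bool \<Rightarrow> bool \<Rightarrow> nat \<Rightarrow> nat \<Rightarrow> nat \<Rightarrow> bool" where
  "third_move_admissible \<kappa> d1 d2 d3 c12 c23 c31 \<longleftrightarrow>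
     (case filter (classical \<kappa>) [c12, c23, c31] of
        [] \<Rightarrow> True
      | [c] \<Rightarrow> True
      | [c, c'] \<Rightarrow> False
      | _ \<Rightarrow> layered \<kappa> d1 d2 d3 c12 c23 c31)"

text \<open>
  A move changes the diagram in a disc only.  In the second move the two arcs bound a bigon,
  and they run through it in the same direction in \<open>move_II_parallel\<close> and in opposite directions
  in \<open>move_II_antiparallel\<close>; for classical crossings one of the arcs is over the other one at
  both crossings.  In the third move strands 1, 2, 3 can occur along the knot in both cyclic
  orders.
\<close>

definition second_move_admissible :: "(nat \<Rightarrow> kind) \<Rightarrow> nat \<Rightarrow> nat \<Rightarrow> side \<Rightarrow> bool" where
  "second_move_admissible \<kappa> a b s \<longleftrightarrow>
     \<kappa> a = Virt \<and> \<kappa> b = Virt \<or>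
     classical \<kappa> a \<and> classical \<kappa> b \<and> over \<kappa> (a, s) = over \<kappa> (b, flip s)"

inductive diagram_move :: "vdiagram \<Rightarrow> vdiagram \<Rightarrow> bool" where
  move_I: "diagram_move (u @ v, \<kappa>) (u @ [(c, s), (c, flip s)] @ v, \<kappa>)"
| move_II_parallel: "second_move_admissible \<kappa> a b s \<Longrightarrow>
    diagram_move
      (u1 @ u2 @ u3, \<kappa>)
      (u1 @ [(a, s), (b, flip s)] @ u2 @ [(a, flip s), (b, s)] @ u3, \<kappa>)"
| move_II_antiparallel: "second_move_admissible \<kappa> a b s \<Longrightarrow>
    diagram_move
      (u1 @ u2 @ u3, \<kappa>)
      (u1 @ [(a, s), (b, flip s)] @ u2 @ [(b, s), (a, flip s)] @ u3, \<kappa>)"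
| move_III_IV: "third_move_admissible \<kappa> d1 d2 d3 c12 c23 c31 \<Longrightarrow>
    p1 = triangle_strand d3 d1 d2 c31 c12 \<Longrightarrow>
    p2 = triangle_strand d1 d2 d3 c12 c23 \<Longrightarrow>
    p3 = triangle_strand d2 d3 d1 c23 c31 \<Longrightarrow>
    (q2, q3) = (p2, p3) \<or> (q2, q3) = (p3, p2) \<Longrightarrow>
    diagram_move
      (u1 @ p1 @ u2 @ q2 @ u3 @ q3 @ u4, \<kappa>)
      (u1 @ rev p1 @ u2 @ rev q2 @ u3 @ rev q3 @ u4, \<kappa>)"

text \<open>
  All intermediate diagrams are required to be planar virtual knot diagrams.
\<close>

definition virtually_equivalent :: "vdiagram \<Rightarrow> vdiagram \<Rightarrow> bool" where
  "virtually_equivalent = equivclp (\<lambda>K K'. virtual_knot_diagram K \<and> virtual_knot_diagram K' \<and>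
     (same_diagram K K' \<or> diagram_move K K'))"


section \<open>The virtual parity group\<close>

definition odd_crossing :: "vdiagram \<Rightarrow> nat \<Rightarrow> bool" where
  "odd_crossing K c \<longleftrightarrow>
     (\<exists>u v x. filter (classical (snd K)) (map fst (fst K)) = u @ [c] @ v @ [c] @ x
        \<and> odd (length v))"

datatype gen = Arc nat | S | Q | Theta

text \<open>A letter \<open>(g, True)\<close> stands for the generator \<open>g\<close> and \<open>(g, False)\<close> for its inverse.\<close>

type_synonym gword = "(gen \<times> bool) list"

definition gen_word :: "gen \<Rightarrow> gword" where
  "gen_word g = [(g, True)]"

definition inv_word :: "gword \<Rightarrow> gword" where
  "inv_word u = rev (map (\<lambda>(g, e). (g, \<not> e)) u)"

definition commutator_word :: "gword \<Rightarrow> gword \<Rightarrow> gword" where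
  "commutator_word a b = a @ b @ inv_word a @ inv_word b"

definition crossing_relators :: "vdiagram \<Rightarrow> nat \<Rightarrow> gword list" where
  "crossing_relators K c =
     (let x = gen_word (Arc (arc_in (fst K) (c, Lft)));
          y = gen_word (Arc (arc_in (fst K) (c, Rgt)));
          z = gen_word (Arc (arc_out (fst K) (c, Rgt)));
          w = gen_word (Arc (arc_out (fst K) (c, Lft)));
          s = gen_word S; q = gen_word Q; \<theta> = gen_word Theta
      in if snd K c = Virt then
           [inv_word q @ y @ q @ inv_word z,
            q @ x @ inv_word q @ inv_word w]
         else if odd_crossing K c then
           [inv_word \<theta> @ y @ \<theta> @ inv_word z,
            \<theta> @ x @ inv_word \<theta> @ inv_word w]
         else if snd K c = Pos then
           [x @ y @ s @ inv_word x @ inv_word s @ inv_word z,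
            s @ x @ inv_word s @ inv_word w]
         else
           [inv_word s @ y @ s @ inv_word z,
            inv_word s @ inv_word y @ s @ x @ y @ inv_word w])"

text \<open>
  The presentation of the virtual parity group.  A word of length \<open>2 n > 0\<close> has \<open>2 n\<close> semi-arcs;
  the diagram without crossings has one.
\<close>

definition parity_group_gens :: "vdiagram \<Rightarrow> gen list" where
  "parity_group_gens K = map Arc [0..<max 1 (length (fst K))] @ [S, Q, Theta]"

definition parity_group_relators :: "vdiagram \<Rightarrow> gword list" where
  "parity_group_relators K =
     concat (map (crossing_relators K) (crossings (fst K))) @
     [commutator_word (gen_word S) (gen_word Q),
      commutator_word (gen_word S) (gen_word Theta),
      commutator_word (gen_word Theta) (gen_word Q)]"


section \<open>The parity virtual Alexander polynomial\<close>

text \<open>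
  The integral Laurent polynomials in \<open>s, t, q, \<theta>\<close>: finitely supported coefficient functions on
  the exponent vectors \<open>(i, j, k, l)\<close> of the monomials \<open>s\<^sup>i t\<^sup>j q\<^sup>k \<theta>\<^sup>l\<close>, with convolution.
\<close>

type_synonym laurent = "(int \<times> int \<times> int \<times> int) \<Rightarrow>\<^sub>0 int"

fun gen_exponent :: "gen \<Rightarrow> int \<times> int \<times> int \<times> int" where
  "gen_exponent S = (1, 0, 0, 0)"
| "gen_exponent (Arc i) = (0, 1, 0, 0)"
| "gen_exponent Q = (0, 0, 1, 0)"
| "gen_exponent Theta = (0, 0, 0, 1)"

fun letter_value :: "gen \<times> bool \<Rightarrow> laurent" where
  "letter_value (g, e) = Poly_Mapping.single (if e then gen_exponent g else - gen_exponent g) 1"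

definition word_value :: "gword \<Rightarrow> laurent" where
  "word_value u = prod_list (map letter_value u)"

text \<open>
  The Fox derivative with respect to \<open>g\<close>, a formal integral combination of words:
  it satisfies \<open>D (u v) = D u + u D v\<close>, \<open>D g = 1\<close>, \<open>D g\<^sup>-\<^sup>1 = - g\<^sup>-\<^sup>1\<close>, and \<open>D h = 0\<close> for the
  other generators \<open>h\<close>.
\<close>

fun fox :: "gen \<Rightarrow> gword \<Rightarrow> (int \<times> gword) list" where
  "fox g [] = []"
| "fox g ((h, e) # u) =
     (if h \<noteq> g then [] else if e then [(1, [])] else [(- 1, [(h, False)])]) @
     map (\<lambda>(k, v). (k, (h, e) # v)) (fox g u)"

definition group_ring_value :: "(int \<times> gword) list \<Rightarrow> laurent" where
  "group_ring_value xs = (\<Sum>(k, v)\<leftarrow>xs. of_int k * word_value v)"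

definition fox_matrix :: "vdiagram \<Rightarrow> laurent mat" where
  "fox_matrix K =
     (let rs = parity_group_relators K; gs = parity_group_gens K
      in mat (length rs) (length gs) (\<lambda>(i, j). group_ring_value (fox (gs ! j) (rs ! i))))"

definition minors :: "nat \<Rightarrow> 'a::comm_ring_1 mat \<Rightarrow> 'a set" where
  "minors k A = {det (submatrix A I J) | I J.
     I \<subseteq> {..<dim_row A} \<and> J \<subseteq> {..<dim_col A} \<and> card I = k \<and> card J = k}"

text \<open>
  The ring is factorial, but it is not an instance of a library class with \<open>gcd\<close>; greatest common
  divisors are therefore taken with respect to divisibility, determined up to units.
\<close>

definition is_gcd_of :: "'a::comm_ring_1 \<Rightarrow> 'a set \<Rightarrow> bool" where
  "is_gcd_of g A \<longleftrightarrow> (\<forall>a\<in>A. g dvd a) \<and> (\<forall>d. (\<forall>a\<in>A. d dvd a) \<longrightarrow> d dvd g)"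

definition is_parity_virtual_alexander :: "vdiagram \<Rightarrow> laurent \<Rightarrow> bool" where
  "is_parity_virtual_alexander K \<Phi> \<longleftrightarrow>
     is_gcd_of \<Phi> (minors (length (parity_group_gens K) - 1) (fox_matrix K))"

end

theory Submission
  imports Defs "HOL-Library.Function_Algebras" "HOL-Library.Product_Lexorder"
begin

text \<open>
  The common divisors of the minors of the Fox matrix depend only on the module that the matrix
  presents, because the minors generate a Fitting ideal of this module.  In detail, for \<open>n\<close>
  generators, \<open>d\<close> divides all minors of size \<open>n - 1\<close> iff it divides every \<open>n\<close> by \<open>n\<close>
  determinant with at most one row outside the span of the relations
  (\<open>divides_fitting_iff_minors\<close>), and this property passes from one presentation to another
  whenever the module presented by the latter surjects onto that of the former
  (\<open>divides_fitting_surjection\<close>).  So it suffices to find, for each move, surjections in both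
  directions between the modules of the two diagrams.

  Homomorphisms from the module of a diagram to a quotient \<open>V / N\<close> are colourings of the diagram:
  the Fox derivative turns each relator into a linear relation between the colours of the semi-arcs
  (\<open>colouring_of_relations\<close>, \<open>relations_of_colouring\<close>).  Colourings are easy to follow through a
  move, since nothing changes outside a disc.  A move carries the generic colouring of one diagram
  to a colouring of the other one, and this gives a surjection as soon as the new colours generate
  the old ones; that is the relation \<open>transfers\<close>.

  At a crossing, let the colour of either strand be recorded on the left and on the right of the
  other strand.  In these terms the relations do not depend on the sign.  At a virtual or odd
  crossing both strands are conjugated by \<open>q\<close> or \<open>\<theta>\<close> on passing from left to right.  At an even
  crossing the over strand is conjugated by \<open>s\<close>, and the colour of the under strand on the left is
  an affine function of its colour on the right and of the over strand.
  Such a law determines all colours from one colour on each strand (\<open>law_unique\<close>), which settles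
  the second move, and it preserves equality of the two colours (\<open>law_diagonal\<close>), which settles the
  first move.

  For the third move there are two cases.  If two of the three crossings are conjugations by the
  same generator, then the strand through both of them slides across the third crossing, because
  conjugation by a central generator respects every law (\<open>triangle_slides_detour\<close>); this covers
  the virtual moves.  If all three crossings are even, then the strands are layered, and the move is
  the self-distributivity of the Alexander quandle (\<open>outer_under_distributive\<close>).  No other case
  occurs: the parities of the three crossings of a triangle are the differences of three signs, so
  that none or exactly two of them are odd (\<open>parity_of_triangle\<close>).

  Finally, two greatest common divisors of sets with the same common divisors divide each other, and
  the ring of Laurent polynomials is an integral domain because the exponents can be ordered
  lexicographically.
\<close>

section \<open>Modules of functions\<close>

definition scale_fun :: "'r::comm_ring_1 \<Rightarrow> ('g \<Rightarrow> 'r) \<Rightarrow> 'g \<Rightarrow> 'r" (infixr "*\<^sub>f" 75) where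
  "r *\<^sub>f v = (\<lambda>g. r * v g)"

lemma module_scale_fun: "Modules.module scale_fun"
  by (rule Modules.module.intro) (simp_all add: scale_fun_def fun_eq_iff algebra_simps)

abbreviation submodule :: "('g \<Rightarrow> 'r::comm_ring_1) set \<Rightarrow> bool" where
  "submodule \<equiv> Modules.module.subspace scale_fun"

abbreviation span_fun :: "('g \<Rightarrow> 'r::comm_ring_1) set \<Rightarrow> ('g \<Rightarrow> 'r) set" where
  "span_fun \<equiv> Modules.module.span scale_fun"

lemmas submodule_def = Modules.module.subspace_def[OF module_scale_fun]
  and submodule_0 = Modules.module.subspace_0[OF module_scale_fun]
  and submodule_add = Modules.module.subspace_add[OF module_scale_fun]
  and submodule_diff = Modules.module.subspace_diff[OF module_scale_fun]
  and submodule_neg = Modules.module.subspace_neg[OF module_scale_fun]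
  and submodule_scale = Modules.module.subspace_scale[OF module_scale_fun]
  and submodule_span = Modules.module.subspace_span[OF module_scale_fun]
  and span_fun_base = Modules.module.span_base[OF module_scale_fun]
  and span_fun_induct = Modules.module.span_induct[OF module_scale_fun]
  and span_fun_minimal = Modules.module.span_minimal[OF module_scale_fun]
  and span_fun_Un = Modules.module.span_Un[OF module_scale_fun]
  and scale_fun_diff = Modules.module.scale_right_diff_distrib[OF module_scale_fun]

section \<open>Common divisors of minors and the presented module\<close>

definition row_matrix :: "'g list \<Rightarrow> (nat \<Rightarrow> 'g \<Rightarrow> 'r) \<Rightarrow> 'r mat" where
  "row_matrix gs B = mat (length gs) (length gs) (\<lambda>(i, j). B i (gs ! j))"

text \<open>
  For a submodule \<open>N\<close> of relations between the generators \<open>gs\<close>, the determinants with at most \<open>k\<close>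
  rows outside \<open>N\<close> generate the \<open>k\<close>-th Fitting ideal of the quotient: expanding along the free rows
  gives the minors of size \<open>length gs - k\<close>.  In this form no choice of rows and columns is involved,
  and only the submodule \<open>N\<close> matters, not the relations that generate it.
\<close>

definition divides_fitting :: "'r::comm_ring_1 \<Rightarrow> nat \<Rightarrow> 'g list \<Rightarrow> ('g \<Rightarrow> 'r) set \<Rightarrow> bool" where
  "divides_fitting d k gs N \<longleftrightarrow>
     (\<forall>B. card {i. i < length gs \<and> B i \<notin> N} \<le> k \<longrightarrow> d dvd det (row_matrix gs B))"

text \<open>
  Repeated expansion along the first column strips the \<open>p\<close> additional columns and deletes one row
  at a time; deleting a row cannot increase the number of rows outside \<open>N\<close>.
\<close>

lemma divides_fitting_det_append_columns:
  assumes N: "divides_fitting d k gs N"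
  shows "A \<in> carrier_mat (p + length gs) (p + length gs) \<Longrightarrow>
    (\<And>i j. i < p + length gs \<Longrightarrow> j < length gs \<Longrightarrow> A $$ (i, p + j) = C i (gs ! j)) \<Longrightarrow>
    card {i. i < p + length gs \<and> C i \<notin> N} \<le> k \<Longrightarrow> d dvd det A"
proof (induction p arbitrary: A C)
  case 0
  have "A = row_matrix gs C"
    by (rule eq_matI) (use 0 in \<open>auto simp: row_matrix_def\<close>)
  with 0 N show ?case by (auto simp: divides_fitting_def)
next
  case (Suc p)
  let ?n = "p + length gs"
  have A: "A \<in> carrier_mat (Suc ?n) (Suc ?n)" using Suc.prems(1) by simp
  have "d dvd det (mat_delete A i 0)" if i: "i < Suc ?n" for i
  proof (rule Suc.IH)
    show "mat_delete A i 0 \<in> carrier_mat ?n ?n"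
      using mat_delete_carrier[OF A] by simp
    show "mat_delete A i 0 $$ (i', p + j) = C (insert_index i i') (gs ! j)"
      if "i' < ?n" "j < length gs" for i' j
    proof -
      have "mat_delete A i 0 $$ (i', p + j) = A $$ (insert_index i i', insert_index 0 (p + j))"
        using that i by (intro mat_delete_index[OF A, symmetric]) auto
      also have "\<dots> = C (insert_index i i') (gs ! j)"
        using Suc.prems(2)[of "insert_index i i'" j] that by (simp add: insert_index_def)
      finally show ?thesis .
    qed
    have "card {i'. i' < ?n \<and> C (insert_index i i') \<notin> N}
        \<le> card {i. i < Suc p + length gs \<and> C i \<notin> N}"
      by (rule card_inj_on_le[where f = "insert_index i"])
         (auto simp: inj_on_def insert_index_def split: if_splits)
    then show "card {i'. i' < ?n \<and> C (insert_index i i') \<notin> N} \<le> k"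
      using Suc.prems(3) by linarith
  qed
  then have "d dvd A $$ (i, 0) * cofactor A i 0" if "i < Suc ?n" for i
    using that by (simp add: cofactor_def)
  then show ?case
    by (subst laplace_expansion_column[OF A, of 0]) (auto simp del: sum.lessThan_Suc intro: dvd_sum)
qed

definition linear_extension :: "'g list \<Rightarrow> ('g \<Rightarrow> 'h \<Rightarrow> 'r) \<Rightarrow> ('g \<Rightarrow> 'r) \<Rightarrow> 'h \<Rightarrow> 'r::comm_ring_1"
  where "linear_extension gs \<phi> v = (\<lambda>h. \<Sum>j<length gs. v (gs ! j) * \<phi> (gs ! j) h)"

definition basis_vector :: "'g \<Rightarrow> 'g \<Rightarrow> 'r::comm_ring_1" where
  "basis_vector g = (\<lambda>h. if h = g then 1 else 0)"

text \<open>
  The inclusion of Fitting ideals along a surjection.  Bordering a matrix \<open>B\<close> of relations for \<open>gs\<close>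
  by \<open>(- \<psi>, 1)\<close>, where \<open>\<psi>\<close> lifts the generators \<open>hs\<close>, does not change the determinant.  Adding to
  the new columns the images under \<open>\<phi>\<close> of the old ones turns the new part of each old row into the
  image of that row, and the new part of each new row into \<open>h - \<phi> (\<psi> h)\<close>; so all but \<open>k\<close> of these
  rows lie in \<open>N'\<close>.
\<close>

lemma divides_fitting_surjection:
  fixes d :: "'r::idom"
  assumes hs: "distinct hs" and N': "divides_fitting d k hs N'"
    and maps: "\<And>v. v \<in> N \<Longrightarrow> linear_extension gs \<phi> v \<in> N'"
    and onto: "\<And>h. h \<in> set hs \<Longrightarrow> \<exists>v. basis_vector h - linear_extension gs \<phi> v \<in> N'"
  shows "divides_fitting d k gs N"
  unfolding divides_fitting_def
proof (intro allI impI)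
  fix B assume bad: "card {i. i < length gs \<and> B i \<notin> N} \<le> k"
  let ?n = "length gs" and ?m = "length hs"
  obtain \<psi> where \<psi>: "\<And>h. h \<in> set hs \<Longrightarrow> basis_vector h - linear_extension gs \<phi> (\<psi> h) \<in> N'"
    using onto by metis
  define F where "F = mat ?n ?m (\<lambda>(i, j). \<phi> (gs ! i) (hs ! j))"
  define P where "P = mat ?m ?n (\<lambda>(i, j). - \<psi> (hs ! i) (gs ! j))"
  define C where "C i = (if i < ?n then linear_extension gs \<phi> (B i)
    else basis_vector (hs ! (i - ?n)) - linear_extension gs \<phi> (\<psi> (hs ! (i - ?n))))" for i
  have M: "row_matrix gs B \<in> carrier_mat ?n ?n" and F: "F \<in> carrier_mat ?n ?m"
    and P: "P \<in> carrier_mat ?m ?n"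
    by (auto simp: row_matrix_def F_def P_def)
  let ?L = "four_block_mat (row_matrix gs B) (0\<^sub>m ?n ?m) P (1\<^sub>m ?m)"
  let ?U = "four_block_mat (1\<^sub>m ?n) F (0\<^sub>m ?m ?n) (1\<^sub>m ?m)"
  have L: "?L \<in> carrier_mat (?n + ?m) (?n + ?m)" and U: "?U \<in> carrier_mat (?n + ?m) (?n + ?m)"
    using M F P by auto
  have LU: "?L * ?U = four_block_mat (row_matrix gs B) (row_matrix gs B * F) P (P * F + 1\<^sub>m ?m)"
    using M F P by (subst mult_four_block_mat[of _ ?n ?n _ ?m _ ?m _ _ ?n _ ?m]) auto
  have "det (?L * ?U) = det (row_matrix gs B)"
    unfolding det_mult[OF L U]
    using det_four_block_mat_upper_right_zero[OF M refl P, of "1\<^sub>m ?m"]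
      det_four_block_mat_lower_left_zero[of "1\<^sub>m ?n" ?n F ?m "0\<^sub>m ?m ?n" "1\<^sub>m ?m"] F by simp
  moreover have "d dvd det (?L * ?U)"
  proof (rule divides_fitting_det_append_columns[OF N'])
    show "?L * ?U \<in> carrier_mat (?n + ?m) (?n + ?m)" using L U by auto
    show "(?L * ?U) $$ (i, ?n + j) = C i (hs ! j)" if "i < ?n + ?m" "j < ?m" for i j
      unfolding LU using that M F P hs
      by (auto simp: C_def row_matrix_def F_def P_def scalar_prod_def linear_extension_def
          basis_vector_def nth_eq_iff_index_eq sum_negf atLeast0LessThan)
    have "C i \<in> N'" if "i < ?n + ?m" "\<not> i < ?n" for i
      using \<psi>[of "hs ! (i - ?n)"] that by (simp add: C_def)
    then have "{i. i < ?n + ?m \<and> C i \<notin> N'} \<subseteq> {i. i < ?n \<and> B i \<notin> N}"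
      using maps by (auto simp: C_def split: if_splits)
    from card_mono[OF _ this] bad show "card {i. i < ?n + ?m \<and> C i \<notin> N'} \<le> k"
      by simp
  qed
  ultimately show "d dvd det (row_matrix gs B)" by simp
qed

lemma det_row_functional:
  fixes f :: "nat \<Rightarrow> 'g \<Rightarrow> 'r::comm_ring_1"
  assumes m: "m < p"
  shows "\<exists>c. \<forall>x. det (mat p p (\<lambda>(i, j). (f(m := x)) i (cl j))) = (\<Sum>j<p. x (cl j) * c j)"
proof (intro exI allI)
  fix x
  let ?A = "\<lambda>x. mat p p (\<lambda>(i, j). (f(m := x)) i (cl j))"
  have "mat_delete (?A x) m j = mat_delete (?A 0) m j" for j
    unfolding mat_delete_def by (rule eq_matI) (use m in auto)
  then have "cofactor (?A x) m j = cofactor (?A 0) m j" for j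
    by (simp add: cofactor_def)
  with m show "det (?A x) = (\<Sum>j<p. x (cl j) * cofactor (?A 0) m j)"
    by (subst laplace_expansion_row[of _ p m]) auto
qed

text \<open>
  Divisibility of all determinants with rows in \<open>R\<close> extends to rows in the span of \<open>R\<close>, one row after
  the other, because a determinant is linear in each row.
\<close>

lemma dvd_det_span:
  fixes d :: "'r::comm_ring_1" and f :: "nat \<Rightarrow> 'g \<Rightarrow> 'r"
  assumes R: "\<And>f. (\<And>i. i < p \<Longrightarrow> f i \<in> R) \<Longrightarrow> d dvd det (mat p p (\<lambda>(i, j). f i (cl j)))"
    and f: "\<And>i. i < p \<Longrightarrow> f i \<in> span_fun R"
  shows "d dvd det (mat p p (\<lambda>(i, j). f i (cl j)))"
proof -
  have "d dvd det (mat p p (\<lambda>(i, j). f i (cl j)))"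
    if "m \<le> p" "\<And>i. i < m \<Longrightarrow> f i \<in> span_fun R" "\<And>i. m \<le> i \<Longrightarrow> i < p \<Longrightarrow> f i \<in> R" for m f
    using that
  proof (induction m arbitrary: f)
    case 0
    then show ?case by (intro R) simp
  next
    case (Suc m)
    obtain c where c: "det (mat p p (\<lambda>(i, j). (f(m := x)) i (cl j))) = (\<Sum>j<p. x (cl j) * c j)" for x
      using det_row_functional[of m p f cl] Suc.prems(1) by auto
    have "submodule {x. d dvd (\<Sum>j<p. x (cl j) * c j)}"
      unfolding submodule_def
      by (auto simp: scale_fun_def distrib_right sum.distrib mult.assoc sum_distrib_left[symmetric])
    moreover have "d dvd (\<Sum>j<p. x (cl j) * c j)" if "x \<in> R" for x
      unfolding c[symmetric] using that Suc.prems
      by (intro Suc.IH) auto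
    ultimately have "d dvd (\<Sum>j<p. f m (cl j) * c j)"
      using span_fun_induct[of "f m" R "\<lambda>x. d dvd (\<Sum>j<p. x (cl j) * c j)"] Suc.prems(2)[of m]
      by simp
    then show ?case using c[of "f m"] by simp
  qed
  from this[of p f] f show ?thesis by simp
qed

lemma pick_remove: "pick ({..<Suc p} - {c}) j = insert_index c j" if "c \<le> p" "j < p"
proof -
  let ?J = "{..<Suc p} - {c}"
  have "{a \<in> ?J. a < insert_index c j} = (if j < c then {..<j} else {..<Suc j} - {c})"
    using that by (auto simp: insert_index_def)
  then have "card {a \<in> ?J. a < insert_index c j} = j" by auto
  moreover have "insert_index c j \<in> ?J" using that by (auto simp: insert_index_def)
  ultimately show ?thesis using pick_card_in_set by metis
qed

lemma minor_remove_column: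
  assumes A: "A = mat nr (Suc p) (\<lambda>(i, j). r i (gs ! j))"
    and I: "I \<subseteq> {..<nr}" "card I = p" and c: "c \<le> p"
  shows "submatrix A I ({..<Suc p} - {c}) = mat p p (\<lambda>(i, j). r (pick I i) (gs ! insert_index c j))"
proof -
  have 1: "{i. i < nr \<and> i \<in> I} = I" and 2: "{j. j < Suc p \<and> j \<in> {..<Suc p} - {c}} = {..<Suc p} - {c}"
    using I by auto
  have 3: "card ({..<Suc p} - {c}) = p" using c by simp
  show ?thesis
  proof (rule eq_matI)
    fix i j assume "i < dim_row (mat p p (\<lambda>(i, j). r (pick I i) (gs ! insert_index c j)))"
      "j < dim_col (mat p p (\<lambda>(i, j). r (pick I i) (gs ! insert_index c j)))"
    then have ij: "i < p" "j < p" by auto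
    have "pick I i < nr" using pick_in_set_le[of i I] I ij by auto
    moreover have "insert_index c j < Suc p" using ij by (simp add: insert_index_def)
    ultimately show "submatrix A I ({..<Suc p} - {c}) $$ (i, j) =
        mat p p (\<lambda>(i, j). r (pick I i) (gs ! insert_index c j)) $$ (i, j)"
      using ij c I(2) 3 by (simp add: submatrix_def A 1 2[simplified] pick_remove)
  qed (use I(2) 3 in \<open>simp_all add: submatrix_def A 1 2[simplified]\<close>)
qed

text \<open>
  Rows that are selected in an arbitrary order are a permutation of the same rows in increasing
  order, which is how \<open>submatrix\<close> lists them.
\<close>

lemma permuted_pick:
  fixes g :: "nat \<Rightarrow> nat"
  assumes g: "inj_on g {..<p}"
  shows "\<exists>\<pi>. \<pi> permutes {0..<p} \<and> (\<forall>i<p. pick (g ` {..<p}) (\<pi> i) = g i)"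
proof -
  define I where "I = g ` {..<p}"
  define rank where "rank i = card {a \<in> I. a < g i}" for i
  have I: "card I = p" "finite I" using g by (simp_all add: card_image I_def)
  have pick: "pick I (rank i) = g i" if "i < p" for i
    unfolding rank_def using that by (intro pick_card_in_set) (simp add: I_def)
  have less: "rank i < p" if "i < p" for i
  proof -
    have "g i \<in> I" "g i \<notin> {a \<in> I. a < g i}" using that by (simp_all add: I_def)
    then have "{a \<in> I. a < g i} \<subset> I" by blast
    from psubset_card_mono[OF I(2) this] I show ?thesis by (simp add: rank_def)
  qed
  have inj: "inj_on rank {0..<p}"
  proof (rule inj_onI)
    fix i j assume ij: "i \<in> {0..<p}" "j \<in> {0..<p}" and eq: "rank i = rank j"
    then have "g i = g j" using pick[of i] pick[of j] by simp
    with g ij show "i = j" by (simp add: inj_on_def)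
  qed
  have "rank ` {0..<p} = {0..<p}"
    by (rule card_subset_eq) (use less inj in \<open>auto simp: card_image\<close>)
  with inj have bij: "bij_betw rank {0..<p} {0..<p}" by (simp add: bij_betw_def)
  let ?\<pi> = "\<lambda>i. if i \<in> {0..<p} then rank i else i"
  have "bij_betw ?\<pi> {0..<p} {0..<p}"
    using bij by (rule bij_betw_cong[THEN iffD1, rotated]) simp
  then have "?\<pi> permutes {0..<p}"
    by (rule bij_imp_permutes) simp
  then show ?thesis using pick by (intro exI[of _ ?\<pi>]) (auto simp: I_def)
qed

lemma minor_dvd_selected_rows:
  fixes d :: "'r::comm_ring_1"
  assumes minors: "\<And>a. a \<in> minors p A \<Longrightarrow> d dvd a"
    and A: "A = mat nr (Suc p) (\<lambda>(i, j). r i (gs ! j))" and c: "c \<le> p"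
    and g: "\<And>i. i < p \<Longrightarrow> g i < nr"
  shows "d dvd det (mat p p (\<lambda>(i, j). r (g i) (gs ! insert_index c j)))" (is "d dvd det ?M")
proof (cases "inj_on g {..<p}")
  case False
  then obtain i i' where i: "i < p" "i' < p" "i \<noteq> i'" "g i = g i'" by (auto simp: inj_on_def)
  have "row ?M i = row ?M i'" by (rule eq_vecI) (use i in auto)
  with i det_identical_rows[of ?M p i i'] show ?thesis by simp
next
  case True
  define I where "I = g ` {..<p}"
  obtain \<pi> where \<pi>: "\<pi> permutes {0..<p}" "\<And>i. i < p \<Longrightarrow> pick I (\<pi> i) = g i"
    using permuted_pick[OF True] unfolding I_def by auto
  have I: "I \<subseteq> {..<nr}" "card I = p" using True g by (auto simp: I_def card_image)
  let ?S = "submatrix A I ({..<Suc p} - {c})"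
  have S: "?S = mat p p (\<lambda>(i, j). r (pick I i) (gs ! insert_index c j))"
    by (rule minor_remove_column[OF A I c])
  have lt: "\<pi> i < p" if "i < p" for i
    using \<pi>(1) that permutes_in_image[of \<pi> "{0..<p}" i] by simp
  have "?M = mat p p (\<lambda>(i, j). ?S $$ (\<pi> i, j))"
    by (rule eq_matI) (auto simp: S \<pi>(2) lt)
  then have "det ?M = signof \<pi> * det ?S"
    using det_permute_rows[of ?S p \<pi>] \<pi>(1) S by simp
  moreover have "det ?S \<in> minors p A"
    unfolding minors_def using I c
    by (intro CollectI exI[of _ I] exI[of _ "{..<Suc p} - {c}"]) (auto simp: A)
  ultimately show ?thesis using minors by simp
qed

text \<open>
  A minor of size \<open>p\<close> that omits the column \<open>c\<close> is, up to sign, a determinant of size \<open>p + 1\<close> whose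
  only free row is the basis vector of \<open>c\<close>.  Conversely, expansion along the free row leaves minors
  with rows in the span, which are combinations of minors of the given matrix.
\<close>

lemma divides_fitting_iff_minors:
  fixes d :: "'r::comm_ring_1"
  assumes gs: "distinct gs" "length gs = Suc p"
  shows "divides_fitting d 1 gs (span_fun (set rs)) \<longleftrightarrow>
    (\<forall>a \<in> minors p (mat (length rs) (length gs) (\<lambda>(i, j). (rs ! i) (gs ! j))). d dvd a)"
proof
  let ?A = "mat (length rs) (length gs) (\<lambda>(i, j). (rs ! i) (gs ! j))"
  assume fit: "divides_fitting d 1 gs (span_fun (set rs))"
  show "\<forall>a \<in> minors p ?A. d dvd a"
  proof
    fix a assume "a \<in> minors p ?A"
    then obtain I J where a: "a = det (submatrix ?A I J)" and I: "I \<subseteq> {..<length rs}" "card I = p"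
      and J: "J \<subseteq> {..<Suc p}" "card J = p"
      by (auto simp: minors_def gs)
    have "card ({..<Suc p} - J) = 1"
      using J by (subst card_Diff_subset) (auto intro: finite_subset)
    then obtain c where "{..<Suc p} - J = {c}" by (auto simp: card_Suc_eq)
    then have c: "c \<le> p" "J = {..<Suc p} - {c}" using J by auto
    define B where "B i = (if i < p then rs ! pick I i else basis_vector (gs ! c))" for i
    let ?M = "row_matrix gs B"
    have "pick I i < length rs" if "i < p" for i
      using pick_in_set_le[of i I] I that by auto
    then have "{i. i < length gs \<and> B i \<notin> span_fun (set rs)} \<subseteq> {p}"
      using gs by (auto simp: B_def less_Suc_eq intro!: span_fun_base)
    then have "d dvd det ?M"
      using fit card_mono[of "{p}"] by (fastforce simp: divides_fitting_def)
    moreover have "det ?M = cofactor ?M p c"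
    proof -
      have "det ?M = (\<Sum>j<Suc p. ?M $$ (p, j) * cofactor ?M p j)"
        by (rule laplace_expansion_row) (auto simp: row_matrix_def gs)
      also have "\<dots> = (\<Sum>j<Suc p. if j = c then cofactor ?M p c else 0)"
        using c gs
        by (intro sum.cong) (auto simp: row_matrix_def B_def basis_vector_def nth_eq_iff_index_eq)
      finally show ?thesis using c by (simp del: sum.lessThan_Suc)
    qed
    moreover have "mat_delete ?M p c = submatrix ?A I J"
    proof -
      have "submatrix ?A I J = mat p p (\<lambda>(i, j). (rs ! pick I i) (gs ! insert_index c j))"
        unfolding c(2) by (rule minor_remove_column[OF _ I c(1)]) (simp add: gs)
      then show ?thesis
        unfolding mat_delete_def by (intro eq_matI) (auto simp: row_matrix_def gs B_def insert_index_def)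
    qed
    ultimately show "d dvd a"
      by (cases "even (p + c)") (simp_all add: a cofactor_def)
  qed
next
  let ?A = "mat (length rs) (length gs) (\<lambda>(i, j). (rs ! i) (gs ! j))"
  assume minors: "\<forall>a \<in> minors p ?A. d dvd a"
  show "divides_fitting d 1 gs (span_fun (set rs))"
    unfolding divides_fitting_def
  proof (intro allI impI)
    fix B assume bad: "card {i. i < length gs \<and> B i \<notin> span_fun (set rs)} \<le> 1"
    let ?bad = "{i. i < length gs \<and> B i \<notin> span_fun (set rs)}"
    obtain b where b: "b \<le> p" "?bad \<subseteq> {b}"
    proof (cases "?bad = {}")
      case True show ?thesis by (rule that[of 0], simp, subst True, simp)
    next
      case False
      then obtain b where "b \<in> ?bad" by auto
      moreover have "?bad \<subseteq> {b}"
        using bad \<open>b \<in> ?bad\<close> card_le_Suc0_iff_eq[of ?bad] by auto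
      ultimately show ?thesis using that[of b] gs by simp
    qed
    have good: "B i \<in> span_fun (set rs)" if "i < length gs" "i \<noteq> b" for i
      using b(2) that by blast
    let ?M = "row_matrix gs B"
    have M: "?M \<in> carrier_mat (Suc p) (Suc p)" by (simp add: row_matrix_def gs)
    have "d dvd det (mat_delete ?M b c)" if c: "c \<le> p" for c
    proof -
      have "mat_delete ?M b c = mat p p (\<lambda>(i, j). B (insert_index b i) (gs ! insert_index c j))"
        unfolding mat_delete_def
        by (rule eq_matI) (use b c in \<open>auto simp: row_matrix_def gs insert_index_def\<close>)
      moreover have "d dvd det (mat p p (\<lambda>(i, j). B (insert_index b i) (gs ! insert_index c j)))"
      proof (rule dvd_det_span[where R = "set rs" and f = "\<lambda>i. B (insert_index b i)"])
        show "B (insert_index b i) \<in> span_fun (set rs)" if "i < p" for i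
          using good[of "insert_index b i"] that gs by (simp add: insert_index_def)
        fix f assume "\<And>i. i < p \<Longrightarrow> f i \<in> set rs"
        then obtain g where g: "\<And>i. i < p \<Longrightarrow> g i < length rs \<and> f i = rs ! g i"
          unfolding in_set_conv_nth by metis
        have "mat p p (\<lambda>(i, j). f i (gs ! insert_index c j)) =
            mat p p (\<lambda>(i, j). (rs ! g i) (gs ! insert_index c j))"
          by (rule eq_matI) (auto simp: g)
        moreover have "d dvd det (mat p p (\<lambda>(i, j). (rs ! g i) (gs ! insert_index c j)))"
          using minor_dvd_selected_rows[of p ?A d "length rs" "\<lambda>i. rs ! i" gs c g] minors c g gs by auto
        ultimately show "d dvd det (mat p p (\<lambda>(i, j). f i (gs ! insert_index c j)))" by simp
      qed
      ultimately show ?thesis by simp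
    qed
    then have "d dvd ?M $$ (b, c) * cofactor ?M b c" if "c < Suc p" for c
      using that by (simp add: cofactor_def)
    then show "d dvd det ?M"
      using b by (subst laplace_expansion_row[OF M, of b]) (auto simp del: sum.lessThan_Suc intro: dvd_sum)
  qed
qed

section \<open>The laws of colours at a crossing\<close>

text \<open>
  The generators \<open>s\<close>, \<open>q\<close>, \<open>\<theta>\<close>, which commute with one another.
\<close>

datatype central = CS | CQ | CT

text \<open>
  \<open>Twist g\<close> is the law of a crossing at which either strand is conjugated by \<open>g\<close>, and \<open>Even k\<close> is the
  law of an even crossing with over strand \<open>k\<close> among the two strands of the crossing.
\<close>

datatype law = Twist central | Even side

fun swap_law :: "law \<Rightarrow> law" where
  "swap_law (Twist g) = Twist g"
| "swap_law (Even s) = Even (flip s)"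

lemma flip_flip [simp]: "flip (flip s) = s"
  by (cases s) auto

lemma flip_neq [simp]: "flip s \<noteq> s" "s \<noteq> flip s"
  by (cases s; simp)+

lemma flip_eq_iff [simp]: "flip s = flip s' \<longleftrightarrow> s = s'"
  by (cases s; cases s') auto

lemma neq_flip: "s \<noteq> s' \<longleftrightarrow> s' = flip s"
  by (cases s; cases s') auto

text \<open>
  A strand that bounds a triangle counterclockwise has the triangle on its left.
\<close>

definition inner :: "bool \<Rightarrow> side" where
  "inner d = (if d then Lft else Rgt)"

lemma all_sides_inner: "(\<forall>k. P k) \<longleftrightarrow> P (inner d) \<and> P (flip (inner d))"
  by (metis inner_def flip.simps side.exhaust)

text \<open>
  Colours are vectors modulo \<open>N\<close>.  A vector \<open>x\<close> stands for an element \<open>(x, t)\<close>, and \<open>\<delta> g\<close> for an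
  element \<open>(\<delta> g, val g)\<close>, of the semidirect product of the vectors with the units of the ring, where
  \<open>(x, r) (y, r') = (x + r y, r r')\<close>; the Fox derivative is the vector part of a homomorphism
  from the free group to such a group.  The last assumption says that the elements of the central
  generators commute modulo \<open>N\<close>.
\<close>

locale colour_module =
  fixes N :: "('g \<Rightarrow> 'r::idom) set" and t t' :: 'r
    and val val' :: "central \<Rightarrow> 'r" and \<delta> :: "central \<Rightarrow> 'g \<Rightarrow> 'r"
  assumes N: "submodule N"
    and t: "t * t' = 1" and val: "\<And>g. val g * val' g = 1"
    and commute: "\<And>g h. (1 - val h) *\<^sub>f \<delta> g - (1 - val g) *\<^sub>f \<delta> h \<in> N"
begin

definition cong (infix "\<approx>" 50) where "x \<approx> y \<longleftrightarrow> x - y \<in> N"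

lemma cong_refl [simp]: "x \<approx> x"
  using submodule_0[OF N] by (simp add: cong_def)

lemma cong_sym: "x \<approx> y \<Longrightarrow> y \<approx> x"
  using submodule_neg[OF N, of "x - y"] by (simp add: cong_def)

lemma cong_trans [trans]: "x \<approx> y \<Longrightarrow> y \<approx> z \<Longrightarrow> x \<approx> z"
  using submodule_add[OF N, of "x - y" "y - z"] by (simp add: cong_def)

lemma cong_right: "x \<approx> y \<Longrightarrow> z \<approx> x \<longleftrightarrow> z \<approx> y"
  by (blast intro: cong_trans cong_sym)

lemma cong_left: "x \<approx> y \<Longrightarrow> x \<approx> z \<longleftrightarrow> y \<approx> z"
  by (blast intro: cong_trans cong_sym)

lemma cong_add: "x \<approx> y \<Longrightarrow> x' \<approx> y' \<Longrightarrow> x + x' \<approx> y + y'"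
  using submodule_add[OF N, of "x - y" "x' - y'"] by (simp add: cong_def algebra_simps)

lemma cong_diff: "x \<approx> y \<Longrightarrow> x' \<approx> y' \<Longrightarrow> x - x' \<approx> y - y'"
  using submodule_diff[OF N, of "x - y" "x' - y'"] by (simp add: cong_def algebra_simps)

lemma cong_scale: "x \<approx> y \<Longrightarrow> r *\<^sub>f x \<approx> r *\<^sub>f y"
  using submodule_scale[OF N, of "x - y" r]
  by (simp add: cong_def scale_fun_diff)

text \<open>
  Conjugation of \<open>x\<close> by the element of \<open>g\<close> in the semidirect product, and its inverse.
\<close>

definition conj_by :: "central \<Rightarrow> ('g \<Rightarrow> 'r) \<Rightarrow> 'g \<Rightarrow> 'r" where
  "conj_by g x = val g *\<^sub>f x + (1 - t) *\<^sub>f \<delta> g"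

definition unconj_by :: "central \<Rightarrow> ('g \<Rightarrow> 'r) \<Rightarrow> 'g \<Rightarrow> 'r" where
  "unconj_by g x = val' g *\<^sub>f (x - (1 - t) *\<^sub>f \<delta> g)"

text \<open>
  The product of \<open>a\<close>, \<open>u\<close> and the inverse of \<open>conj_by CS a\<close> in the semidirect product.  It is the colour
  of an under strand on the left of the over strand, if \<open>u\<close> is its colour on the right, and \<open>a\<close> the
  colour of the over strand on the left of the under strand.
\<close>

definition under :: "('g \<Rightarrow> 'r) \<Rightarrow> ('g \<Rightarrow> 'r) \<Rightarrow> 'g \<Rightarrow> 'r" where
  "under a u = (1 - t * val CS) *\<^sub>f a + t *\<^sub>f u + (t * (t - 1)) *\<^sub>f \<delta> CS"

definition ununder :: "('g \<Rightarrow> 'r) \<Rightarrow> ('g \<Rightarrow> 'r) \<Rightarrow> 'g \<Rightarrow> 'r" where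
  "ununder a u = t' *\<^sub>f (u - (1 - t * val CS) *\<^sub>f a - (t * (t - 1)) *\<^sub>f \<delta> CS)"

lemma conj_unconj [simp]: "conj_by g (unconj_by g x) = x"
proof (rule ext)
  fix i show "conj_by g (unconj_by g x) i = x i"
    using val[of g] unfolding conj_by_def unconj_by_def scale_fun_def plus_fun_apply fun_diff_def by Groebner_Basis.algebra
qed

lemma unconj_conj [simp]: "unconj_by g (conj_by g x) = x"
proof (rule ext)
  fix i show "unconj_by g (conj_by g x) i = x i"
    using val[of g] unfolding conj_by_def unconj_by_def scale_fun_def plus_fun_apply fun_diff_def by Groebner_Basis.algebra
qed

lemma under_ununder [simp]: "under a (ununder a u) = u"
proof (rule ext)
  fix i show "under a (ununder a u) i = u i"
    using t unfolding under_def ununder_def scale_fun_def plus_fun_apply fun_diff_def by Groebner_Basis.algebra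
qed

lemma ununder_under [simp]: "ununder a (under a u) = u"
proof (rule ext)
  fix i show "ununder a (under a u) i = u i"
    using t unfolding under_def ununder_def scale_fun_def plus_fun_apply fun_diff_def by Groebner_Basis.algebra
qed

lemma under_conj [simp]: "under a (conj_by CS a) = a"
proof (rule ext)
  fix i show "under a (conj_by CS a) i = a i"
    unfolding under_def conj_by_def scale_fun_def plus_fun_apply by (simp add: algebra_simps)
qed

lemma cong_conj: "x \<approx> y \<Longrightarrow> conj_by g x \<approx> conj_by g y"
  unfolding conj_by_def by (intro cong_add cong_scale cong_refl)

lemma cong_unconj: "x \<approx> y \<Longrightarrow> unconj_by g x \<approx> unconj_by g y"
  unfolding unconj_by_def by (intro cong_diff cong_scale cong_refl)

lemma cong_under: "a \<approx> a' \<Longrightarrow> u \<approx> u' \<Longrightarrow> under a u \<approx> under a' u'"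
  unfolding under_def by (intro cong_add cong_scale cong_refl)

lemma cong_ununder: "a \<approx> a' \<Longrightarrow> u \<approx> u' \<Longrightarrow> ununder a u \<approx> ununder a' u'"
  unfolding ununder_def by (intro cong_diff cong_scale cong_refl)

lemma conj_by_commute: "conj_by h (conj_by g x) \<approx> conj_by g (conj_by h x)"
proof -
  have "conj_by h (conj_by g x) - conj_by g (conj_by h x) =
      (- (1 - t)) *\<^sub>f ((1 - val h) *\<^sub>f \<delta> g - (1 - val g) *\<^sub>f \<delta> h)"
    unfolding conj_by_def scale_fun_def plus_fun_def fun_diff_def by (rule ext) (simp add: algebra_simps)
  then show ?thesis
    unfolding cong_def using submodule_scale[OF N commute] by simp
qed

lemma under_conj_conj: "under (conj_by g a) (conj_by g u) \<approx> conj_by g (under a u)"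
proof -
  have "under (conj_by g a) (conj_by g u) - conj_by g (under a u) =
      (t * (1 - t)) *\<^sub>f ((1 - val CS) *\<^sub>f \<delta> g - (1 - val g) *\<^sub>f \<delta> CS)"
    unfolding conj_by_def under_def scale_fun_def plus_fun_def fun_diff_def by (rule ext) (simp add: algebra_simps)
  then show ?thesis
    unfolding cong_def using submodule_scale[OF N commute] by simp
qed

text \<open>
  The effect of crossing a strand of flag \<open>d\<close> outward from the triangle: left to right iff \<open>d\<close>.
\<close>

definition cross :: "bool \<Rightarrow> central \<Rightarrow> ('g \<Rightarrow> 'r) \<Rightarrow> 'g \<Rightarrow> 'r" where
  "cross d g x = (if d then conj_by g x else unconj_by g x)"

lemma cong_cross: "x \<approx> y \<Longrightarrow> cross d g x \<approx> cross d g y"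
  by (simp add: cross_def cong_conj cong_unconj)

lemma cross_commute: "cross d g (cross e h x) \<approx> cross e h (cross d g x)"
proof -
  have un: "unconj_by g (conj_by h y) \<approx> conj_by h (unconj_by g y)" for g h y
    using cong_unconj[OF conj_by_commute[of h g "unconj_by g y"], of g] by simp
  have "unconj_by g (unconj_by h y) \<approx> unconj_by h (unconj_by g y)" for y
    using cong_sym[OF cong_unconj[OF un[of g h "unconj_by h y"], of h]] by simp
  with un cong_sym[OF un] conj_by_commute show ?thesis
    by (auto simp: cross_def)
qed

lemma cross_under: "under (cross d g a) (cross d g u) \<approx> cross d g (under a u)"
proof -
  have "unconj_by g (under a u) \<approx> under (unconj_by g a) (unconj_by g u)"
    using cong_unconj[OF under_conj_conj[of g "unconj_by g a" "unconj_by g u"], of g] by simp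
  then show ?thesis
    using under_conj_conj[of g a u] by (auto simp: cross_def intro: cong_sym)
qed

text \<open>
  The arguments are the colours of the two strands of a crossing, \<open>p\<close> of the one that passes it from
  left to right and \<open>r\<close> of the other one, each on the left and on the right of the other strand.
\<close>

fun satisfies :: "law \<Rightarrow> (side \<Rightarrow> 'g \<Rightarrow> 'r) \<Rightarrow> (side \<Rightarrow> 'g \<Rightarrow> 'r) \<Rightarrow> bool" where
  "satisfies (Twist g) p r \<longleftrightarrow> p Rgt \<approx> conj_by g (p Lft) \<and> r Rgt \<approx> conj_by g (r Lft)"
| "satisfies (Even Lft) p r \<longleftrightarrow> p Rgt \<approx> conj_by CS (p Lft) \<and> r Lft \<approx> under (p Lft) (r Rgt)"
| "satisfies (Even Rgt) p r \<longleftrightarrow> r Rgt \<approx> conj_by CS (r Lft) \<and> p Lft \<approx> under (r Lft) (p Rgt)"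

lemma satisfies_swap: "satisfies (swap_law l) r p \<longleftrightarrow> satisfies l p r"
proof (cases l)
  case (Even s) then show ?thesis by (cases s) auto
qed auto

text \<open>
  The colour of an under strand of flag \<open>du\<close> outside the triangle, in terms of its colour \<open>u\<close> and the
  colour \<open>a\<close> of the over strand of flag \<open>da\<close> along the triangle.
\<close>

definition outer_under :: "bool \<Rightarrow> bool \<Rightarrow> ('g \<Rightarrow> 'r) \<Rightarrow> ('g \<Rightarrow> 'r) \<Rightarrow> 'g \<Rightarrow> 'r" where
  "outer_under du da a u =
     (let l = if du then a else unconj_by CS a in if da then ununder l u else under l u)"

lemma cong_outer_under: "a \<approx> a' \<Longrightarrow> u \<approx> u' \<Longrightarrow> outer_under du da a u \<approx> outer_under du da a' u'"
  by (auto simp: outer_under_def intro!: cong_under cong_ununder cong_unconj)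

lemma cong_conj_iff: "y \<approx> conj_by g x \<longleftrightarrow> x \<approx> unconj_by g y"
  using cong_conj[of x "unconj_by g y" g] cong_unconj[of y "conj_by g x" g] by (auto intro: cong_sym)

lemma cong_under_iff: "y \<approx> under a x \<longleftrightarrow> x \<approx> ununder a y"
  using cong_under[OF cong_refl, of x "ununder a y" a] cong_ununder[OF cong_refl, of y "under a x" a]
  by (auto intro: cong_sym)

lemma twist_step_iff: "p Rgt \<approx> conj_by g (p Lft) \<longleftrightarrow> p (flip (inner d)) \<approx> cross d g (p (inner d))"
  by (cases d) (auto simp: inner_def cross_def cong_conj_iff)

lemma twist_iff:
  "satisfies (Twist g) p r \<longleftrightarrow>
     p (flip (inner d)) \<approx> cross d g (p (inner d)) \<and> r (flip (inner e)) \<approx> cross e g (r (inner e))"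
  using twist_step_iff[of p g d] twist_step_iff[of r g e] by simp

lemma even_iff:
  "satisfies (Even Lft) p r \<longleftrightarrow>
     p (flip (inner d)) \<approx> cross d CS (p (inner d)) \<and>
     r (flip (inner e)) \<approx> outer_under d e (p (inner d)) (r (inner e))"
proof -
  have "r Lft \<approx> under (p Lft) (r Rgt) \<longleftrightarrow>
      r (flip (inner e)) \<approx> outer_under d e (p (inner d)) (r (inner e))"
    if p: "p Rgt \<approx> conj_by CS (p Lft)"
  proof -
    have l: "(if d then p (inner d) else unconj_by CS (p (inner d))) \<approx> p Lft"
      using p by (auto simp: inner_def cong_conj_iff intro: cong_sym)
    have "r (flip (inner e)) \<approx> outer_under d e (p (inner d)) (r (inner e)) \<longleftrightarrow>
        r (flip (inner e)) \<approx> (if e then ununder (p Lft) (r Lft) else under (p Lft) (r Rgt))"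
      using cong_right[OF cong_under[OF l cong_refl]] cong_right[OF cong_ununder[OF l cong_refl]]
      by (simp only: outer_under_def inner_def Let_def split: if_split) simp
    then show ?thesis by (cases e) (simp_all add: inner_def cong_under_iff)
  qed
  then show ?thesis using twist_step_iff[of p CS d] by auto
qed

text \<open>
  Submodules in which every law of a crossing can be solved.  The colours of a colouring, together
  with \<open>N\<close> and the central elements, generate the smallest enclosing submodule that contains them.
\<close>

definition encloses :: "('g \<Rightarrow> 'r) set \<Rightarrow> bool" where
  "encloses W \<longleftrightarrow> submodule W \<and> N \<subseteq> W \<and> range \<delta> \<subseteq> W"

lemma encloses_cong: "encloses W \<Longrightarrow> x \<approx> y \<Longrightarrow> x \<in> W \<longleftrightarrow> y \<in> W"
proof -
  have "y \<in> W" if "encloses W" "x \<approx> y" "x \<in> W" for x y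
    using that submodule_diff[of W x "x - y"] by (auto simp: encloses_def cong_def)
  then show "encloses W \<Longrightarrow> x \<approx> y \<Longrightarrow> x \<in> W \<longleftrightarrow> y \<in> W"
    using cong_sym by blast
qed

lemma encloses_cross: "encloses W \<Longrightarrow> x \<in> W \<Longrightarrow> cross d g x \<in> W"
  unfolding encloses_def cross_def conj_by_def unconj_by_def
  by (auto intro!: submodule_add submodule_diff submodule_scale)

lemma encloses_outer_under:
  "encloses W \<Longrightarrow> x \<in> W \<Longrightarrow> y \<in> W \<Longrightarrow> outer_under d e x y \<in> W"
  using encloses_cross[of W x False CS]
  unfolding encloses_def outer_under_def under_def ununder_def Let_def cross_def
  by (auto intro!: submodule_add submodule_diff submodule_scale)

text \<open>
  Both maps that a law involves, conjugation and the dependence of one colour of the under strand on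
  the other one, are invertible; so any colour on each of the strands can be prescribed.
\<close>

lemma law_solution:
  "\<exists>p r. satisfies l p r \<and> p i = x \<and> r j = y \<and>
     (\<forall>W. encloses W \<longrightarrow> x \<in> W \<longrightarrow> y \<in> W \<longrightarrow> (\<forall>k. p k \<in> W \<and> r k \<in> W))"
proof -
  have over: "\<exists>p r. satisfies (Even Lft) p r \<and> p i = x \<and> r j = y \<and>
     (\<forall>W. encloses W \<longrightarrow> x \<in> W \<longrightarrow> y \<in> W \<longrightarrow> (\<forall>k. p k \<in> W \<and> r k \<in> W))" for i j x y
  proof -
    obtain d e where ij: "i = inner d" "j = inner e"
      by (metis inner_def side.exhaust)
    show ?thesis
      by (intro exI[of _ "\<lambda>k. if k = i then x else cross d CS x"]
          exI[of _ "\<lambda>k. if k = j then y else outer_under d e x y"])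
         (simp add: ij even_iff[of _ _ d e] encloses_cross encloses_outer_under del: satisfies.simps)
  qed
  show ?thesis
  proof (cases l)
    case (Twist g)
    obtain d e where ij: "i = inner d" "j = inner e"
      by (metis inner_def side.exhaust)
    show ?thesis unfolding Twist
      by (intro exI[of _ "\<lambda>k. if k = i then x else cross d g x"]
          exI[of _ "\<lambda>k. if k = j then y else cross e g y"])
         (simp add: ij twist_iff[of _ _ _ d e] encloses_cross del: satisfies.simps)
  next
    case (Even s)
    then consider "l = Even Lft" | "l = swap_law (Even Lft)" by (cases s) auto
    then show ?thesis
    proof cases
      case 2
      obtain p r where "satisfies (Even Lft) p r" "p j = y" "r i = x"
        "\<And>W. encloses W \<Longrightarrow> y \<in> W \<Longrightarrow> x \<in> W \<Longrightarrow> \<forall>k. p k \<in> W \<and> r k \<in> W"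
        using over[of j y i x] by blast
      then show ?thesis
        unfolding 2 using satisfies_swap[of "Even Lft" r p]
        by (intro exI[of _ r] exI[of _ p]) (simp del: satisfies.simps)
    qed (use over in blast)
  qed
qed

lemma law_unique:
  assumes "satisfies l p r" "satisfies l p' r'" "p i \<approx> p' i" "r j \<approx> r' j"
  shows "p k \<approx> p' k \<and> r k \<approx> r' k"
proof -
  obtain d e where ij: "i = inner d" "j = inner e"
    by (metis inner_def side.exhaust)
  have over: "(\<forall>k. p k \<approx> p' k) \<and> (\<forall>k. r k \<approx> r' k)"
    if "satisfies (Even Lft) p r" "satisfies (Even Lft) p' r'" "p (inner d) \<approx> p' (inner d)"
      "r (inner e) \<approx> r' (inner e)" for p r p' r' d e
    unfolding all_sides_inner[of "\<lambda>k. p k \<approx> p' k" d] all_sides_inner[of "\<lambda>k. r k \<approx> r' k" e]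
    using that(1,2)[unfolded even_iff[of _ _ d e]] that(3,4)
      cong_cross[OF that(3), of d CS] cong_outer_under[OF that(3,4), of d e]
    by (blast intro: cong_trans cong_sym)
  have "(\<forall>k. p k \<approx> p' k) \<and> (\<forall>k. r k \<approx> r' k)"
  proof (cases l)
    case (Twist g)
    show ?thesis
      unfolding all_sides_inner[of "\<lambda>k. p k \<approx> p' k" d] all_sides_inner[of "\<lambda>k. r k \<approx> r' k" e]
      using assms(1,2)[unfolded Twist twist_iff[of _ _ _ d e]] assms(3,4)[unfolded ij]
        cong_cross[OF assms(3)[unfolded ij], of d g] cong_cross[OF assms(4)[unfolded ij], of e g]
      by (blast intro: cong_trans cong_sym)
  next
    case (Even s)
    then consider "l = Even Lft" | "l = swap_law (Even Lft)" by (cases s) auto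
    then show ?thesis
    proof cases
      case 1 then show ?thesis using over[of p r p' r' d e] assms ij by (simp del: satisfies.simps)
    next
      case 2
      have "satisfies (Even Lft) r p" "satisfies (Even Lft) r' p'"
        using assms(1,2) satisfies_swap[of "Even Lft" p r] satisfies_swap[of "Even Lft" p' r']
        unfolding 2 by blast+
      then show ?thesis using over[of r p r' p' e d] assms(3,4) ij by blast
    qed
  qed
  then show ?thesis by blast
qed

lemma law_encloses:
  assumes "satisfies l p r" "encloses W" "p i \<in> W" "r j \<in> W"
  shows "p k \<in> W \<and> r k \<in> W"
proof -
  obtain p' r' where p': "satisfies l p' r'" "p' i = p i" "r' j = r j" "p' k \<in> W \<and> r' k \<in> W"
    using law_solution[of l i "p i" j "r j"] assms by metis
  then have "p k \<approx> p' k \<and> r k \<approx> r' k"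
    using law_unique[OF assms(1) p'(1), of i j k] by simp
  then show ?thesis using p'(4) encloses_cong[OF assms(2)] by blast
qed

lemma outer_under_diagonal: "outer_under d d x x = cross d CS x"
  using ununder_under[of x "conj_by CS x"] under_conj[of "unconj_by CS x"]
  by (simp add: outer_under_def cross_def)

text \<open>
  At an even crossing let both strands have the colour \<open>x\<close> on the left or \<open>s x s\<inverse>\<close> on the right.  In
  the semidirect product, \<open>x = x (s x s\<inverse>) (s x s\<inverse>)\<inverse>\<close>, which is the law of the under strand for
  the colours \<open>x\<close> on the left and \<open>s x s\<inverse>\<close> on the right.
\<close>

lemma law_diagonal:
  assumes "satisfies l p r" "p k \<approx> r k"
  shows "p (flip k) \<approx> r (flip k)"
proof -
  obtain d where k: "k = inner d" by (metis inner_def side.exhaust)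
  have over: "p (flip k) \<approx> r (flip k)" if "satisfies (Even Lft) p r" "p k \<approx> r k" for p r
  proof -
    have "p (flip k) \<approx> cross d CS (p k)" "r (flip k) \<approx> outer_under d d (p k) (r k)"
      using that(1) unfolding k even_iff[of p r d d] by blast+
    moreover have "outer_under d d (p k) (r k) \<approx> cross d CS (p k)"
      using cong_outer_under[OF cong_refl cong_sym[OF that(2)], of d d "p k"]
      by (simp add: outer_under_diagonal)
    ultimately show ?thesis by (blast intro: cong_trans cong_sym)
  qed
  show ?thesis
  proof (cases l)
    case (Twist g)
    then have "p (flip k) \<approx> cross d g (p k)" "r (flip k) \<approx> cross d g (r k)"
      using assms(1) unfolding k Twist twist_iff[of g p r d d] by blast+
    then show ?thesis using cong_cross[OF assms(2), of d g] by (blast intro: cong_trans cong_sym)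
  next
    case (Even s)
    then consider "l = Even Lft" | "l = swap_law (Even Lft)" by (cases s) auto
    then show ?thesis
      using over[of p r] over[of r p] assms satisfies_swap[of "Even Lft" p r]
      by cases (blast intro: cong_sym)+
  qed
qed

lemma cross_outer_under:
  "outer_under du da (cross d g x) (cross d g y) \<approx> cross d g (outer_under du da x y)"
proof -
  let ?l = "\<lambda>x. if du then x else unconj_by CS x"
  have l: "?l (cross d g x) \<approx> cross d g (?l x)"
    using cross_commute[of False CS d g x] by (simp add: cross_def[of False])
  have "under (?l (cross d g x)) (cross d g y) \<approx> cross d g (under (?l x) y)"
    using cong_under[OF l cong_refl] cross_under by (blast intro: cong_trans)
  moreover have "ununder (?l (cross d g x)) (cross d g y) \<approx> cross d g (ununder (?l x) y)"
  proof -
    have "cross d g y \<approx> under (cross d g (?l x)) (cross d g (ununder (?l x) y))"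
      using cross_under[of d g "?l x" "ununder (?l x) y"] by (simp add: cong_sym)
    then have "cross d g (ununder (?l x) y) \<approx> ununder (cross d g (?l x)) (cross d g y)"
      by (simp add: cong_under_iff)
    with cong_ununder[OF l cong_refl] show ?thesis by (blast intro: cong_trans cong_sym)
  qed
  ultimately show ?thesis by (simp add: outer_under_def Let_def)
qed

text \<open>
  Conjugation by a central element is an automorphism that fixes the central elements, and so it
  respects all laws.
\<close>

lemma satisfies_cross:
  assumes "satisfies l p r"
  shows "satisfies l (\<lambda>k. cross d g (p k)) (\<lambda>k. cross d g (r k))"
proof -
  have over: "satisfies (Even Lft) (\<lambda>k. cross d g (p k)) (\<lambda>k. cross d g (r k))"
    if "satisfies (Even Lft) p r" for p r
  proof -
    have 1: "p (flip (inner True)) \<approx> cross True CS (p (inner True))"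
      and 2: "r (flip (inner True)) \<approx> outer_under True True (p (inner True)) (r (inner True))"
      using that unfolding even_iff[of p r True True] by blast+
    show ?thesis
      unfolding even_iff[of "\<lambda>k. cross d g (p k)" _ True True]
      using cong_cross[OF 1, of d g] cong_cross[OF 2, of d g] cross_commute cross_outer_under
      by (blast intro: cong_trans cong_sym)
  qed
  show ?thesis
  proof (cases l)
    case (Twist h)
    have 1: "p (flip (inner True)) \<approx> cross True h (p (inner True))"
      and 2: "r (flip (inner True)) \<approx> cross True h (r (inner True))"
      using assms unfolding Twist twist_iff[of h p r True True] by blast+
    show ?thesis
      unfolding Twist twist_iff[of h "\<lambda>k. cross d g (p k)" _ True True]
      using cong_cross[OF 1, of d g] cong_cross[OF 2, of d g] cross_commute
      by (blast intro: cong_trans)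
  next
    case (Even s)
    then consider "l = Even Lft" | "l = swap_law (Even Lft)" by (cases s) auto
    then show ?thesis
      using over[of p r] over[of r p] assms satisfies_swap[of "Even Lft" p r]
        satisfies_swap[of "Even Lft" "\<lambda>k. cross d g (p k)" "\<lambda>k. cross d g (r k)"]
      by cases blast+
  qed
qed

text \<open>
  Replace a colour by its conjugate by the power of \<open>s\<close> given by an Alexander numbering of the regions
  around the triangle.  Then the over strand keeps its colour at an even crossing, and the under
  strand passes from the colour \<open>\<lambda> y + (1 - \<lambda>) x\<close> on the left of \<open>x\<close> to \<open>y\<close> on the right, with
  \<open>\<lambda> = s t\<close>.  This is the Alexander quandle, and the identity is its self-distributivity.
\<close>

lemma outer_under_distributive:
  "outer_under d3 d1 (cross d2 CS x) (outer_under d3 d2 y z) =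
   outer_under d3 d2 (outer_under d2 d1 x y) (outer_under d3 d1 x z)"
proof (rule ext)
  fix i
  have s: "val CS * val' CS = 1" by (rule val)
  show "outer_under d3 d1 (cross d2 CS x) (outer_under d3 d2 y z) i =
    outer_under d3 d2 (outer_under d2 d1 x y) (outer_under d3 d1 x z) i"
    using s t
    by (cases d1; cases d2; cases d3; simp only: outer_under_def cross_def Let_def if_True if_False
        conj_by_def unconj_by_def under_def ununder_def scale_fun_def plus_fun_apply fun_diff_def;
        Groebner_Basis.algebra)
qed

section \<open>Sliding a strand across a triangle\<close>

text \<open>
  \<open>pij\<close> are the colours of strand \<open>i\<close> on the two sides of strand \<open>j\<close>.  Before the move the inner colours
  of a strand at its two crossings agree.  Moving a strand across the opposite crossing reverses the
  order of the crossings along each strand and turns the triangle inside out: the old outer colours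
  become inner colours at the other crossing, and the new outer colours have to agree.
  The directions of the strands enter only through the sides on which the triangle lies, so that the
  condition is symmetric in the three strands.
\<close>

definition triangle_slides :: "bool \<Rightarrow> bool \<Rightarrow> bool \<Rightarrow> law \<Rightarrow> law \<Rightarrow> law \<Rightarrow> bool" where
  "triangle_slides d1 d2 d3 l12 l13 l23 \<longleftrightarrow> (\<forall>p12 p21 p13 p31 p23 p32.
     satisfies l12 p12 p21 \<longrightarrow> satisfies l13 p13 p31 \<longrightarrow> satisfies l23 p23 p32 \<longrightarrow>
     p12 (inner d2) \<approx> p13 (inner d3) \<longrightarrow> p21 (inner d1) \<approx> p23 (inner d3) \<longrightarrow>
     p31 (inner d1) \<approx> p32 (inner d2) \<longrightarrow>
     (\<exists>r12 r21 r13 r31 r23 r32.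
        satisfies l12 r12 r21 \<and> satisfies l13 r13 r31 \<and> satisfies l23 r23 r32 \<and>
        r12 (inner d2) \<approx> p13 (flip (inner d3)) \<and> r13 (inner d3) \<approx> p12 (flip (inner d2)) \<and>
        r21 (inner d1) \<approx> p23 (flip (inner d3)) \<and> r23 (inner d3) \<approx> p21 (flip (inner d1)) \<and>
        r31 (inner d1) \<approx> p32 (flip (inner d2)) \<and> r32 (inner d2) \<approx> p31 (flip (inner d1)) \<and>
        r12 (flip (inner d2)) \<approx> r13 (flip (inner d3)) \<and>
        r21 (flip (inner d1)) \<approx> r23 (flip (inner d3)) \<and>
        r31 (flip (inner d1)) \<approx> r32 (flip (inner d2))))"

lemma triangle_slides_swap_12:
  assumes "triangle_slides d2 d1 d3 (swap_law l12) l23 l13"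
  shows "triangle_slides d1 d2 d3 l12 l13 l23"
  unfolding triangle_slides_def
proof (intro allI impI)
  fix p12 p21 p13 p31 p23 p32
  assume l: "satisfies l12 p12 p21" "satisfies l13 p13 p31" "satisfies l23 p23 p32"
    and c: "p12 (inner d2) \<approx> p13 (inner d3)" "p21 (inner d1) \<approx> p23 (inner d3)"
      "p31 (inner d1) \<approx> p32 (inner d2)"
  have l': "satisfies (swap_law l12) p21 p12" using l(1) by (simp only: satisfies_swap)
  from assms[unfolded triangle_slides_def, rule_format, OF l' l(3) l(2) c(2) c(1) cong_sym[OF c(3)]]
  obtain r12 r21 r13 r31 r23 r32 where r: "satisfies (swap_law l12) r21 r12" "satisfies l13 r13 r31"
    "satisfies l23 r23 r32"
    "r12 (inner d2) \<approx> p13 (flip (inner d3))" "r13 (inner d3) \<approx> p12 (flip (inner d2))"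
    "r21 (inner d1) \<approx> p23 (flip (inner d3))" "r23 (inner d3) \<approx> p21 (flip (inner d1))"
    "r31 (inner d1) \<approx> p32 (flip (inner d2))" "r32 (inner d2) \<approx> p31 (flip (inner d1))"
    "r12 (flip (inner d2)) \<approx> r13 (flip (inner d3))"
    "r21 (flip (inner d1)) \<approx> r23 (flip (inner d3))"
    "r32 (flip (inner d2)) \<approx> r31 (flip (inner d1))" by blast
  show "\<exists>r12 r21 r13 r31 r23 r32.
        satisfies l12 r12 r21 \<and> satisfies l13 r13 r31 \<and> satisfies l23 r23 r32 \<and>
        r12 (inner d2) \<approx> p13 (flip (inner d3)) \<and> r13 (inner d3) \<approx> p12 (flip (inner d2)) \<and>
        r21 (inner d1) \<approx> p23 (flip (inner d3)) \<and> r23 (inner d3) \<approx> p21 (flip (inner d1)) \<and>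
        r31 (inner d1) \<approx> p32 (flip (inner d2)) \<and> r32 (inner d2) \<approx> p31 (flip (inner d1)) \<and>
        r12 (flip (inner d2)) \<approx> r13 (flip (inner d3)) \<and>
        r21 (flip (inner d1)) \<approx> r23 (flip (inner d3)) \<and>
        r31 (flip (inner d1)) \<approx> r32 (flip (inner d2))"
    by (intro exI[of _ r12] exI[of _ r21] exI[of _ r13] exI[of _ r31] exI[of _ r23] exI[of _ r32]
        conjI r(1)[unfolded satisfies_swap] r(2-11) cong_sym[OF r(12)])
qed

lemma triangle_slides_swap_23:
  assumes "triangle_slides d1 d3 d2 l13 l12 (swap_law l23)"
  shows "triangle_slides d1 d2 d3 l12 l13 l23"
  unfolding triangle_slides_def
proof (intro allI impI)
  fix p12 p21 p13 p31 p23 p32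
  assume l: "satisfies l12 p12 p21" "satisfies l13 p13 p31" "satisfies l23 p23 p32"
    and c: "p12 (inner d2) \<approx> p13 (inner d3)" "p21 (inner d1) \<approx> p23 (inner d3)"
      "p31 (inner d1) \<approx> p32 (inner d2)"
  have l': "satisfies (swap_law l23) p32 p23" using l(3) by (simp only: satisfies_swap)
  from assms[unfolded triangle_slides_def, rule_format, OF l(2) l(1) l' cong_sym[OF c(1)] c(3) c(2)]
  obtain r12 r21 r13 r31 r23 r32 where r: "satisfies l12 r12 r21" "satisfies l13 r13 r31"
    "satisfies (swap_law l23) r32 r23"
    "r12 (inner d2) \<approx> p13 (flip (inner d3))" "r13 (inner d3) \<approx> p12 (flip (inner d2))"
    "r21 (inner d1) \<approx> p23 (flip (inner d3))" "r23 (inner d3) \<approx> p21 (flip (inner d1))"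
    "r31 (inner d1) \<approx> p32 (flip (inner d2))" "r32 (inner d2) \<approx> p31 (flip (inner d1))"
    "r13 (flip (inner d3)) \<approx> r12 (flip (inner d2))"
    "r21 (flip (inner d1)) \<approx> r23 (flip (inner d3))"
    "r31 (flip (inner d1)) \<approx> r32 (flip (inner d2))" by blast
  show "\<exists>r12 r21 r13 r31 r23 r32.
        satisfies l12 r12 r21 \<and> satisfies l13 r13 r31 \<and> satisfies l23 r23 r32 \<and>
        r12 (inner d2) \<approx> p13 (flip (inner d3)) \<and> r13 (inner d3) \<approx> p12 (flip (inner d2)) \<and>
        r21 (inner d1) \<approx> p23 (flip (inner d3)) \<and> r23 (inner d3) \<approx> p21 (flip (inner d1)) \<and>
        r31 (inner d1) \<approx> p32 (flip (inner d2)) \<and> r32 (inner d2) \<approx> p31 (flip (inner d1)) \<and>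
        r12 (flip (inner d2)) \<approx> r13 (flip (inner d3)) \<and>
        r21 (flip (inner d1)) \<approx> r23 (flip (inner d3)) \<and>
        r31 (flip (inner d1)) \<approx> r32 (flip (inner d2))"
    by (intro exI[of _ r12] exI[of _ r21] exI[of _ r13] exI[of _ r31] exI[of _ r23] exI[of _ r32]
        conjI r(3)[unfolded satisfies_swap] r(1,2,4-9,11,12) cong_sym[OF r(10)])
qed

text \<open>
  Strands 1 and 2 cross on the inner side of strand 3 before the move and on its outer side
  afterwards.  As strand 3 conjugates whatever crosses it, all four colours at their crossing are
  conjugated.  Strand 3 itself is conjugated twice by powers of \<open>g\<close>, and the order does not matter.
\<close>

lemma triangle_slides_detour:
  "triangle_slides d1 d2 d3 l (Twist g) (Twist g)"
  unfolding triangle_slides_def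
proof (intro allI impI)
  fix p12 p21 p13 p31 p23 p32
  assume l: "satisfies l p12 p21" and l13: "satisfies (Twist g) p13 p31"
    and l23: "satisfies (Twist g) p23 p32"
    and c: "p12 (inner d2) \<approx> p13 (inner d3)" "p21 (inner d1) \<approx> p23 (inner d3)"
      "p31 (inner d1) \<approx> p32 (inner d2)"
  let ?T = "\<lambda>d. cross d g"
  have 13: "p13 (flip (inner d3)) \<approx> ?T d3 (p13 (inner d3))" "p31 (flip (inner d1)) \<approx> ?T d1 (p31 (inner d1))"
    using l13 unfolding twist_iff[of g p13 p31 d3 d1] by blast+
  have 23: "p23 (flip (inner d3)) \<approx> ?T d3 (p23 (inner d3))" "p32 (flip (inner d2)) \<approx> ?T d2 (p32 (inner d2))"
    using l23 unfolding twist_iff[of g p23 p32 d3 d2] by blast+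
  define step where "step d x = (\<lambda>k. if k = inner d then x else ?T d x)" for d and x :: "'g \<Rightarrow> 'r"
  have step [simp]: "step d x (inner d) = x" "step d x (flip (inner d)) = ?T d x" for d x
    by (simp_all add: step_def)
  show "\<exists>r12 r21 r13 r31 r23 r32.
        satisfies l r12 r21 \<and> satisfies (Twist g) r13 r31 \<and> satisfies (Twist g) r23 r32 \<and>
        r12 (inner d2) \<approx> p13 (flip (inner d3)) \<and> r13 (inner d3) \<approx> p12 (flip (inner d2)) \<and>
        r21 (inner d1) \<approx> p23 (flip (inner d3)) \<and> r23 (inner d3) \<approx> p21 (flip (inner d1)) \<and>
        r31 (inner d1) \<approx> p32 (flip (inner d2)) \<and> r32 (inner d2) \<approx> p31 (flip (inner d1)) \<and>
        r12 (flip (inner d2)) \<approx> r13 (flip (inner d3)) \<and>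
        r21 (flip (inner d1)) \<approx> r23 (flip (inner d3)) \<and>
        r31 (flip (inner d1)) \<approx> r32 (flip (inner d2))"
  proof (intro exI conjI)
    show "satisfies l (\<lambda>k. ?T d3 (p12 k)) (\<lambda>k. ?T d3 (p21 k))"
      by (rule satisfies_cross[OF l])
    show "satisfies (Twist g) (step d3 (p12 (flip (inner d2)))) (step d1 (p32 (flip (inner d2))))"
      unfolding twist_iff[of g _ _ d3 d1] by simp
    show "satisfies (Twist g) (step d3 (p21 (flip (inner d1)))) (step d2 (p31 (flip (inner d1))))"
      unfolding twist_iff[of g _ _ d3 d2] by simp
    show "?T d3 (p12 (inner d2)) \<approx> p13 (flip (inner d3))"
      using cong_cross[OF c(1)] 13(1) by (blast intro: cong_trans cong_sym)
    show "?T d3 (p21 (inner d1)) \<approx> p23 (flip (inner d3))"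
      using cong_cross[OF c(2)] 23(1) by (blast intro: cong_trans cong_sym)
    have "?T d1 (p32 (flip (inner d2))) \<approx> ?T d1 (?T d2 (p32 (inner d2)))"
      by (rule cong_cross[OF 23(2)])
    also have "\<dots> \<approx> ?T d2 (?T d1 (p32 (inner d2)))" by (rule cross_commute)
    also have "\<dots> \<approx> ?T d2 (p31 (flip (inner d1)))"
      using cong_cross[OF c(3), of d1 g] 13(2) by (intro cong_cross) (blast intro: cong_trans cong_sym)
    finally show "step d1 (p32 (flip (inner d2))) (flip (inner d1)) \<approx>
        step d2 (p31 (flip (inner d1))) (flip (inner d2))" by simp
  qed simp_all
qed

text \<open>
  Strand 1 is on top of strand 2, and strand 2 on top of strand 3.  The agreement of the new colours
  is commutation of conjugations on strand 1, equivariance under conjugation on strand 2, and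
  distributivity on strand 3.
\<close>

lemma triangle_slides_layered:
  "triangle_slides d1 d2 d3 (Even Lft) (Even Lft) (Even Lft)"
  unfolding triangle_slides_def
proof (intro allI impI)
  fix p12 p21 p13 p31 p23 p32
  assume l: "satisfies (Even Lft) p12 p21" "satisfies (Even Lft) p13 p31" "satisfies (Even Lft) p23 p32"
    and c: "p12 (inner d2) \<approx> p13 (inner d3)" "p21 (inner d1) \<approx> p23 (inner d3)"
      "p31 (inner d1) \<approx> p32 (inner d2)"
  let ?A = "\<lambda>d. cross d CS" and ?G = outer_under
  let ?x = "p12 (inner d2)" and ?y = "p21 (inner d1)" and ?z = "p31 (inner d1)"
  have 12: "p12 (flip (inner d2)) \<approx> ?A d2 ?x" "p21 (flip (inner d1)) \<approx> ?G d2 d1 ?x ?y"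
    using l(1) unfolding even_iff[of p12 p21 d2 d1] by blast+
  have 13: "p13 (flip (inner d3)) \<approx> ?A d3 ?x" "p31 (flip (inner d1)) \<approx> ?G d3 d1 ?x ?z"
    using l(2) cong_cross[OF c(1), of d3 CS] cong_outer_under[OF c(1) cong_refl, of d3 d1 ?z]
    unfolding even_iff[of p13 p31 d3 d1] by (blast intro: cong_trans cong_sym)+
  have 23: "p23 (flip (inner d3)) \<approx> ?A d3 ?y" "p32 (flip (inner d2)) \<approx> ?G d3 d2 ?y ?z"
    using l(3) cong_cross[OF c(2), of d3 CS] cong_outer_under[OF c(2,3), of d3 d2]
    unfolding even_iff[of p23 p32 d3 d2] by (blast intro: cong_trans cong_sym)+
  define over where "over d x = (\<lambda>k. if k = inner d then x else ?A d x)" for d and x :: "'g \<Rightarrow> 'r"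
  define below where "below d e x y = (\<lambda>k. if k = inner e then y else ?G d e x y)"
    for d e and x y :: "'g \<Rightarrow> 'r"
  have [simp]: "over d x (inner d) = x" "over d x (flip (inner d)) = ?A d x"
    "below d e x y (inner e) = y" "below d e x y (flip (inner e)) = ?G d e x y" for d e x y
    by (simp_all add: over_def below_def)
  have sat: "satisfies (Even Lft) (over d x) (below d e x y)" for d e x y
    unfolding even_iff[of _ _ d e] by simp
  show "\<exists>r12 r21 r13 r31 r23 r32.
        satisfies (Even Lft) r12 r21 \<and> satisfies (Even Lft) r13 r31 \<and> satisfies (Even Lft) r23 r32 \<and>
        r12 (inner d2) \<approx> p13 (flip (inner d3)) \<and> r13 (inner d3) \<approx> p12 (flip (inner d2)) \<and>
        r21 (inner d1) \<approx> p23 (flip (inner d3)) \<and> r23 (inner d3) \<approx> p21 (flip (inner d1)) \<and>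
        r31 (inner d1) \<approx> p32 (flip (inner d2)) \<and> r32 (inner d2) \<approx> p31 (flip (inner d1)) \<and>
        r12 (flip (inner d2)) \<approx> r13 (flip (inner d3)) \<and>
        r21 (flip (inner d1)) \<approx> r23 (flip (inner d3)) \<and>
        r31 (flip (inner d1)) \<approx> r32 (flip (inner d2))"
    by (rule exI[of _ "over d2 (?A d3 ?x)"], rule exI[of _ "below d2 d1 (?A d3 ?x) (?A d3 ?y)"],
        rule exI[of _ "over d3 (?A d2 ?x)"], rule exI[of _ "below d3 d1 (?A d2 ?x) (?G d3 d2 ?y ?z)"],
        rule exI[of _ "over d3 (?G d2 d1 ?x ?y)"],
        rule exI[of _ "below d3 d2 (?G d2 d1 ?x ?y) (?G d3 d1 ?x ?z)"])
       (simp add: sat 12[THEN cong_sym] 13[THEN cong_sym] 23[THEN cong_sym] cross_commute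
         cross_outer_under outer_under_distributive del: satisfies.simps)
qed

end

section \<open>Parity of crossings under the moves\<close>

text \<open>
  The number of occurrences of \<open>c\<close> at even positions minus that at odd positions.  Two occurrences are
  separated by an odd number of letters iff their positions have the same parity, that is, iff their
  signs do not cancel; and the sum is easy to follow under the moves.
\<close>

fun alternating_count :: "'a \<Rightarrow> 'a list \<Rightarrow> int" where
  "alternating_count c [] = 0"
| "alternating_count c (x # xs) = (if x = c then 1 else 0) - alternating_count c xs"

lemma alternating_count_append:
  "alternating_count c (u @ v) = alternating_count c u + (- 1) ^ length u * alternating_count c v"
  by (induction u) (auto simp: algebra_simps)

lemma alternating_count_notin: "c \<notin> set u \<Longrightarrow> alternating_count c u = 0"
  by (induction u) auto

lemma alternating_count_map:
  "inj_on f (insert c (set u)) \<Longrightarrow> alternating_count (f c) (map f u) = alternating_count c u"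
  by (induction u) (auto simp: inj_on_def)

lemma neg_one_power_cases: "(- 1) ^ n = (1::int) \<or> (- 1) ^ n = (- 1 :: int)"
  by (cases "even n") auto

lemma odd_gap_iff_alternating_count:
  assumes "count_list ws c = 2"
  shows "(\<exists>u v x. ws = u @ [c] @ v @ [c] @ x \<and> odd (length v)) \<longleftrightarrow> alternating_count c ws \<noteq> 0"
proof -
  have *: "odd (length v) \<longleftrightarrow> alternating_count c ws \<noteq> 0" if ws: "ws = u @ [c] @ v @ [c] @ x" for u v x
  proof -
    have "count_list u c = 0" "count_list v c = 0" "count_list x c = 0"
      using assms by (auto simp: ws)
    then have "c \<notin> set u" "c \<notin> set v" "c \<notin> set x"
      by (simp_all add: count_list_0_iff)
    then show ?thesis
      by (cases "even (length v)") (simp_all add: ws alternating_count_append alternating_count_notin)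
  qed
  have "c \<in> set ws" using assms count_list_0_iff[of ws c] by auto
  then obtain u y where u: "ws = u @ c # y" "c \<notin> set u" by (auto dest: split_list_first)
  then have "count_list y c = 1" using assms by (simp add: count_list_0_iff[THEN iffD2])
  then have "c \<in> set y" using count_list_0_iff[of y c] by auto
  then obtain v x where "y = v @ c # x" by (auto dest: split_list)
  with u have "ws = u @ [c] @ v @ [c] @ x" by simp
  with * show ?thesis by blast
qed

definition classical_word :: "vdiagram \<Rightarrow> nat list" where
  "classical_word K = filter (classical (snd K)) (map fst (fst K))"

lemma classical_word_append [simp]:
  "classical_word (u @ v, \<kappa>) = classical_word (u, \<kappa>) @ classical_word (v, \<kappa>)"
  by (simp add: classical_word_def)

lemma classical_word_Nil [simp]: "classical_word ([], \<kappa>) = []"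
  by (simp add: classical_word_def)

lemma classical_word_Cons [simp]:
  "classical_word (p # w, \<kappa>) = (if classical \<kappa> (fst p) then [fst p] else []) @ classical_word (w, \<kappa>)"
  by (simp add: classical_word_def)

lemma set_classical_word: "set (classical_word (w, \<kappa>)) \<subseteq> fst ` set w"
  by (auto simp: classical_word_def)

lemma closed_word_mem:
  assumes "closed_word w" "c \<in> fst ` set w"
  shows "(c, s) \<in> set w"
proof -
  obtain s' where "(c, s') \<in> set w" using assms(2) by auto
  moreover from this have "(c, flip s') \<in> set w" using assms(1) by (simp add: closed_word_def)
  ultimately show ?thesis by (cases "s = s'") (auto simp: neq_flip)
qed

lemma set_closed_word: "closed_word w \<Longrightarrow> set w = fst ` set w \<times> UNIV"
  using closed_word_mem by force

lemma UNIV_side: "UNIV = {Lft, Rgt}"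
  using side.exhaust by auto

lemma even_length_closed_word: "closed_word w \<Longrightarrow> even (length w)"
proof -
  assume w: "closed_word w"
  then have "length w = card (set w)" by (simp add: closed_word_def distinct_card)
  also have "\<dots> = card (fst ` set w \<times> (UNIV :: side set))"
    using set_closed_word[OF w] by metis
  finally show ?thesis by (simp add: card_cartesian_product UNIV_side)
qed

lemma even_length_classical_word:
  assumes "closed_word w" shows "even (length (classical_word (w, \<kappa>)))"
proof -
  have "closed_word (filter (\<lambda>p. classical \<kappa> (fst p)) w)"
    using assms by (auto simp: closed_word_def)
  then show ?thesis
    using even_length_closed_word by (fastforce simp: classical_word_def filter_map o_def)
qed

lemma count_list_map_fst: "count_list (map fst w) c = length (filter (\<lambda>p. fst p = c) w)"
  by (induction w) auto

lemma count_list_filter_eq: "P c \<Longrightarrow> count_list (filter P xs) c = count_list xs c"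
  by (induction xs) auto

lemma count_classical_word:
  assumes w: "closed_word w" and c: "classical \<kappa> c" "c \<in> fst ` set w"
  shows "count_list (classical_word (w, \<kappa>)) c = 2"
proof -
  have "count_list (classical_word (w, \<kappa>)) c = length (filter (\<lambda>p. fst p = c) w)"
    by (simp add: classical_word_def count_list_filter_eq c(1) count_list_map_fst)
  also have "\<dots> = card (set (filter (\<lambda>p. fst p = c) w))"
    using w by (subst distinct_card) (auto simp: closed_word_def)
  also have "set (filter (\<lambda>p. fst p = c) w) = {c} \<times> UNIV"
    using closed_word_mem[OF w c(2)] by auto
  finally show ?thesis by (simp add: card_cartesian_product UNIV_side)
qed

lemma odd_crossing_iff:
  assumes "closed_word w" "classical \<kappa> c" "c \<in> fst ` set w"
  shows "odd_crossing (w, \<kappa>) c \<longleftrightarrow> alternating_count c (classical_word (w, \<kappa>)) \<noteq> 0"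
  using odd_gap_iff_alternating_count[OF count_classical_word[OF assms]]
  by (simp add: odd_crossing_def classical_word_def)

definition law_of :: "vdiagram \<Rightarrow> nat \<Rightarrow> law" where
  "law_of K c =
     (if snd K c = Virt then Twist CQ
      else if odd_crossing K c then Twist CT
      else if snd K c = Pos then Even Lft else Even Rgt)"

lemma law_of_cong:
  assumes "closed_word w" "c \<in> fst ` set w" "closed_word w'" "c' \<in> fst ` set w'"
    and kind: "\<kappa> c = \<kappa>' c'"
    and parity: "classical \<kappa> c \<Longrightarrow> alternating_count c (classical_word (w, \<kappa>)) = 0 \<longleftrightarrow>
      alternating_count c' (classical_word (w', \<kappa>')) = 0"
  shows "law_of (w, \<kappa>) c = law_of (w', \<kappa>') c'"
proof (cases "\<kappa> c = Virt")
  case False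
  then have "classical \<kappa> c" "classical \<kappa>' c'" using kind by (simp_all add: classical_def)
  then have "odd_crossing (w, \<kappa>) c \<longleftrightarrow> odd_crossing (w', \<kappa>') c'"
    using odd_crossing_iff assms by simp
  then show ?thesis by (simp add: law_of_def kind)
qed (use kind in \<open>simp add: law_of_def\<close>)

text \<open>
  A change of base point multiplies the alternating count by a sign, since the classical word has
  even length.
\<close>

lemma law_of_rebase:
  assumes w: "closed_word (u @ v)" "closed_word (v @ u)" and c: "c \<in> fst ` set (u @ v)"
  shows "law_of (v @ u, \<kappa>) c = law_of (u @ v, \<kappa>) c"
proof (rule law_of_cong)
  let ?m = "\<lambda>w. length (classical_word (w, \<kappa>))" and ?a = "\<lambda>w. alternating_count c (classical_word (w, \<kappa>))"
  have "even (?m u) \<longleftrightarrow> even (?m v)"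
    using even_length_classical_word[OF w(1), of \<kappa>] by simp
  then show "?a (v @ u) = 0 \<longleftrightarrow> ?a (u @ v) = 0"
    by (cases "even (?m u)") (auto simp: alternating_count_append)
qed (use w c in auto)

lemma law_of_relabel:
  assumes w: "closed_word w" "closed_word (map (map_prod f id) w)"
    and f: "inj_on f (fst ` set w)" and \<kappa>: "\<And>c. c \<in> fst ` set w \<Longrightarrow> \<kappa>' (f c) = \<kappa> c"
    and c: "c \<in> fst ` set w"
  shows "law_of (map (map_prod f id) w, \<kappa>') (f c) = law_of (w, \<kappa>) c"
proof (rule law_of_cong)
  have "filter (classical \<kappa>') (map f xs) = map f (filter (classical \<kappa>) xs)"
    if "set xs \<subseteq> fst ` set w" for xs
    using that \<kappa> by (induction xs) (auto simp: classical_def)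
  from this[of "map fst w"]
  have "classical_word (map (map_prod f id) w, \<kappa>') = map f (classical_word (w, \<kappa>))"
    by (simp add: classical_word_def o_def)
  moreover have "inj_on f (insert c (set (classical_word (w, \<kappa>))))"
    by (rule inj_on_subset[OF f]) (use c set_classical_word in auto)
  ultimately show "alternating_count (f c) (classical_word (map (map_prod f id) w, \<kappa>')) = 0 \<longleftrightarrow>
      alternating_count c (classical_word (w, \<kappa>)) = 0"
    by (simp add: alternating_count_map)
qed (use w c \<kappa> in \<open>auto simp: image_iff\<close>)

lemma law_of_move_I:
  assumes w: "closed_word (u @ v)" "closed_word (u @ [(c, s), (c, flip s)] @ v)"
    and c': "c' \<in> fst ` set (u @ v)"
  shows "law_of (u @ [(c, s), (c, flip s)] @ v, \<kappa>) c' = law_of (u @ v, \<kappa>) c'"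
  by (rule law_of_cong) (use w c' in \<open>auto simp: alternating_count_append\<close>)

lemma law_of_move_II:
  assumes w: "closed_word (u1 @ u2 @ u3)" "closed_word (u1 @ [(a, s), (b, flip s)] @ u2 @ x @ u3)"
    and x: "x = [(a, flip s), (b, s)] \<or> x = [(b, s), (a, flip s)]"
    and adm: "second_move_admissible \<kappa> a b s"
    and c: "c \<in> fst ` set (u1 @ u2 @ u3)"
  shows "law_of (u1 @ [(a, s), (b, flip s)] @ u2 @ x @ u3, \<kappa>) c = law_of (u1 @ u2 @ u3, \<kappa>) c"
proof (rule law_of_cong)
  have "distinct (u1 @ [(a, s), (b, flip s)] @ u2 @ x @ u3)" using w(2) by (simp add: closed_word_def)
  then have "(a, s) \<notin> set (u1 @ u2 @ u3)" "(b, flip s) \<notin> set (u1 @ u2 @ u3)" by auto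
  then have "c \<noteq> a" "c \<noteq> b" using closed_word_mem[OF w(1) c] by metis+
  moreover have "classical \<kappa> a \<longleftrightarrow> classical \<kappa> b"
    using adm by (auto simp: second_move_admissible_def classical_def)
  ultimately show "alternating_count c (classical_word (u1 @ [(a, s), (b, flip s)] @ u2 @ x @ u3, \<kappa>)) = 0 \<longleftrightarrow>
      alternating_count c (classical_word (u1 @ u2 @ u3, \<kappa>)) = 0"
    using x by (auto simp: alternating_count_append add.commute)
qed (use w c x in auto)

text \<open>
  The law of a crossing as seen from the strand that passes it as \<open>s\<close>: the result is \<open>Even Lft\<close> iff the
  crossing is even and this strand is on top.
\<close>

definition law_from :: "side \<Rightarrow> law \<Rightarrow> law" where
  "law_from s l = (if s = Lft then l else swap_law l)"

text \<open>
  Seen from the first arc of the bigon the two crossings have the same law.  If they are classical,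
  then they have the same parity, as their positions differ by one on each of the two arcs, and the
  same arc is on top at both.
\<close>

lemma law_of_bigon:
  assumes w: "closed_word (u1 @ [(a, s), (b, flip s)] @ u2 @ x @ u3)" (is "closed_word ?w")
    and x: "x = [(a, flip s), (b, s)] \<or> x = [(b, s), (a, flip s)]"
    and adm: "second_move_admissible \<kappa> a b s"
  shows "law_from s (law_of (?w, \<kappa>) a) = law_from (flip s) (law_of (?w, \<kappa>) b)"
proof (cases "\<kappa> a = Virt")
  case True
  then show ?thesis using adm
    by (auto simp: second_move_admissible_def law_of_def law_from_def classical_def)
next
  case False
  then have cl: "classical \<kappa> a" "classical \<kappa> b" and over: "over \<kappa> (a, s) = over \<kappa> (b, flip s)"
    using adm by (auto simp: second_move_admissible_def classical_def)
  have d: "distinct ?w" using w by (simp add: closed_word_def)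
  then have ab: "a \<noteq> b" using x by (cases s) auto
  have notin: "c \<notin> fst ` set u" if "u \<in> {u1, u2, u3}" "c \<in> {a, b}" for u c
  proof
    assume "c \<in> fst ` set u"
    then obtain s' where s': "(c, s') \<in> set u" by auto
    have "s' = s \<or> s' = flip s" by (cases s; cases s') auto
    moreover have "(a, s) \<notin> set u" "(a, flip s) \<notin> set u" "(b, s) \<notin> set u" "(b, flip s) \<notin> set u"
      using that(1) d x by auto
    ultimately show False using s' that(2) by auto
  qed
  have "alternating_count c (classical_word (u, \<kappa>)) = 0" if "u \<in> {u1, u2, u3}" "c \<in> {a, b}" for u c
    using notin[OF that] set_classical_word by (intro alternating_count_notin) blast
  then have "odd_crossing (?w, \<kappa>) a \<longleftrightarrow> odd_crossing (?w, \<kappa>) b"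
    using cl ab x by (subst (1 2) odd_crossing_iff[OF w])
      (auto simp: alternating_count_append)
  moreover have "\<kappa> a = Pos \<or> \<kappa> a = Neg" "\<kappa> b = Pos \<or> \<kappa> b = Neg"
    using cl kind.exhaust by (auto simp: classical_def)
  ultimately show ?thesis
    using over by (cases s) (auto simp: law_of_def law_from_def)
qed

lemma triangle_strand_cases:
  "triangle_strand e d f a b =
     (if d then [(a, flip (turn e d)), (b, turn d f)] else [(b, turn d f), (a, flip (turn e d))])"
  by (simp add: triangle_strand_def)

lemma alternating_count_rev_pair:
  "length p = 2 \<Longrightarrow> alternating_count c (rev p) = - alternating_count c p"
  by (auto simp: numeral_2_eq_2 length_Suc_conv)

text \<open>
  Here \<open>q2\<close> and \<open>q3\<close> are the strands 2 and 3 in the order in which the knot runs through them.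
\<close>

locale third_move =
  fixes d1 d2 d3 :: bool and c12 c23 c31 :: nat and u1 u2 u3 u4 p1 p2 p3 q2 q3 :: gauss_word
    and \<kappa> :: "nat \<Rightarrow> kind"
  assumes admissible: "third_move_admissible \<kappa> d1 d2 d3 c12 c23 c31"
    and p1: "p1 = triangle_strand d3 d1 d2 c31 c12"
    and p2: "p2 = triangle_strand d1 d2 d3 c12 c23"
    and p3: "p3 = triangle_strand d2 d3 d1 c23 c31"
    and order: "(q2, q3) = (p2, p3) \<or> (q2, q3) = (p3, p2)"
    and closed: "closed_word (u1 @ p1 @ u2 @ q2 @ u3 @ q3 @ u4)"
      "closed_word (u1 @ rev p1 @ u2 @ rev q2 @ u3 @ rev q3 @ u4)"
begin

abbreviation "before \<equiv> u1 @ p1 @ u2 @ q2 @ u3 @ q3 @ u4"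
abbreviation "after \<equiv> u1 @ rev p1 @ u2 @ rev q2 @ u3 @ rev q3 @ u4"

definition passages :: "(nat \<times> side) set" where
  "passages = {c12, c23, c31} \<times> UNIV"

lemma set_strands: "set p1 \<union> set p2 \<union> set p3 = passages"
  by (cases d1; cases d2; cases d3) (auto simp: p1 p2 p3 triangle_strand_cases turn_def passages_def UNIV_side)

lemma set_q: "set q2 \<union> set q3 = set p2 \<union> set p3"
  using order by auto

lemma outside:
  assumes "u \<in> {u1, u2, u3, u4}"
  shows "set u \<inter> passages = {}"
proof -
  have "distinct before" using closed by (simp add: closed_word_def)
  then have "set u \<inter> (set p1 \<union> set q2 \<union> set q3) = {}" using assms by auto
  then show ?thesis using set_strands set_q by blast
qed

lemma distinct_crossings: "c12 \<noteq> c23" "c23 \<noteq> c31" "c31 \<noteq> c12"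
proof -
  have "distinct before" using closed by (simp add: closed_word_def)
  then have "distinct (p1 @ p2 @ p3)" using order by auto
  then show "c12 \<noteq> c23" "c23 \<noteq> c31" "c31 \<noteq> c12"
    by (cases d1; cases d2; cases d3; auto simp: p1 p2 p3 triangle_strand_cases turn_def)+
qed

lemma crossings_mem: "c \<in> {c12, c23, c31} \<Longrightarrow> c \<in> fst ` set before"
proof -
  assume "c \<in> {c12, c23, c31}"
  then have "(c, Lft) \<in> set p1 \<union> (set p2 \<union> set p3)"
    unfolding set_strands[unfolded Un_assoc] by (simp add: passages_def)
  then have "(c, Lft) \<in> set before" unfolding set_q[symmetric] by auto
  from imageI[OF this, of fst] show ?thesis by simp
qed

lemma outside_fst:
  assumes "u \<in> {u1, u2, u3, u4}" "c \<in> {c12, c23, c31}"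
  shows "c \<notin> fst ` set u"
proof
  assume "c \<in> fst ` set u"
  then obtain s where "(c, s) \<in> set u" by auto
  moreover have "(c, s) \<in> passages" unfolding passages_def using assms(2) by simp
  ultimately show False using outside[OF assms(1)] by blast
qed

lemma outside_count:
  assumes "u \<in> {u1, u2, u3, u4}" "c \<in> {c12, c23, c31}"
  shows "alternating_count c (classical_word (u, \<kappa>)) = 0"
  using outside_fst[OF assms] set_classical_word by (intro alternating_count_notin) blast

text \<open>
  If there is a virtual crossing, there are at least two, and they lie on a common strand.
\<close>

lemma classical_cases:
  obtains "classical \<kappa> c12" "classical \<kappa> c23" "classical \<kappa> c31" "layered \<kappa> d1 d2 d3 c12 c23 c31"
  | "\<not> classical \<kappa> c23" "\<not> classical \<kappa> c31"
  | "\<not> classical \<kappa> c31" "\<not> classical \<kappa> c12"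
  | "\<not> classical \<kappa> c12" "\<not> classical \<kappa> c23"
  using admissible
  by (cases "classical \<kappa> c12"; cases "classical \<kappa> c23"; cases "classical \<kappa> c31")
     (auto simp: third_move_admissible_def)

text \<open>
  With three classical crossings the move exchanges adjacent letters.  This changes the sign of both
  occurrences of each of the three crossings and of no other letter.  With fewer classical crossings
  the classical word does not change at all.
\<close>

lemma law_of_after:
  assumes c: "c \<in> fst ` set before"
  shows "law_of (after, \<kappa>) c = law_of (before, \<kappa>) c"
proof (rule law_of_cong)
  let ?cw = "\<lambda>w. classical_word (w, \<kappa>)"
  have strands: "p \<in> {p1, p2, p3}" if "p \<in> {p1, q2, q3}" for p
    using that order by auto
  show "alternating_count c (?cw after) = 0 \<longleftrightarrow> alternating_count c (?cw before) = 0"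
  proof (cases "classical \<kappa> c12 \<and> classical \<kappa> c23 \<and> classical \<kappa> c31")
    case True
    have 1: "length (?cw p) = 2" "length (?cw (rev p)) = 2"
      and rev: "?cw (rev p) = rev (?cw p)" if "p \<in> {p1, q2, q3}" for p
      using strands[OF that] True by (auto simp: p1 p2 p3 triangle_strand_cases)
    have 2: "alternating_count c (?cw (rev p)) = - alternating_count c (?cw p)"
      if "p \<in> {p1, q2, q3}" for p
      using 1[OF that] rev[OF that] by (simp add: alternating_count_rev_pair)
    show ?thesis
    proof (cases "c \<in> {c12, c23, c31}")
      case True
      have "alternating_count c (?cw u1) = 0" "alternating_count c (?cw u2) = 0"
        "alternating_count c (?cw u3) = 0" "alternating_count c (?cw u4) = 0"
        using outside_count[OF _ True] by simp_all
      then have "alternating_count c (?cw after) = - alternating_count c (?cw before)"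
        by (simp add: alternating_count_append 1 2 algebra_simps)
      then show ?thesis by simp
    next
      case False
      have "alternating_count c (?cw p) = 0" if "p \<in> {p1, q2, q3}" for p
        using strands[OF that] False by (intro alternating_count_notin)
          (auto simp: p1 p2 p3 triangle_strand_cases split: if_splits)
      then show ?thesis by (simp add: alternating_count_append 1 2)
    qed
  next
    case False
    have "?cw (rev p) = ?cw p" if "p \<in> {p1, q2, q3}" for p
      using strands[OF that] False classical_cases
      by (cases rule: classical_cases) (auto simp: p1 p2 p3 triangle_strand_cases)
    then show ?thesis by simp
  qed
qed (use closed c in auto)

text \<open>
  Strand \<open>i\<close> contributes opposite signs to the alternating counts of its two crossings, which are
  adjacent letters.  If \<open>f\<^sub>i\<close> is the sign of its crossing with the preceding strand, then the crossing
  of the strands \<open>i\<close> and \<open>j = i + 1\<close> has count \<open>f\<^sub>j - f\<^sub>i\<close>.  Hence none or two of the three are odd.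
\<close>

lemma parity_of_triangle:
  assumes cl: "classical \<kappa> c12" "classical \<kappa> c23" "classical \<kappa> c31"
  shows "\<exists>f1 f2 f3 :: int. {f1, f2, f3} \<subseteq> {1, - 1} \<and>
    (odd_crossing (before, \<kappa>) c12 \<longleftrightarrow> f1 \<noteq> f2) \<and>
    (odd_crossing (before, \<kappa>) c23 \<longleftrightarrow> f2 \<noteq> f3) \<and>
    (odd_crossing (before, \<kappa>) c31 \<longleftrightarrow> f3 \<noteq> f1)"
proof -
  let ?cw = "\<lambda>w. classical_word (w, \<kappa>)"
  let ?a = "\<lambda>c w. alternating_count c (?cw w)"
  define \<delta> where "\<delta> d = (if d then 1 else - 1 :: int)" for d
  have len: "length (?cw q2) = 2" "length (?cw q3) = 2" "length (?cw p1) = 2"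
    using order cl by (auto simp: p1 p2 p3 triangle_strand_cases)
  \<comment> \<open>The signs of the positions at which the three strands begin, in the order of the knot.\<close>
  define e1 e2 e3 :: int where "e1 = (- 1) ^ length (?cw u1)"
    and "e2 = e1 * (- 1) ^ length (?cw u2)" and "e3 = e2 * (- 1) ^ length (?cw u3)"
  have sum: "?a c before = e1 * ?a c p1 + e2 * ?a c q2 + e3 * ?a c q3"
    if "c \<in> {c12, c23, c31}" for c
    using outside_count[OF _ that] len
    by (simp add: alternating_count_append e1_def e2_def e3_def algebra_simps)
  \<comment> \<open>The signs of the same positions, assigned to the strands 2 and 3.\<close>
  obtain g2 g3 where g: "{g2, g3} = {e2, e3}"
    and sum': "\<And>c. c \<in> {c12, c23, c31} \<Longrightarrow> ?a c before = e1 * ?a c p1 + g2 * ?a c p2 + g3 * ?a c p3"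
    using order
  proof
    assume "(q2, q3) = (p2, p3)" then show thesis using that[of e2 e3] sum by simp
  next
    assume "(q2, q3) = (p3, p2)" then show thesis using that[of e3 e2] sum by (simp add: insert_commute)
  qed
  have e: "e1 \<in> {1, - 1}" "e2 \<in> {1, - 1}" "e3 \<in> {1, - 1}"
    unfolding e1_def e2_def e3_def using neg_one_power_cases[of "length (?cw u1)"]
      neg_one_power_cases[of "length (?cw u2)"] neg_one_power_cases[of "length (?cw u3)"] by auto
  then have g': "g2 \<in> {1, - 1}" "g3 \<in> {1, - 1}" using g by (metis insertCI insertE singletonD)+
  note neq = distinct_crossings distinct_crossings[symmetric]
  have strand:
    "?a c31 p1 = \<delta> d1" "?a c12 p1 = - \<delta> d1" "?a c23 p1 = 0"
    "?a c12 p2 = \<delta> d2" "?a c23 p2 = - \<delta> d2" "?a c31 p2 = 0"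
    "?a c23 p3 = \<delta> d3" "?a c31 p3 = - \<delta> d3" "?a c12 p3 = 0"
    using neq cl by (auto simp: p1 p2 p3 triangle_strand_cases \<delta>_def)
  have odd: "odd_crossing (before, \<kappa>) c \<longleftrightarrow> ?a c before \<noteq> 0" if "c \<in> {c12, c23, c31}" for c
    using odd_crossing_iff[OF closed(1) _ crossings_mem[OF that]] that cl by blast
  have "{e1 * \<delta> d1, g2 * \<delta> d2, g3 * \<delta> d3} \<subseteq> {1, - 1}"
    using e g' by (auto simp: \<delta>_def)
  moreover have "?a c12 before = g2 * \<delta> d2 - e1 * \<delta> d1"
    "?a c23 before = g3 * \<delta> d3 - g2 * \<delta> d2" "?a c31 before = e1 * \<delta> d1 - g3 * \<delta> d3"
    by (simp_all only: sum' strand insert_iff simp_thms mult_zero_right mult_minus_right)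
  then have "odd_crossing (before, \<kappa>) c12 \<longleftrightarrow> e1 * \<delta> d1 \<noteq> g2 * \<delta> d2"
    "odd_crossing (before, \<kappa>) c23 \<longleftrightarrow> g2 * \<delta> d2 \<noteq> g3 * \<delta> d3"
    "odd_crossing (before, \<kappa>) c31 \<longleftrightarrow> g3 * \<delta> d3 \<noteq> e1 * \<delta> d1"
    using odd[of c12] odd[of c23] odd[of c31] by (simp_all only: insert_iff simp_thms) linarith+
  ultimately show ?thesis by blast
qed

end

section \<open>Colourings of a diagram and the moves\<close>

text \<open>
  Reversing all three strands exchanges the two sides of the move, so that it is its own inverse.
\<close>

lemma third_move_reverse:
  assumes "third_move d1 d2 d3 c12 c23 c31 u1 u2 u3 u4 p1 p2 p3 q2 q3 \<kappa>"
  shows "third_move (\<not> d1) (\<not> d2) (\<not> d3) c12 c23 c31 u1 u2 u3 u4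
    (rev p1) (rev p2) (rev p3) (rev q2) (rev q3) \<kappa>"
proof -
  interpret third_move d1 d2 d3 c12 c23 c31 u1 u2 u3 u4 p1 p2 p3 q2 q3 \<kappa> by fact
  have turn: "turn (\<not> d) (\<not> e) = turn d e" for d e by (simp add: turn_def)
  have strand: "triangle_strand (\<not> e) (\<not> d) (\<not> f) a b = rev (triangle_strand e d f a b)" for e d f a b
    by (auto simp: triangle_strand_cases turn_def)
  have layered: "layered \<kappa> (\<not> d1) (\<not> d2) (\<not> d3) = layered \<kappa> d1 d2 d3"
    by (intro ext) (simp add: layered_def turn)
  show ?thesis
  proof
    show "third_move_admissible \<kappa> (\<not> d1) (\<not> d2) (\<not> d3) c12 c23 c31"
      using admissible unfolding third_move_admissible_def layered .
    show "rev p1 = triangle_strand (\<not> d3) (\<not> d1) (\<not> d2) c31 c12"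
      "rev p2 = triangle_strand (\<not> d1) (\<not> d2) (\<not> d3) c12 c23"
      "rev p3 = triangle_strand (\<not> d2) (\<not> d3) (\<not> d1) c23 c31"
      by (simp_all add: strand p1 p2 p3)
    show "(rev q2, rev q3) = (rev p2, rev p3) \<or> (rev q2, rev q3) = (rev p3, rev p2)"
      using order by auto
    show "closed_word (u1 @ rev p1 @ u2 @ rev q2 @ u3 @ rev q3 @ u4)"
      "closed_word (u1 @ rev (rev p1) @ u2 @ rev (rev q2) @ u3 @ rev (rev q3) @ u4)"
      using closed by simp_all
  qed
qed

context colour_module
begin

text \<open>
  \<open>C (c, s) k\<close> is the colour, on the side \<open>k\<close> of the other strand, of the strand that passes the crossing
  \<open>c\<close> as \<open>s\<close>.  A strand recorded as \<open>Lft\<close> comes from the left of the other strand and one recorded as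
  \<open>Rgt\<close> from its right; so the incoming colour at a passage \<open>p\<close> is \<open>C p (snd p)\<close>.  The relation follows
  the word from the colour \<open>x\<close> to the colour \<open>y\<close>.
\<close>

fun trace :: "(nat \<times> side \<Rightarrow> side \<Rightarrow> 'g \<Rightarrow> 'r) \<Rightarrow> gauss_word \<Rightarrow> ('g \<Rightarrow> 'r) \<Rightarrow> ('g \<Rightarrow> 'r) \<Rightarrow> bool" where
  "trace C [] x y \<longleftrightarrow> x \<approx> y"
| "trace C (p # w) x y \<longleftrightarrow> x \<approx> C p (snd p) \<and> trace C w (C p (flip (snd p))) y"

lemma trace_cong_left:
  assumes "x \<approx> x'"
  shows "trace C w x y \<longleftrightarrow> trace C w x' y"
  by (cases w) (simp_all add: cong_left[OF assms])

lemma trace_append: "trace C (u @ v) x y \<longleftrightarrow> (\<exists>m. trace C u x m \<and> trace C v m y)"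
proof (induction u arbitrary: x)
  case Nil
  show ?case using trace_cong_left[of x _ C v y] by (auto intro: exI[of _ x])
qed auto

lemma trace_agree: "(\<And>p. p \<in> set w \<Longrightarrow> C p = C' p) \<Longrightarrow> trace C w x y \<longleftrightarrow> trace C' w x y"
  by (induction w arbitrary: x) auto

lemma trace_map: "trace C (map (map_prod f id) w) x y \<longleftrightarrow> trace (\<lambda>p. C (map_prod f id p)) w x y"
  by (induction w arbitrary: x) auto

lemma trace_encloses:
  assumes "encloses W" "trace C w x y" "x \<in> W" "\<And>p k. p \<in> set w \<Longrightarrow> C p k \<in> W"
  shows "y \<in> W"
  using assms(2-)
  by (induction w arbitrary: x) (use encloses_cong[OF assms(1)] in auto)

lemma satisfies_law_from:
  "satisfies (law_from s l) (C (c, s)) (C (c, flip s)) \<longleftrightarrow> satisfies l (C (c, Lft)) (C (c, Rgt))"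
  by (cases s) (simp_all add: law_from_def satisfies_swap del: satisfies.simps)

text \<open>
  The colour \<open>x\<close> of the base point is kept separately, as it is the only colour of a circle without
  crossings.
\<close>

definition colouring :: "vdiagram \<Rightarrow> ('g \<Rightarrow> 'r) \<Rightarrow> (nat \<times> side \<Rightarrow> side \<Rightarrow> 'g \<Rightarrow> 'r) \<Rightarrow> bool" where
  "colouring K x C \<longleftrightarrow> trace C (fst K) x x \<and>
     (\<forall>c \<in> fst ` set (fst K). satisfies (law_of K c) (C (c, Lft)) (C (c, Rgt)))"

lemma colouring_law:
  "colouring K x C \<Longrightarrow> c \<in> fst ` set (fst K) \<Longrightarrow> satisfies (law_of K c) (C (c, Lft)) (C (c, Rgt))"
  unfolding colouring_def by blast

definition colours_in ::
    "('g \<Rightarrow> 'r) set \<Rightarrow> vdiagram \<Rightarrow> ('g \<Rightarrow> 'r) \<Rightarrow> (nat \<times> side \<Rightarrow> side \<Rightarrow> 'g \<Rightarrow> 'r) \<Rightarrow> bool" where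
  "colours_in W K x C \<longleftrightarrow> x \<in> W \<and> (\<forall>p \<in> set (fst K). \<forall>k. C p k \<in> W)"

text \<open>
  A colouring of \<open>K\<close> yields a colouring of \<open>K'\<close> from whose colours those of \<open>K\<close> can be recovered by
  linear combinations.  For the generic colouring of \<open>K\<close> this means that the module of \<open>K'\<close> surjects
  onto that of \<open>K\<close>.
\<close>

definition transfers :: "vdiagram \<Rightarrow> vdiagram \<Rightarrow> bool" where
  "transfers K K' \<longleftrightarrow> (\<forall>x C. colouring K x C \<longrightarrow>
     (\<exists>x' C'. colouring K' x' C' \<and>
        (\<forall>W. encloses W \<longrightarrow> colours_in W K' x' C' \<longrightarrow> colours_in W K x C)))"

lemma transfersI:
  assumes "\<And>x C. colouring K x C \<Longrightarrow> \<exists>x' C'. colouring K' x' C' \<and>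
    (\<forall>W. encloses W \<longrightarrow> colours_in W K' x' C' \<longrightarrow> colours_in W K x C)"
  shows "transfers K K'"
  using assms by (simp add: transfers_def)

lemma transfers_rebase:
  assumes "closed_word (u @ v)" "closed_word (v @ u)"
  shows "transfers (u @ v, \<kappa>) (v @ u, \<kappa>)"
proof (rule transfersI)
  fix x C assume col: "colouring (u @ v, \<kappa>) x C"
  then obtain m where m: "trace C u x m" "trace C v m x"
    by (auto simp: colouring_def trace_append)
  have "satisfies (law_of (v @ u, \<kappa>) c) (C (c, Lft)) (C (c, Rgt))" if "c \<in> fst ` set (v @ u)" for c
  proof -
    have c: "c \<in> fst ` set (u @ v)" using that by (simp add: Un_commute)
    show ?thesis
      unfolding law_of_rebase[OF assms c] by (rule colouring_law[OF col, unfolded fst_conv, OF c])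
  qed
  then have "colouring (v @ u, \<kappa>) m C"
    using m unfolding colouring_def fst_conv trace_append by blast
  moreover have "colours_in W (u @ v, \<kappa>) x C" if "encloses W" "colours_in W (v @ u, \<kappa>) m C" for W
    using that trace_encloses[OF that(1) m(2)] by (auto simp: colours_in_def)
  ultimately show "\<exists>x' C'. colouring (v @ u, \<kappa>) x' C' \<and>
      (\<forall>W. encloses W \<longrightarrow> colours_in W (v @ u, \<kappa>) x' C' \<longrightarrow> colours_in W (u @ v, \<kappa>) x C)"
    by blast
qed

lemma transfers_relabel:
  assumes w: "closed_word w" "closed_word (map (map_prod f id) w)"
    and f: "inj_on f (fst ` set w)" and \<kappa>: "\<And>c. c \<in> fst ` set w \<Longrightarrow> \<kappa>' (f c) = \<kappa> c"
  shows "transfers (w, \<kappa>) (map (map_prod f id) w, \<kappa>')"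
    and "transfers (map (map_prod f id) w, \<kappa>') (w, \<kappa>)"
proof -
  let ?w' = "map (map_prod f id) w"
  let ?K = "(w, \<kappa>)" and ?K' = "(?w', \<kappa>')"
  have law: "law_of ?K' (f c) = law_of ?K c" if "c \<in> fst ` set w" for c
    using law_of_relabel[OF w f, of \<kappa>' \<kappa> c] \<kappa> that by blast
  have fst_w': "fst ` set ?w' = f ` fst ` set w" by (simp add: image_image)
  have col: "colouring ?K' x C \<longleftrightarrow> colouring ?K x (\<lambda>p. C (map_prod f id p))" for x C
    using law by (simp add: colouring_def trace_map fst_w' del: satisfies.simps)
  have col_in: "colours_in W ?K' x C \<longleftrightarrow> colours_in W ?K x (\<lambda>p. C (map_prod f id p))" for W x C
    by (auto simp: colours_in_def)
  show "transfers ?K' ?K"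
    by (rule transfersI) (use col col_in in blast)
  show "transfers ?K ?K'"
  proof (rule transfersI)
    fix x C assume C: "colouring ?K x C"
    define C' where "C' p = C (the_inv_into (fst ` set w) f (fst p), snd p)" for p
    have agree: "C' (map_prod f id p) = C p" if "p \<in> set w" for p
      using the_inv_into_f_f[OF f imageI[OF that]] by (simp add: C'_def)
    then have "colouring ?K x (\<lambda>p. C' (map_prod f id p))"
      using C closed_word_mem[OF w(1)]
      by (auto simp: colouring_def trace_agree[of w "\<lambda>p. C' (map_prod f id p)" C] simp del: satisfies.simps map_prod_simp)
    moreover have "colours_in W ?K x (\<lambda>p. C' (map_prod f id p)) \<longleftrightarrow> colours_in W ?K x C" for W
      using agree by (auto simp: colours_in_def)
    ultimately show "\<exists>x' C'. colouring ?K' x' C' \<and>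
      (\<forall>W. encloses W \<longrightarrow> colours_in W ?K' x' C' \<longrightarrow> colours_in W ?K x C)"
      using col col_in by blast
  qed
qed

text \<open>
  The two passages of the crossing follow each other, so the strands agree in the colour of the
  loop between them.  By \<open>law_diagonal\<close> the incoming and the outgoing colour agree as well.
\<close>

lemma transfers_move_I:
  assumes w: "closed_word (u @ v)" "closed_word (u @ [(c, s), (c, flip s)] @ v)"
  shows "transfers (u @ v, \<kappa>) (u @ [(c, s), (c, flip s)] @ v, \<kappa>)"
    and "transfers (u @ [(c, s), (c, flip s)] @ v, \<kappa>) (u @ v, \<kappa>)"
proof -
  let ?K = "(u @ v, \<kappa>)" and ?K' = "(u @ [(c, s), (c, flip s)] @ v, \<kappa>)"
  let ?l = "law_from s (law_of ?K' c)"
  have law: "law_of ?K' c' = law_of ?K c'" if "c' \<in> fst ` set (u @ v)" for c'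
    by (rule law_of_move_I[OF w that])
  have new: "(c, s) \<notin> set (u @ v)" "(c, flip s) \<notin> set (u @ v)"
    using w(2) by (auto simp: closed_word_def)
  then have c: "c' \<noteq> c" if "c' \<in> fst ` set (u @ v)" for c'
    using closed_word_mem[OF w(1) that] by metis
  show "transfers ?K ?K'"
  proof (rule transfersI)
    fix x C assume col: "colouring ?K x C"
    then obtain m where m: "trace C u x m" "trace C v m x"
      by (auto simp: colouring_def trace_append)
    obtain p r where pr: "satisfies ?l p r" "p s = m" "r s = m"
      using law_solution[of ?l s m s m] by blast
    have diag: "p (flip s) \<approx> r (flip s)" using law_diagonal[OF pr(1), of s] pr by simp
    define C' where "C' = C((c, s) := p, (c, flip s) := r)"
    have C': "C' q = C q" if "q \<in> set (u @ v)" for q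
      using that new by (auto simp: C'_def)
    then have "trace C' u x m" "trace C' v m x"
      using m trace_agree[of u C' C] trace_agree[of v C' C] by auto
    moreover have "trace C' [(c, s), (c, flip s)] m m"
      using pr diag by (simp add: C'_def)
    moreover have "satisfies (law_of ?K' c') (C' (c', Lft)) (C' (c', Rgt))" if "c' \<in> fst ` set (u @ v)" for c'
      using colouring_law[OF col, of c'] law[OF that] that C'[OF closed_word_mem[OF w(1) that]]
      by (simp del: satisfies.simps)
    moreover have "satisfies (law_of ?K' c) (C' (c, Lft)) (C' (c, Rgt))"
      using pr(1) satisfies_law_from[of s "law_of ?K' c" C' c] by (simp add: C'_def del: satisfies.simps)
    ultimately have "colouring ?K' x C'"
      unfolding colouring_def fst_conv trace_append by auto
    moreover have "colours_in W ?K x C" if "colours_in W ?K' x C'" for W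
      using that C' by (auto simp: colours_in_def)
    ultimately show "\<exists>x' C'. colouring ?K' x' C' \<and>
      (\<forall>W. encloses W \<longrightarrow> colours_in W ?K' x' C' \<longrightarrow> colours_in W ?K x C)" by blast
  qed
  show "transfers ?K' ?K"
  proof (rule transfersI)
    fix x C assume col: "colouring ?K' x C"
    then obtain m1 m2 where m: "trace C u x m1" "trace C v m2 x"
      and 1: "m1 \<approx> C (c, s) s" "C (c, s) (flip s) \<approx> C (c, flip s) (flip s)" "C (c, flip s) s \<approx> m2"
      unfolding colouring_def fst_conv trace_append by auto
    have sat: "satisfies ?l (C (c, s)) (C (c, flip s))"
      using col unfolding satisfies_law_from by (simp add: colouring_def del: satisfies.simps)
    have "C (c, s) s \<approx> C (c, flip s) s" using law_diagonal[OF sat 1(2)] by simp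
    then have m12: "m1 \<approx> m2" and r: "m1 \<approx> C (c, flip s) s"
      using 1 by (blast intro: cong_trans)+
    have "trace C (u @ v) x x"
      unfolding trace_append using m trace_cong_left[OF m12] by blast
    then have "colouring ?K x C"
      using col law by (auto simp: colouring_def simp del: satisfies.simps)
    moreover have "colours_in W ?K' x C" if W: "encloses W" and C: "colours_in W ?K x C" for W
    proof -
      have "m1 \<in> W" using trace_encloses[OF W m(1)] C by (auto simp: colours_in_def)
      then have "C (c, s) s \<in> W" "C (c, flip s) s \<in> W"
        using encloses_cong[OF W] 1(1) r by blast+
      from law_encloses[OF sat W this] C show ?thesis by (auto simp: colours_in_def)
    qed
    ultimately show "\<exists>x' C'. colouring ?K x' C' \<and>
      (\<forall>W. encloses W \<longrightarrow> colours_in W ?K x' C' \<longrightarrow> colours_in W ?K' x C)" by blast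
  qed
qed

text \<open>
  The two crossings have the same law, and the arcs of the bigon are common to both.  By \<open>law_unique\<close>
  the crossings have the same colours, so both strands leave with the colours with which they enter.
\<close>

lemma transfers_move_II:
  assumes w: "closed_word (u1 @ u2 @ u3)" "closed_word (u1 @ [(a, s), (b, flip s)] @ u2 @ y @ u3)"
    and y: "y = [(a, flip s), (b, s)] \<or> y = [(b, s), (a, flip s)]"
    and adm: "second_move_admissible \<kappa> a b s"
  shows "transfers (u1 @ u2 @ u3, \<kappa>) (u1 @ [(a, s), (b, flip s)] @ u2 @ y @ u3, \<kappa>)"
    and "transfers (u1 @ [(a, s), (b, flip s)] @ u2 @ y @ u3, \<kappa>) (u1 @ u2 @ u3, \<kappa>)"
proof -
  let ?K = "(u1 @ u2 @ u3, \<kappa>)" and ?K' = "(u1 @ [(a, s), (b, flip s)] @ u2 @ y @ u3, \<kappa>)"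
  define l where "l = law_from s (law_of ?K' a)"
  have l: "l = law_from (flip s) (law_of ?K' b)"
    unfolding l_def by (rule law_of_bigon[OF w(2) y adm])
  have law: "law_of ?K' c = law_of ?K c" if "c \<in> fst ` set (u1 @ u2 @ u3)" for c
    by (rule law_of_move_II[OF w y adm that])
  have d: "distinct (u1 @ [(a, s), (b, flip s)] @ u2 @ y @ u3)" using w(2) by (simp add: closed_word_def)
  then have ab: "a \<noteq> b" using y by (cases s) auto
  have new: "q \<notin> set (u1 @ u2 @ u3)" if "q \<in> {(a, s), (a, flip s), (b, s), (b, flip s)}" for q
    using that d y by auto
  \<comment> \<open>The side of the first arc from which the second arc enters the bigon.\<close>
  define j where "j = (if y = [(a, flip s), (b, s)] then flip s else s)"
  have set_y: "set y = {(a, flip s), (b, s)}" using y by auto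
  show "transfers ?K ?K'"
  proof (rule transfersI)
    fix x C assume col: "colouring ?K x C"
    then obtain m1 m2 where m: "trace C u1 x m1" "trace C u2 m1 m2" "trace C u3 m2 x"
      by (auto simp: colouring_def trace_append)
    obtain p r where pr: "satisfies l p r" "p s = m1" "r j = m2"
      using law_solution[of l s m1 j m2] by blast
    define C' where "C' = C((a, s) := p, (a, flip s) := r, (b, flip s) := p, (b, s) := r)"
    have C'ab [simp]: "C' (a, s) = p" "C' (a, flip s) = r" "C' (b, flip s) = p" "C' (b, s) = r"
      using ab by (auto simp: C'_def)
    have C': "C' q = C q" if "q \<in> set (u1 @ u2 @ u3)" for q
      unfolding C'_def using that new by (metis fun_upd_other insertCI)
    then have "trace C' u1 x m1" "trace C' u2 m1 m2" "trace C' u3 m2 x"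
      using m trace_agree[of u1 C' C] trace_agree[of u2 C' C] trace_agree[of u3 C' C] by auto
    moreover have "trace C' [(a, s), (b, flip s)] m1 m1" using pr by simp
    moreover have "trace C' y m2 m2" using y pr by (auto simp: j_def)
    ultimately have "trace C' (u1 @ [(a, s), (b, flip s)] @ u2 @ y @ u3) x x"
      unfolding trace_append by blast
    moreover have "satisfies (law_of ?K' c) (C' (c, Lft)) (C' (c, Rgt))" if "c \<in> fst ` set (u1 @ u2 @ u3)" for c
      using colouring_law[OF col, of c] law[OF that] that C'[OF closed_word_mem[OF w(1) that]]
      by (simp del: satisfies.simps)
    moreover have "satisfies (law_of ?K' a) (C' (a, Lft)) (C' (a, Rgt))"
      using pr(1) satisfies_law_from[of s "law_of ?K' a" C' a] by (simp add: l_def del: satisfies.simps)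
    moreover have "satisfies (law_of ?K' b) (C' (b, Lft)) (C' (b, Rgt))"
      using pr(1) satisfies_law_from[of "flip s" "law_of ?K' b" C' b] by (simp add: l del: satisfies.simps)
    ultimately have "colouring ?K' x C'"
      using set_y by (auto simp: colouring_def simp del: satisfies.simps)
    moreover have "colours_in W ?K x C" if "colours_in W ?K' x C'" for W
      unfolding colours_in_def fst_conv
    proof (intro conjI ballI allI)
      show "x \<in> W" using that by (simp add: colours_in_def)
      fix q k assume q: "q \<in> set (u1 @ u2 @ u3)"
      then have "C' q k \<in> W" using that by (auto simp: colours_in_def)
      then show "C q k \<in> W" using C'[OF q] by simp
    qed
    ultimately show "\<exists>x' C'. colouring ?K' x' C' \<and>
      (\<forall>W. encloses W \<longrightarrow> colours_in W ?K' x' C' \<longrightarrow> colours_in W ?K x C)" by blast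
  qed
  show "transfers ?K' ?K"
  proof (rule transfersI)
    fix x C assume col: "colouring ?K' x C"
    then obtain m1 m1' m2 m2' where m: "trace C u1 x m1" "trace C u2 m1' m2" "trace C u3 m2' x"
      and t1: "trace C [(a, s), (b, flip s)] m1 m1'" and t2: "trace C y m2 m2'"
      unfolding colouring_def fst_conv trace_append by blast
    let ?p = "C (a, s)" and ?r = "C (a, flip s)" and ?p' = "C (b, flip s)" and ?r' = "C (b, s)"
    have sat: "satisfies l ?p ?r"
      unfolding l_def satisfies_law_from using col by (simp add: colouring_def del: satisfies.simps)
    have sat': "satisfies l ?p' ?r'"
      using col satisfies_law_from[of "flip s" "law_of ?K' b" C b]
      by (simp add: l colouring_def del: satisfies.simps)
    have 1: "m1 \<approx> ?p s" "?p (flip s) \<approx> ?p' (flip s)" "?p' s \<approx> m1'" using t1 by simp_all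
    have 2: "m2 \<approx> ?r j \<and> ?r (flip j) \<approx> ?r' (flip j) \<and> ?r' j \<approx> m2' \<or>
        m2 \<approx> ?r' j \<and> ?r' (flip j) \<approx> ?r (flip j) \<and> ?r j \<approx> m2'"
      using t2 y by (auto simp: j_def)
    have same: "?p k \<approx> ?p' k" "?r k \<approx> ?r' k" for k
      using law_unique[OF sat sat' 1(2), of "flip j" k] 2 cong_sym by blast+
    have m1: "m1 \<approx> m1'" using 1 same(1)[of s] by (blast intro: cong_trans)
    have m2: "m2 \<approx> m2'" and r: "m2 \<approx> ?r j"
      using 2 same(2)[of j] by (blast intro: cong_trans cong_sym)+
    have "trace C (u1 @ u2 @ u3) x x"
      unfolding trace_append using m trace_cong_left[OF m1] trace_cong_left[OF m2] by blast
    moreover have "satisfies (law_of ?K c) (C (c, Lft)) (C (c, Rgt))"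
      if "c \<in> fst ` set (u1 @ u2 @ u3)" for c
      unfolding law[OF that, symmetric] by (rule colouring_law[OF col]) (use that in auto)
    ultimately have "colouring ?K x C"
      unfolding colouring_def fst_conv by blast
    moreover have "colours_in W ?K' x C" if W: "encloses W" and C: "colours_in W ?K x C" for W
    proof -
      have "m1 \<in> W" using trace_encloses[OF W m(1)] C by (auto simp: colours_in_def)
      then have "m1' \<in> W" "?p s \<in> W" using encloses_cong[OF W] m1 1(1) by blast+
      moreover have "m2 \<in> W" using trace_encloses[OF W m(2) \<open>m1' \<in> W\<close>] C by (auto simp: colours_in_def)
      then have "?r j \<in> W" using encloses_cong[OF W] r by blast
      ultimately have "?p k \<in> W" "?r k \<in> W" for k using law_encloses[OF sat W] by blast+
      moreover from this have "?p' k \<in> W" "?r' k \<in> W" for k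
        using encloses_cong[OF W] same by blast+
      ultimately show ?thesis using C set_y by (auto simp: colours_in_def)
    qed
    ultimately show "\<exists>x' C'. colouring ?K x' C' \<and>
      (\<forall>W. encloses W \<longrightarrow> colours_in W ?K x' C' \<longrightarrow> colours_in W ?K' x C)" by blast
  qed
qed

lemma trace_strand:
  "trace C (triangle_strand e d f a b) x y \<longleftrightarrow>
     C (a, flip (turn e d)) (inner e) \<approx> C (b, turn d f) (inner f) \<and>
     (if d then x \<approx> C (a, flip (turn e d)) (flip (inner e)) \<and> C (b, turn d f) (flip (inner f)) \<approx> y
      else x \<approx> C (b, turn d f) (flip (inner f)) \<and> C (a, flip (turn e d)) (flip (inner e)) \<approx> y)"
  by (cases d; cases e; cases f) (auto simp: triangle_strand_cases turn_def inner_def intro: cong_sym)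

lemma trace_rev_strand:
  "trace C (rev (triangle_strand e d f a b)) x y \<longleftrightarrow>
     C (b, turn d f) (flip (inner f)) \<approx> C (a, flip (turn e d)) (flip (inner e)) \<and>
     (if d then x \<approx> C (b, turn d f) (inner f) \<and> C (a, flip (turn e d)) (inner e) \<approx> y
      else x \<approx> C (a, flip (turn e d)) (inner e) \<and> C (b, turn d f) (inner f) \<approx> y)"
  by (cases d; cases e; cases f) (auto simp: triangle_strand_cases turn_def inner_def intro: cong_sym)

text \<open>
  One strand of the third move, which passes the crossing \<open>a\<close> with its predecessor and the crossing \<open>b\<close>
  with its successor in the order given by its direction: the end colours do not change.
\<close>

lemma strand_slides:
  assumes "trace C (triangle_strand e d f a b) x y"
    and "C' (a, flip (turn e d)) (inner e) \<approx> C (b, turn d f) (flip (inner f))"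
    and "C' (b, turn d f) (inner f) \<approx> C (a, flip (turn e d)) (flip (inner e))"
    and "C' (b, turn d f) (flip (inner f)) \<approx> C' (a, flip (turn e d)) (flip (inner e))"
  shows "trace C' (rev (triangle_strand e d f a b)) x y"
  using assms unfolding trace_strand trace_rev_strand
  by (cases d) (auto intro: cong_trans cong_sym)

lemma triangle_slides_two_twists:
  "triangle_slides d1 d2 d3 l (Twist g) (Twist g)"
  "triangle_slides d1 d2 d3 (Twist g) l (Twist g)"
  "triangle_slides d1 d2 d3 (Twist g) (Twist g) l"
proof -
  show 1: "triangle_slides d1 d2 d3 l (Twist g) (Twist g)" for d1 d2 d3 l
    by (rule triangle_slides_detour)
  show 2: "triangle_slides d1 d2 d3 (Twist g) l (Twist g)" for d1 d2 d3 l
    by (rule triangle_slides_swap_23) (simp add: 1)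
  show "triangle_slides d1 d2 d3 (Twist g) (Twist g) l"
    by (rule triangle_slides_swap_12) (simp add: 2)
qed

lemma triangle_slides_even:
  assumes "\<not> (e12 = e23 \<and> e23 = e31)"
  shows "triangle_slides d1 d2 d3 (Even e12) (Even (flip e31)) (Even e23)"
proof -
  have 1: "triangle_slides d1 d2 d3 (Even Lft) (Even Lft) (Even Lft)" for d1 d2 d3
    by (rule triangle_slides_layered)
  have 2: "triangle_slides d1 d2 d3 (Even Rgt) (Even Lft) (Even Lft)" for d1 d2 d3
    by (rule triangle_slides_swap_12) (simp add: 1)
  have 3: "triangle_slides d1 d2 d3 (Even Lft) (Even Lft) (Even Rgt)" for d1 d2 d3
    by (rule triangle_slides_swap_23) (simp add: 1)
  have 4: "triangle_slides d1 d2 d3 (Even Lft) (Even Rgt) (Even Rgt)" for d1 d2 d3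
    by (rule triangle_slides_swap_23) (simp add: 2)
  have 5: "triangle_slides d1 d2 d3 (Even Rgt) (Even Rgt) (Even Lft)" for d1 d2 d3
    by (rule triangle_slides_swap_12) (simp add: 3)
  have 6: "triangle_slides d1 d2 d3 (Even Rgt) (Even Rgt) (Even Rgt)" for d1 d2 d3
    by (rule triangle_slides_swap_12) (simp add: 4)
  show ?thesis
    using assms by (cases e12; cases e23; cases e31) (simp_all add: 1 2 3 4 5 6)
qed

lemma law_from_Twist [simp]: "law_from s (Twist g) = Twist g"
  by (simp add: law_from_def)

lemma law_from_even:
  assumes "classical \<kappa> c" "\<not> odd_crossing (w, \<kappa>) c"
  shows "law_from s (law_of (w, \<kappa>) c) = Even (if over \<kappa> (c, s) then Lft else Rgt)"
  using assms by (cases s; cases "\<kappa> c") (auto simp: law_from_def law_of_def classical_def)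

text \<open>
  A virtual crossing occurs together with a second one, and an odd crossing among three classical ones
  together with a second odd one; in both cases two laws are twists by the same element.
  Otherwise all laws are even, and they are layered by assumption.
\<close>

lemma triangle_slides_third_move:
  assumes "third_move d1 d2 d3 c12 c23 c31 u1 u2 u3 u4 p1 p2 p3 q2 q3 \<kappa>"
  defines "K \<equiv> (u1 @ p1 @ u2 @ q2 @ u3 @ q3 @ u4, \<kappa>)"
  shows "triangle_slides d1 d2 d3 (law_from (turn d1 d2) (law_of K c12))
    (swap_law (law_from (turn d3 d1) (law_of K c31))) (law_from (turn d2 d3) (law_of K c23))"
proof -
  interpret third_move d1 d2 d3 c12 c23 c31 u1 u2 u3 u4 p1 p2 p3 q2 q3 \<kappa> by fact
  have virt: "law_of K c = Twist CQ" if "\<not> classical \<kappa> c" for c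
    using that by (simp add: law_of_def K_def classical_def)
  show ?thesis
  proof (cases rule: classical_cases)
    case 1
    have odd: "law_of K c = Twist CT" if "odd_crossing K c" "classical \<kappa> c" for c
      using that by (simp add: law_of_def K_def classical_def)
    obtain f1 f2 f3 :: int where f: "{f1, f2, f3} \<subseteq> {1, - 1}"
      "odd_crossing K c12 \<longleftrightarrow> f1 \<noteq> f2" "odd_crossing K c23 \<longleftrightarrow> f2 \<noteq> f3" "odd_crossing K c31 \<longleftrightarrow> f3 \<noteq> f1"
      using parity_of_triangle[OF 1(1-3)] unfolding K_def by blast
    then consider "\<not> odd_crossing K c12" "\<not> odd_crossing K c23" "\<not> odd_crossing K c31"
      | "odd_crossing K c12" "odd_crossing K c23" | "odd_crossing K c12" "odd_crossing K c31"
      | "odd_crossing K c23" "odd_crossing K c31"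
      by auto
    then show ?thesis
    proof cases
      case even: 1
      let ?e = "\<lambda>c s. if over \<kappa> (c, s) then Lft else Rgt"
      have "swap_law (law_from (turn d3 d1) (law_of K c31)) = Even (flip (?e c31 (turn d3 d1)))"
        using law_from_even[OF 1(3)] even(3) by (simp add: K_def)
      moreover have "\<not> (?e c12 (turn d1 d2) = ?e c23 (turn d2 d3) \<and> ?e c23 (turn d2 d3) = ?e c31 (turn d3 d1))"
        using 1(4) unfolding layered_def by (auto split: if_splits)
      ultimately show ?thesis
        using law_from_even[OF 1(1)] law_from_even[OF 1(2)] even(1,2) triangle_slides_even
        by (simp only: K_def not_False_eq_True)
    qed (simp_all add: odd 1 triangle_slides_two_twists)
  qed (simp_all add: virt triangle_slides_two_twists)
qed

text \<open>
  Only the colours at the three crossings are replaced.  The old ones can be recovered, since the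
  outer colours before the move are the inner colours after it and determine the rest.
\<close>

lemma transfers_third_move:
  assumes "third_move d1 d2 d3 c12 c23 c31 u1 u2 u3 u4 p1 p2 p3 q2 q3 \<kappa>"
  shows "transfers (u1 @ p1 @ u2 @ q2 @ u3 @ q3 @ u4, \<kappa>) (u1 @ rev p1 @ u2 @ rev q2 @ u3 @ rev q3 @ u4, \<kappa>)"
    (is "transfers ?K ?K'")
proof (rule transfersI)
  interpret third_move d1 d2 d3 c12 c23 c31 u1 u2 u3 u4 p1 p2 p3 q2 q3 \<kappa> by fact
  fix x C assume col: "colouring ?K x C"
  let ?s12 = "turn d1 d2" and ?s23 = "turn d2 d3" and ?s31 = "turn d3 d1"
  let ?p12 = "C (c12, ?s12)" and ?p21 = "C (c12, flip ?s12)"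
  let ?p23 = "C (c23, ?s23)" and ?p32 = "C (c23, flip ?s23)"
  let ?p31 = "C (c31, ?s31)" and ?p13 = "C (c31, flip ?s31)"
  let ?l12 = "law_from ?s12 (law_of ?K c12)" and ?l23 = "law_from ?s23 (law_of ?K c23)"
  let ?l31 = "law_from ?s31 (law_of ?K c31)"
  have law: "satisfies (law_of ?K c) (C (c, Lft)) (C (c, Rgt))" if "c \<in> {c12, c23, c31}" for c
    by (rule colouring_law[OF col]) (simp only: fst_conv crossings_mem[OF that])
  have l: "satisfies ?l12 ?p12 ?p21" "satisfies ?l23 ?p23 ?p32" "satisfies ?l31 ?p31 ?p13"
    unfolding satisfies_law_from by (simp_all add: law del: satisfies.simps)
  have l13: "satisfies (swap_law ?l31) ?p13 ?p31" using l(3) by (simp only: satisfies_swap)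
  obtain a1 b1 a2 b2 a3 b3 where tu: "trace C u1 x a1" "trace C u2 b1 a2" "trace C u3 b2 a3" "trace C u4 b3 x"
    and tq: "trace C p1 a1 b1" "trace C q2 a2 b2" "trace C q3 a3 b3"
    using col unfolding colouring_def fst_conv trace_append by blast
  obtain a b a' b' where tp: "trace C p2 a b" "trace C p3 a' b'"
    using tq order by auto
  note t1 = tq(1)[unfolded p1] and t2 = tp(1)[unfolded p2] and t3 = tp(2)[unfolded p3]
  have c: "?p12 (inner d2) \<approx> ?p13 (inner d3)" "?p21 (inner d1) \<approx> ?p23 (inner d3)"
    "?p31 (inner d1) \<approx> ?p32 (inner d2)"
    using t1 t2 t3 unfolding trace_strand by (blast intro: cong_sym)+
  from triangle_slides_third_move[OF assms, unfolded triangle_slides_def, rule_format,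
      OF l(1) l13 l(2) c]
  obtain r12 r21 r13 r31 r23 r32 where
    sat: "satisfies ?l12 r12 r21" "satisfies (swap_law ?l31) r13 r31" "satisfies ?l23 r23 r32" and
    r: "r12 (inner d2) \<approx> ?p13 (flip (inner d3))" "r13 (inner d3) \<approx> ?p12 (flip (inner d2))"
       "r21 (inner d1) \<approx> ?p23 (flip (inner d3))" "r23 (inner d3) \<approx> ?p21 (flip (inner d1))"
       "r31 (inner d1) \<approx> ?p32 (flip (inner d2))" "r32 (inner d2) \<approx> ?p31 (flip (inner d1))" and
    s: "r12 (flip (inner d2)) \<approx> r13 (flip (inner d3))" "r21 (flip (inner d1)) \<approx> r23 (flip (inner d3))"
       "r31 (flip (inner d1)) \<approx> r32 (flip (inner d2))"
    by (elim exE conjE)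
  define C' where "C' = C((c12, ?s12) := r12, (c12, flip ?s12) := r21, (c23, ?s23) := r23,
    (c23, flip ?s23) := r32, (c31, ?s31) := r31, (c31, flip ?s31) := r13)"
  have C'r: "C' (c12, ?s12) = r12" "C' (c12, flip ?s12) = r21" "C' (c23, ?s23) = r23"
    "C' (c23, flip ?s23) = r32" "C' (c31, ?s31) = r31" "C' (c31, flip ?s31) = r13"
    using distinct_crossings distinct_crossings[symmetric] by (simp_all add: C'_def)
  have C': "C' q = C q" if "q \<notin> passages" for q
    using that unfolding C'_def passages_def by auto
  then have C'u: "C' q = C q" if "q \<in> set u" "u \<in> {u1, u2, u3, u4}" for q u
    using outside[OF that(2)] that(1) by blast
  have 1: "trace C' (rev p1) x y" if "trace C p1 x y" for x y
    using that unfolding p1 by (rule strand_slides) (use r s in \<open>simp_all add: C'r\<close>)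
  have 2: "trace C' (rev p2) x y" if "trace C p2 x y" for x y
    using that unfolding p2 by (rule strand_slides) (use r s in \<open>simp_all add: C'r cong_sym\<close>)
  have 3: "trace C' (rev p3) x y" if "trace C p3 x y" for x y
    using that unfolding p3 by (rule strand_slides) (use r s in \<open>simp_all add: C'r\<close>)
  have "trace C' (rev p1) a1 b1" "trace C' (rev q2) a2 b2" "trace C' (rev q3) a3 b3"
    using 1 2 3 tq order by auto
  moreover have "trace C' u1 x a1" "trace C' u2 b1 a2" "trace C' u3 b2 a3" "trace C' u4 b3 x"
    using tu trace_agree[of _ C' C] C'u by blast+
  ultimately have "trace C' after x x"
    unfolding trace_append by blast
  moreover have "satisfies (law_of ?K' c) (C' (c, Lft)) (C' (c, Rgt))" if "c \<in> fst ` set after" for c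
  proof -
    have cb: "c \<in> fst ` set before" using that by simp
    show ?thesis
    proof (cases "c \<in> {c12, c23, c31}")
      case True
      have "satisfies (law_of ?K c12) (C' (c12, Lft)) (C' (c12, Rgt))"
        using satisfies_law_from[of ?s12 "law_of ?K c12" C' c12] sat(1) by (simp only: C'r)
      moreover have "satisfies (law_of ?K c23) (C' (c23, Lft)) (C' (c23, Rgt))"
        using satisfies_law_from[of ?s23 "law_of ?K c23" C' c23] sat(3) by (simp only: C'r)
      moreover have "satisfies (law_of ?K c31) (C' (c31, Lft)) (C' (c31, Rgt))"
        using satisfies_law_from[of ?s31 "law_of ?K c31" C' c31] sat(2) by (simp only: C'r satisfies_swap)
      ultimately show ?thesis
        unfolding law_of_after[OF cb] using True by blast
    next
      case False
      then have "C' (c, s) = C (c, s)" for s by (intro C') (simp add: passages_def)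
      then show ?thesis
        unfolding law_of_after[OF cb] using colouring_law[OF col, unfolded fst_conv, OF cb] by (simp only:)
    qed
  qed
  ultimately have "colouring ?K' x C'"
    unfolding colouring_def fst_conv by blast
  moreover have "colours_in W ?K x C" if W: "encloses W" and C: "colours_in W ?K' x C'" for W
  proof -
    have mem: "q \<in> set after \<longleftrightarrow> q \<in> set before" for q by auto
    have "C' q k \<in> W" if "q \<in> passages" for q k
    proof -
      have "q \<in> set p1 \<union> (set q2 \<union> set q3)" using that set_strands set_q by blast
      then show ?thesis using C by (auto simp: colours_in_def)
    qed
    then have rW: "C' (c, s) k \<in> W" if "c \<in> {c12, c23, c31}" for c s k
      using that by (simp add: passages_def)
    have "r12 k \<in> W" "r21 k \<in> W" "r13 k \<in> W" "r31 k \<in> W" "r23 k \<in> W" "r32 k \<in> W" for k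
      unfolding C'r[symmetric] by (rule rW; simp)+
    then have "?p13 (flip (inner d3)) \<in> W" "?p12 (flip (inner d2)) \<in> W" "?p23 (flip (inner d3)) \<in> W"
      "?p21 (flip (inner d1)) \<in> W" "?p32 (flip (inner d2)) \<in> W" "?p31 (flip (inner d1)) \<in> W"
      using r encloses_cong[OF W] by blast+
    then have pW: "?p12 k \<in> W" "?p21 k \<in> W" "?p23 k \<in> W" "?p32 k \<in> W" "?p31 k \<in> W" "?p13 k \<in> W" for k
      using law_encloses[OF l(1) W] law_encloses[OF l(2) W] law_encloses[OF l(3) W] by blast+
    have "C q k \<in> W" if "q \<in> set before" for q k
    proof (cases "q \<in> passages")
      case True
      obtain c s where q: "q = (c, s)" by (cases q)
      have "s = s' \<or> s = flip s'" for s' by (cases s; cases s') auto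
      with pW True show ?thesis unfolding q passages_def by (metis SigmaD1 insertE singletonD)
    next
      case False
      have "C' q k \<in> W"
        using C that mem[of q] unfolding colours_in_def fst_conv by blast
      then show ?thesis by (simp only: C'[OF False])
    qed
    then show ?thesis using C by (simp add: colours_in_def)
  qed
  ultimately show "\<exists>x' C'. colouring ?K' x' C' \<and>
      (\<forall>W. encloses W \<longrightarrow> colours_in W ?K' x' C' \<longrightarrow> colours_in W ?K x C)" by blast
qed

end

section \<open>Fox derivatives and colourings\<close>

text \<open>
  The lexicographic order on the exponents makes \<open>laurent\<close> an integral domain: the product of the
  greatest monomials of two factors is not cancelled by the other terms.
\<close>

instance prod :: ("{linorder, ordered_cancel_comm_monoid_add}", "{linorder, ordered_cancel_comm_monoid_add}") ordered_cancel_comm_monoid_add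
  by standard (auto simp: less_eq_prod_def add_left_mono add_strict_left_mono)

fun central_gen :: "central \<Rightarrow> gen" where
  "central_gen CS = S"
| "central_gen CQ = Q"
| "central_gen CT = Theta"

text \<open>
  The values \<open>t\<close> and \<open>t\<inverse>\<close> of the letters of all semi-arcs.
\<close>

definition arc_value :: "bool \<Rightarrow> laurent" where
  "arc_value e = letter_value (Arc 0, e)"

definition central_value :: "bool \<Rightarrow> central \<Rightarrow> laurent" where
  "central_value e c = letter_value (central_gen c, e)"

lemma letter_value_eqs:
  "letter_value (Arc i, e) = arc_value e"
  "letter_value (S, e) = central_value e CS"
  "letter_value (Q, e) = central_value e CQ"
  "letter_value (Theta, e) = central_value e CT"
  by (simp_all add: arc_value_def central_value_def)

lemma letter_value_inverse: "letter_value (g, True) * letter_value (g, False) = 1"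
proof -
  have "gen_exponent g + - gen_exponent g = 0" by simp
  then show ?thesis by (simp only: letter_value.simps if_True if_False mult_single single_one mult_1)
qed

lemma arc_value_inverse: "arc_value True * arc_value False = 1"
  and central_value_inverse: "central_value True c * central_value False c = 1"
  using letter_value_inverse by (simp_all only: arc_value_def central_value_def)

lemma group_ring_value_append: "group_ring_value (xs @ ys) = group_ring_value xs + group_ring_value ys"
  by (simp add: group_ring_value_def)

lemma group_ring_value_prefix:
  "group_ring_value (map (\<lambda>(k, v). (k, p # v)) xs) = letter_value p * group_ring_value xs"
  by (induction xs)
     (auto simp: group_ring_value_def word_value_def distrib_left mult.left_commute simp del: letter_value.simps)

definition fox_row :: "gword \<Rightarrow> gen \<Rightarrow> laurent" where
  "fox_row r = (\<lambda>g. group_ring_value (fox g r))"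

text \<open>
  The Fox derivative of a word with \<open>\<phi> g\<close> substituted for the symbol \<open>d g\<close> of each generator, that is,
  the vector part of the value of the word in the semidirect product.
\<close>

fun fox_extension :: "(gen \<Rightarrow> 'g \<Rightarrow> laurent) \<Rightarrow> gword \<Rightarrow> 'g \<Rightarrow> laurent" where
  "fox_extension \<phi> [] = 0"
| "fox_extension \<phi> ((h, e) # u) =
     (if e then \<phi> h else (- letter_value (h, False)) *\<^sub>f \<phi> h) + letter_value (h, e) *\<^sub>f fox_extension \<phi> u"

lemma fox_row_Nil: "fox_row [] = 0"
  by (rule ext) (simp add: fox_row_def group_ring_value_def)

lemma fox_row_Cons:
  "fox_row ((h, e) # u) =
     (if e then 1 else - letter_value (h, False)) *\<^sub>f basis_vector h + letter_value (h, e) *\<^sub>f fox_row u"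
  by (rule ext) (simp add: fox_row_def group_ring_value_append group_ring_value_prefix
      scale_fun_def basis_vector_def group_ring_value_def[of "[_]"] group_ring_value_def[of "[]"] word_value_def
      del: letter_value.simps)

lemma fox_extension_basis: "fox_extension basis_vector r = fox_row r"
proof (induction r)
  case (Cons p r)
  then show ?case by (cases p) (simp add: fox_row_Cons scale_fun_def del: letter_value.simps)
qed (simp add: fox_row_Nil)

lemma linear_extension_add: "linear_extension gs \<phi> (v + w) = linear_extension gs \<phi> v + linear_extension gs \<phi> w"
  by (rule ext) (simp add: linear_extension_def distrib_right sum.distrib)

lemma linear_extension_scale: "linear_extension gs \<phi> (r *\<^sub>f v) = r *\<^sub>f linear_extension gs \<phi> v"
  by (rule ext) (simp add: linear_extension_def scale_fun_def mult.assoc sum_distrib_left)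

lemma linear_extension_0: "linear_extension gs \<phi> 0 = 0"
  by (rule ext) (simp add: linear_extension_def)

lemma linear_extension_basis:
  assumes "distinct gs" "g \<in> set gs"
  shows "linear_extension gs \<phi> (basis_vector g) = \<phi> g"
proof -
  obtain i where i: "i < length gs" "g = gs ! i" using assms(2) by (auto simp: in_set_conv_nth)
  show ?thesis
  proof (rule ext)
    fix h
    have "linear_extension gs \<phi> (basis_vector g) h = (\<Sum>j<length gs. if j = i then \<phi> g h else 0)"
      unfolding linear_extension_def using i assms(1)
      by (intro sum.cong) (auto simp: basis_vector_def nth_eq_iff_index_eq)
    then show "linear_extension gs \<phi> (basis_vector g) h = \<phi> g h" using i(1) by simp
  qed
qed

lemma linear_extension_fox_row:
  assumes gs: "distinct gs" and r: "fst ` set r \<subseteq> set gs"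
  shows "linear_extension gs \<phi> (fox_row r) = fox_extension \<phi> r"
  using r
proof (induction r)
  case (Cons p r)
  obtain h e where p: "p = (h, e)" by (cases p)
  have one: "1 *\<^sub>f v = v" for v :: "'b \<Rightarrow> laurent" by (simp add: scale_fun_def)
  have h: "h \<in> set gs" and IH: "linear_extension gs \<phi> (fox_row r) = fox_extension \<phi> r"
    using Cons p by simp_all
  show ?case
    unfolding p fox_row_Cons linear_extension_add linear_extension_scale
      linear_extension_basis[OF gs h] IH fox_extension.simps
    by (cases e) (simp_all only: one if_True if_False)
qed (simp add: fox_row_Nil linear_extension_0)

lemma submodule_range_linear_extension: "submodule {x. \<exists>v. x = linear_extension gs \<phi> v}"
  unfolding submodule_def mem_Collect_eq Ball_def
  by (metis linear_extension_0 linear_extension_add linear_extension_scale)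

lemma linear_extension_span:
  assumes N: "submodule N" and R: "\<And>r. r \<in> R \<Longrightarrow> linear_extension gs \<phi> r \<in> N"
    and v: "v \<in> span_fun R"
  shows "linear_extension gs \<phi> v \<in> N"
proof (rule span_fun_induct[OF v, where P = "\<lambda>v. linear_extension gs \<phi> v \<in> N"])
  show "submodule (Collect (\<lambda>v. linear_extension gs \<phi> v \<in> N))"
    using N unfolding submodule_def
    by (simp add: linear_extension_0 linear_extension_add linear_extension_scale)
qed (use R in auto)

locale laurent_colours =
  fixes N :: "('g \<Rightarrow> laurent) set" and \<delta> :: "central \<Rightarrow> 'g \<Rightarrow> laurent"
  assumes submodule_N: "submodule N"
    and commute_N: "\<And>g h. (1 - central_value True h) *\<^sub>f \<delta> g - (1 - central_value True g) *\<^sub>f \<delta> h \<in> N"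
begin

sublocale colour_module N "arc_value True" "arc_value False" "central_value True" "central_value False" \<delta>
  by unfold_locales (rule submodule_N arc_value_inverse central_value_inverse commute_N)+

lemma satisfies_cong:
  assumes "\<And>k. p k \<approx> p' k" "\<And>k. r k \<approx> r' k" and "satisfies l p r"
  shows "satisfies l p' r'"
proof -
  have 1: "y \<approx> conj_by g x \<Longrightarrow> y' \<approx> conj_by g x'" if "x \<approx> x'" "y \<approx> y'" for x y x' y' g
    using that cong_conj[OF that(1), of g] by (blast intro: cong_trans cong_sym)
  have 2: "z \<approx> under x y \<Longrightarrow> z' \<approx> under x' y'" if "x \<approx> x'" "y \<approx> y'" "z \<approx> z'" for x y z x' y' z'
    using that(3) cong_under[OF that(1,2)] by (blast intro: cong_trans cong_sym)
  show ?thesis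
    using assms(3) 1[OF assms(1) assms(1)] 1[OF assms(2) assms(2)]
      2[OF assms(1) assms(2) assms(2)] 2[OF assms(2) assms(1) assms(1)]
    by (cases "(l, p, r)" rule: satisfies.cases) (auto simp del: split_paired_All)
qed

lemmas word_simps = gen_word_def inv_word_def commutator_word_def letter_value_eqs

lemmas eval_simps = scale_fun_def plus_fun_apply fun_diff_def zero_fun_apply

context
  fixes \<phi> :: "gen \<Rightarrow> 'g \<Rightarrow> laurent"
  assumes \<phi>: "\<And>c. \<phi> (central_gen c) = \<delta> c"
begin

lemma \<phi>_gens: "\<phi> S = \<delta> CS" "\<phi> Q = \<delta> CQ" "\<phi> Theta = \<delta> CT"
  using \<phi>[of CS] \<phi>[of CQ] \<phi>[of CT] by simp_all

abbreviation "arc_word i \<equiv> gen_word (Arc i)"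
abbreviation "central_word c \<equiv> gen_word (central_gen c)"

lemma letter_value_central: "letter_value (central_gen c, e) = central_value e c"
  by (simp add: central_value_def)

lemma fox_conj: "fox_extension \<phi> (central_word c @ arc_word x @ inv_word (central_word c) @ inv_word (arc_word y)) =
    conj_by c (\<phi> (Arc x)) - \<phi> (Arc y)"
proof (rule ext)
  fix i
  show "fox_extension \<phi> (central_word c @ arc_word x @ inv_word (central_word c) @ inv_word (arc_word y)) i =
      (conj_by c (\<phi> (Arc x)) - \<phi> (Arc y)) i"
    using arc_value_inverse central_value_inverse[of c]
    by (simp add: word_simps letter_value_central \<phi> conj_by_def eval_simps del: letter_value.simps)
       Groebner_Basis.algebra
qed

lemma fox_unconj: "fox_extension \<phi> (inv_word (central_word c) @ arc_word x @ central_word c @ inv_word (arc_word y)) =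
    unconj_by c (\<phi> (Arc x)) - \<phi> (Arc y)"
proof (rule ext)
  fix i
  show "fox_extension \<phi> (inv_word (central_word c) @ arc_word x @ central_word c @ inv_word (arc_word y)) i =
      (unconj_by c (\<phi> (Arc x)) - \<phi> (Arc y)) i"
    using arc_value_inverse central_value_inverse[of c]
    by (simp add: word_simps letter_value_central \<phi> unconj_by_def eval_simps del: letter_value.simps)
       Groebner_Basis.algebra
qed

lemma fox_under:
  "fox_extension \<phi> (arc_word x @ arc_word y @ central_word CS @ inv_word (arc_word x) @ inv_word (central_word CS) @ inv_word (arc_word z)) =
    under (\<phi> (Arc x)) (\<phi> (Arc y)) - \<phi> (Arc z)"
proof (rule ext)
  fix i
  show "fox_extension \<phi> (arc_word x @ arc_word y @ central_word CS @ inv_word (arc_word x) @ inv_word (central_word CS) @ inv_word (arc_word z)) i =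
      (under (\<phi> (Arc x)) (\<phi> (Arc y)) - \<phi> (Arc z)) i"
    using arc_value_inverse central_value_inverse[of CS]
    by (simp add: word_simps \<phi>_gens under_def eval_simps del: letter_value.simps)
       Groebner_Basis.algebra
qed

text \<open>
  The second relator of a negative crossing is not the law of the under strand itself, but combines it
  with the law of the over strand, which is the first relator.
\<close>

lemma fox_negative:
  "fox_extension \<phi> (inv_word (central_word CS) @ inv_word (arc_word y) @ central_word CS @ arc_word x @ arc_word y @ inv_word (arc_word w)) =
    arc_value False *\<^sub>f (\<phi> (Arc x) - under (\<phi> (Arc z)) (\<phi> (Arc w))) +
    (1 - central_value False CS * arc_value False) *\<^sub>f (\<phi> (Arc y) - conj_by CS (\<phi> (Arc z)))"
proof (rule ext)
  fix i
  show "fox_extension \<phi> (inv_word (central_word CS) @ inv_word (arc_word y) @ central_word CS @ arc_word x @ arc_word y @ inv_word (arc_word w)) i =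
    (arc_value False *\<^sub>f (\<phi> (Arc x) - under (\<phi> (Arc z)) (\<phi> (Arc w))) +
    (1 - central_value False CS * arc_value False) *\<^sub>f (\<phi> (Arc y) - conj_by CS (\<phi> (Arc z)))) i"
    using arc_value_inverse central_value_inverse[of CS]
    by (simp add: word_simps \<phi>_gens under_def conj_by_def eval_simps del: letter_value.simps)
       Groebner_Basis.algebra
qed

lemma fox_commutator:
  "fox_extension \<phi> (commutator_word (central_word g) (central_word h)) =
    (1 - central_value True h) *\<^sub>f \<delta> g - (1 - central_value True g) *\<^sub>f \<delta> h"
proof (rule ext)
  fix i
  show "fox_extension \<phi> (commutator_word (central_word g) (central_word h)) i =
    ((1 - central_value True h) *\<^sub>f \<delta> g - (1 - central_value True g) *\<^sub>f \<delta> h) i"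
    using central_value_inverse[of g] central_value_inverse[of h]
    by (simp add: word_simps letter_value_central \<phi> eval_simps del: letter_value.simps)
       Groebner_Basis.algebra
qed

lemma scale_arc_value_cong_iff: "arc_value False *\<^sub>f x \<approx> arc_value False *\<^sub>f y \<longleftrightarrow> x \<approx> y"
proof
  have 1: "arc_value True *\<^sub>f (arc_value False *\<^sub>f z) = z" for z :: "'g \<Rightarrow> laurent"
    using arc_value_inverse by (simp add: scale_fun_def mult.assoc[symmetric])
  assume "arc_value False *\<^sub>f x \<approx> arc_value False *\<^sub>f y"
  from cong_scale[OF this, of "arc_value True"] show "x \<approx> y" by (simp add: 1)
qed (rule cong_scale)

text \<open>
  This is where the relations of the parity group enter.  The incoming and outgoing semi-arcs
  \<open>x\<close>, \<open>w\<close> of the strand \<open>Lft\<close> are on the left and on the right of the other strand, and \<open>y\<close>, \<open>z\<close> of the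
  strand \<open>Rgt\<close> are on the right and on the left.
\<close>

lemma crossing_relators_iff_law:
  fixes K c
  defines "P \<equiv> \<lambda>k. \<phi> (Arc (if k = Lft then arc_in (fst K) (c, Lft) else arc_out (fst K) (c, Lft)))"
    and "R \<equiv> \<lambda>k. \<phi> (Arc (if k = Rgt then arc_in (fst K) (c, Rgt) else arc_out (fst K) (c, Rgt)))"
  shows "(\<forall>r \<in> set (crossing_relators K c). fox_extension \<phi> r \<in> N) \<longleftrightarrow> satisfies (law_of K c) P R"
proof -
  let ?x = "arc_in (fst K) (c, Lft)" and ?y = "arc_in (fst K) (c, Rgt)"
  let ?z = "arc_out (fst K) (c, Rgt)" and ?w = "arc_out (fst K) (c, Lft)"
  have PR: "P Lft = \<phi> (Arc ?x)" "P Rgt = \<phi> (Arc ?w)" "R Rgt = \<phi> (Arc ?y)" "R Lft = \<phi> (Arc ?z)"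
    by (simp_all add: P_def R_def)
  note defs = crossing_relators_def Let_def law_of_def
  have conj: "conj_by g x - y \<in> N \<longleftrightarrow> y \<approx> conj_by g x" for g x y
    using cong_sym unfolding cong_def by blast
  have unconj: "unconj_by g y - x \<in> N \<longleftrightarrow> y \<approx> conj_by g x" for g x y
    using cong_conj_iff cong_sym unfolding cong_def by blast
  have under: "under x y - z \<in> N \<longleftrightarrow> z \<approx> under x y" for x y z
    using cong_sym unfolding cong_def by blast
  have neg: "a *\<^sub>f u + b *\<^sub>f v \<in> N \<longleftrightarrow> a *\<^sub>f u \<in> N" if "v \<in> N" for a b and u v :: "'g \<Rightarrow> laurent"
    using submodule_scale[OF N that, of b] submodule_add[OF N, of "a *\<^sub>f u" "b *\<^sub>f v"]
      submodule_diff[OF N, of "a *\<^sub>f u + b *\<^sub>f v" "b *\<^sub>f v"] by auto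
  have scale: "arc_value False *\<^sub>f u \<in> N \<longleftrightarrow> u \<in> N" for u
  proof -
    have "arc_value False *\<^sub>f 0 = (0 :: 'g \<Rightarrow> laurent)" by (rule ext) (simp add: scale_fun_def)
    then show ?thesis using scale_arc_value_cong_iff[of u 0] by (simp add: cong_def)
  qed
  consider "snd K c = Virt" | "snd K c \<noteq> Virt" "odd_crossing K c"
    | "snd K c = Pos" "\<not> odd_crossing K c" | "snd K c = Neg" "\<not> odd_crossing K c"
    using kind.exhaust by blast
  then show ?thesis
  proof cases
    case 1
    then show ?thesis
      using fox_unconj[of CQ ?y ?z] fox_conj[of CQ ?x ?w] by (auto simp: defs PR conj unconj)
  next
    case 2
    then show ?thesis
      using fox_unconj[of CT ?y ?z] fox_conj[of CT ?x ?w] by (auto simp: defs PR conj unconj)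
  next
    case 3
    then show ?thesis
      using fox_under[of ?x ?y ?z] fox_conj[of CS ?x ?w] by (auto simp: defs PR conj under)
  next
    case 4
    have "arc_value False *\<^sub>f (\<phi> (Arc ?x) - under (\<phi> (Arc ?z)) (\<phi> (Arc ?w))) +
      (1 - central_value False CS * arc_value False) *\<^sub>f (\<phi> (Arc ?y) - conj_by CS (\<phi> (Arc ?z))) \<in> N \<longleftrightarrow>
      \<phi> (Arc ?x) \<approx> under (\<phi> (Arc ?z)) (\<phi> (Arc ?w))" if "\<phi> (Arc ?y) \<approx> conj_by CS (\<phi> (Arc ?z))"
      using neg[OF that[unfolded cong_def]] scale by (simp add: cong_def)
    then show ?thesis
      using 4 fox_unconj[of CS ?y ?z] fox_negative[of ?y ?x ?w ?z]
      by (auto simp: defs PR unconj)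
  qed
qed

end

end

lemma (in colour_module) trace_nth:
  "w \<noteq> [] \<Longrightarrow> trace C w x y \<longleftrightarrow>
     x \<approx> C (w ! 0) (snd (w ! 0)) \<and>
     (\<forall>i. Suc i < length w \<longrightarrow> C (w ! i) (flip (snd (w ! i))) \<approx> C (w ! Suc i) (snd (w ! Suc i))) \<and>
     C (w ! (length w - 1)) (flip (snd (w ! (length w - 1)))) \<approx> y"
proof (induction w arbitrary: x)
  case (Cons p w)
  show ?case
  proof (cases w)
    case (Cons q v)
    have split: "(\<forall>i. P i) \<longleftrightarrow> P 0 \<and> (\<forall>i. P (Suc i))" for P :: "nat \<Rightarrow> bool"
      by (metis not0_implies_Suc)
    show ?thesis
      using Cons.IH[of "C p (flip (snd p))"] unfolding split[of "\<lambda>i. Suc i < length (p # w) \<longrightarrow> _ i"]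
      by (auto simp: Cons)
  qed simp
qed simp

lemma passage_pos_nth: "distinct w \<Longrightarrow> i < length w \<Longrightarrow> passage_pos w (w ! i) = i"
  unfolding passage_pos_def by (rule the_equality) (auto simp: nth_eq_iff_index_eq)

lemma passage_pos:
  assumes "distinct w" "p \<in> set w"
  shows "passage_pos w p < length w" "w ! passage_pos w p = p"
  using assms passage_pos_nth[OF assms(1)] by (auto simp: in_set_conv_nth)

lemma distinct_parity_group_gens: "distinct (parity_group_gens K)"
  by (auto simp: parity_group_gens_def distinct_map inj_on_def)

lemma set_parity_group_gens:
  "set (parity_group_gens K) = Arc ` {..<max 1 (length (fst K))} \<union> range central_gen"
proof -
  have "(UNIV :: central set) = {CS, CQ, CT}"
    using central.exhaust by blast
  then have "range central_gen = central_gen ` {CS, CQ, CT}" by (rule arg_cong)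
  then show ?thesis by (simp add: parity_group_gens_def atLeast0LessThan)
qed

lemma set_parity_group_relators:
  "set (parity_group_relators K) =
     (\<Union>c \<in> fst ` set (fst K). set (crossing_relators K c)) \<union>
     {commutator_word (gen_word S) (gen_word Q), commutator_word (gen_word S) (gen_word Theta),
      commutator_word (gen_word Theta) (gen_word Q)}"
  by (simp add: parity_group_relators_def crossings_def)

lemma relator_letters:
  assumes closed: "closed_word (fst K)" and r: "r \<in> set (parity_group_relators K)"
  shows "fst ` set r \<subseteq> set (parity_group_gens K)"
proof -
  have K: "distinct (fst K)" using closed by (simp add: closed_word_def)
  have arcs: "Arc (arc_in (fst K) (c, s)) \<in> set (parity_group_gens K)"
    "Arc (arc_out (fst K) (c, s)) \<in> set (parity_group_gens K)" if "c \<in> fst ` set (fst K)" for c s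
  proof -
    have "passage_pos (fst K) (c, s) < length (fst K)"
      by (rule passage_pos(1)[OF K closed_word_mem[OF closed that]])
    then have "arc_in (fst K) (c, s) < max 1 (length (fst K))" "arc_out (fst K) (c, s) < max 1 (length (fst K))"
      by (auto simp: arc_in_def arc_out_def less_max_iff_disj intro: mod_less_divisor)
    then show "Arc (arc_in (fst K) (c, s)) \<in> set (parity_group_gens K)"
      "Arc (arc_out (fst K) (c, s)) \<in> set (parity_group_gens K)"
      by (simp_all add: set_parity_group_gens)
  qed
  have central: "S \<in> set (parity_group_gens K)" "Q \<in> set (parity_group_gens K)" "Theta \<in> set (parity_group_gens K)"
    by (simp_all add: parity_group_gens_def)
  have letters: "fst ` set r \<subseteq> {Arc (arc_in (fst K) (c, Lft)), Arc (arc_in (fst K) (c, Rgt)),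
      Arc (arc_out (fst K) (c, Lft)), Arc (arc_out (fst K) (c, Rgt)), S, Q, Theta}"
    if "r \<in> set (crossing_relators K c)" for c
    using that by (auto simp: crossing_relators_def Let_def gen_word_def inv_word_def split: if_splits)
  have crossing: "fst ` set r \<subseteq> set (parity_group_gens K)"
    if "c \<in> fst ` set (fst K)" "r \<in> set (crossing_relators K c)" for c
    by (rule subset_trans[OF letters[OF that(2)]]) (simp add: arcs[OF that(1)] central)
  have "fst ` set (commutator_word (gen_word g) (gen_word h)) \<subseteq> {g, h}" for g h
    by (simp add: commutator_word_def gen_word_def inv_word_def)
  then have commutator: "fst ` set (commutator_word (gen_word g) (gen_word h)) \<subseteq> set (parity_group_gens K)"
    if "g \<in> set (parity_group_gens K)" "h \<in> set (parity_group_gens K)" for g h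
    by (rule subset_trans) (use that in simp)
  from r consider c where "c \<in> fst ` set (fst K)" "r \<in> set (crossing_relators K c)"
    | "r = commutator_word (gen_word S) (gen_word Q)" | "r = commutator_word (gen_word S) (gen_word Theta)"
    | "r = commutator_word (gen_word Theta) (gen_word Q)"
    unfolding set_parity_group_relators by blast
  then show ?thesis
    using crossing commutator central by cases simp_all
qed

definition relation_module :: "vdiagram \<Rightarrow> (gen \<Rightarrow> laurent) set" where
  "relation_module K = span_fun (fox_row ` set (parity_group_relators K))"

lemma laurent_colours_relation_module:
  "laurent_colours (relation_module K) (\<lambda>c. basis_vector (central_gen c))"
proof
  show sub: "submodule (relation_module K)"
    by (simp add: relation_module_def submodule_span)
  let ?\<delta> = "\<lambda>c. basis_vector (central_gen c) :: gen \<Rightarrow> laurent"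
  let ?k = "\<lambda>g h. (1 - central_value True h) *\<^sub>f ?\<delta> g - (1 - central_value True g) *\<^sub>f ?\<delta> h"
  have row: "fox_row (commutator_word (gen_word (central_gen g)) (gen_word (central_gen h))) = ?k g h" for g h
  proof (rule ext)
    fix i
    show "fox_row (commutator_word (gen_word (central_gen g)) (gen_word (central_gen h))) i = ?k g h i"
      using central_value_inverse[of g] central_value_inverse[of h]
      unfolding fox_extension_basis[symmetric]
      by (simp add: gen_word_def inv_word_def commutator_word_def central_value_def[symmetric]
          scale_fun_def del: letter_value.simps) Groebner_Basis.algebra
  qed
  have base: "?k g h \<in> relation_module K"
    if "(g, h) \<in> {(CS, CQ), (CS, CT), (CT, CQ)}" for g h
    unfolding row[symmetric] relation_module_def using that
    by (intro span_fun_base imageI) (auto simp: set_parity_group_relators)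
  have neg: "?k h g = - ?k g h" for g h by simp
  have zero: "?k g g \<in> relation_module K" for g
    using submodule_0[OF sub] by simp
  show "?k g h \<in> relation_module K" for g h
    using base[of g h] base[of h g] zero[of g] submodule_neg[OF sub, of "?k h g"] neg[of g h]
    by (cases g; cases h) simp_all
qed

context laurent_colours
begin

text \<open>
  A homomorphism \<open>\<phi>\<close> from the module of the diagram colours every passage by the images of the semi-arcs
  that end and begin there.
\<close>

lemma colouring_of_relations:
  assumes K: "closed_word (fst K)"
    and \<phi>: "\<And>c. \<phi> (central_gen c) = \<delta> c"
    and rel: "\<And>r. r \<in> set (parity_group_relators K) \<Longrightarrow> fox_extension \<phi> r \<in> N"
  shows "colouring K (\<phi> (Arc 0))
    (\<lambda>p k. \<phi> (Arc (if k = snd p then arc_in (fst K) p else arc_out (fst K) p)))" (is "colouring K _ ?C")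
  unfolding colouring_def
proof
  have d: "distinct (fst K)" using K by (simp add: closed_word_def)
  show "trace ?C (fst K) (\<phi> (Arc 0)) (\<phi> (Arc 0))"
  proof (cases "fst K = []")
    case False
    have 1: "arc_in (fst K) (fst K ! i) = i" if "i < length (fst K)" for i
      using passage_pos_nth[OF d that] by (simp add: arc_in_def)
    have 2: "arc_out (fst K) (fst K ! i) = Suc i mod length (fst K)" if "i < length (fst K)" for i
      using passage_pos_nth[OF d that] by (simp add: arc_out_def)
    show ?thesis
      unfolding trace_nth[OF False] using False by (simp add: 1 2)
  qed simp
  show "\<forall>c \<in> fst ` set (fst K). satisfies (law_of K c) (?C (c, Lft)) (?C (c, Rgt))"
  proof
    fix c assume c: "c \<in> fst ` set (fst K)"
    then have "\<forall>r \<in> set (crossing_relators K c). fox_extension \<phi> r \<in> N"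
      using rel by (auto simp: set_parity_group_relators)
    then show "satisfies (law_of K c) (?C (c, Lft)) (?C (c, Rgt))"
      unfolding crossing_relators_iff_law[OF \<phi>] by simp
  qed
qed

text \<open>
  A colouring assigns to the semi-arc \<open>i\<close> the incoming colour of the \<open>i\<close>-th passage.  That this is also
  the outgoing colour of the passage before it holds modulo \<open>N\<close> only.
\<close>

lemma relations_of_colouring:
  assumes K: "closed_word (fst K)" and col: "colouring K x C"
  shows "\<exists>\<phi>. (\<forall>c. \<phi> (central_gen c) = \<delta> c) \<and>
    (\<forall>r \<in> set (parity_group_relators K). fox_extension \<phi> r \<in> N) \<and>
    (\<forall>W. encloses W \<longrightarrow> \<phi> ` set (parity_group_gens K) \<subseteq> W \<longrightarrow> colours_in W K x C)"
proof -
  let ?w = "fst K"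
  have d: "distinct ?w" using K by (simp add: closed_word_def)
  define \<phi> where "\<phi> g = (case g of Arc i \<Rightarrow> if ?w = [] then x else C (?w ! i) (snd (?w ! i))
    | S \<Rightarrow> \<delta> CS | Q \<Rightarrow> \<delta> CQ | Theta \<Rightarrow> \<delta> CT)" for g
  have central: "\<phi> (central_gen c) = \<delta> c" for c by (cases c) (simp_all add: \<phi>_def)
  have arc_in: "\<phi> (Arc (arc_in ?w p)) = C p (snd p)" if "p \<in> set ?w" for p
    using passage_pos(2)[OF d that] that by (auto simp: \<phi>_def arc_in_def)
  have trace: "trace C ?w x x" using col by (simp add: colouring_def)
  have arc_out: "\<phi> (Arc (arc_out ?w p)) \<approx> C p (flip (snd p))" if p: "p \<in> set ?w" for p
  proof -
    define i where "i = passage_pos ?w p"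
    have i: "i < length ?w" "?w ! i = p" unfolding i_def using passage_pos[OF d p] .
    have ne: "?w \<noteq> []" using p by auto
    have out: "C (?w ! i) (flip (snd (?w ! i))) \<approx> C (?w ! (Suc i mod length ?w)) (snd (?w ! (Suc i mod length ?w)))"
    proof (cases "Suc i < length ?w")
      case True
      then show ?thesis using trace[unfolded trace_nth[OF ne]] by simp
    next
      case False
      then have "i = length ?w - 1" "Suc i mod length ?w = 0"
      proof -
        have "Suc i = length ?w" using False i(1) by linarith
        then show "i = length ?w - 1" "Suc i mod length ?w = 0" by auto
      qed
      then show ?thesis using trace[unfolded trace_nth[OF ne]] by (metis cong_trans)
    qed
    show ?thesis
      using out i(2) ne by (simp add: \<phi>_def arc_out_def i_def[symmetric] cong_sym)
  qed
  have rel: "fox_extension \<phi> r \<in> N" if r: "r \<in> set (parity_group_relators K)" for r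
  proof -
    have crossing: "fox_extension \<phi> r \<in> N" if c: "c \<in> fst ` set ?w" and r: "r \<in> set (crossing_relators K c)" for c
    proof -
      have mem: "(c, Lft) \<in> set ?w" "(c, Rgt) \<in> set ?w" using closed_word_mem[OF K c] by blast+
      have "satisfies (law_of K c)
         (\<lambda>k. \<phi> (Arc (if k = Lft then arc_in ?w (c, Lft) else arc_out ?w (c, Lft))))
         (\<lambda>k. \<phi> (Arc (if k = Rgt then arc_in ?w (c, Rgt) else arc_out ?w (c, Rgt))))"
      proof (rule satisfies_cong[OF _ _ colouring_law[OF col c]])
        show "C (c, Lft) k \<approx> \<phi> (Arc (if k = Lft then arc_in ?w (c, Lft) else arc_out ?w (c, Lft)))" for k
          using arc_in[OF mem(1)] cong_sym[OF arc_out[OF mem(1)]] by (cases k) simp_all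
        show "C (c, Rgt) k \<approx> \<phi> (Arc (if k = Rgt then arc_in ?w (c, Rgt) else arc_out ?w (c, Rgt)))" for k
          using arc_in[OF mem(2)] cong_sym[OF arc_out[OF mem(2)]] by (cases k) simp_all
      qed
      then show ?thesis
        using crossing_relators_iff_law[OF central, of K c] r by blast
    qed
    have "fox_extension \<phi> (commutator_word (gen_word (central_gen g)) (gen_word (central_gen h))) \<in> N" for g h
      unfolding fox_commutator[OF central] by (rule commute)
    from this[of CS CQ] this[of CS CT] this[of CT CQ] crossing r show ?thesis
      by (auto simp: set_parity_group_relators)
  qed
  have "colours_in W K x C" if W: "encloses W" and gens: "\<phi> ` set (parity_group_gens K) \<subseteq> W" for W
  proof -
    have arc: "\<phi> (Arc i) \<in> W" if "i < max 1 (length ?w)" for i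
      using gens that by (auto simp: set_parity_group_gens)
    have x: "x \<in> W"
    proof (cases "?w = []")
      case True then show ?thesis using arc[of 0] by (simp add: \<phi>_def)
    next
      case False
      then have "x \<approx> \<phi> (Arc 0)" using trace trace_nth[OF False] by (simp add: \<phi>_def)
      then show ?thesis using arc[of 0] encloses_cong[OF W] by simp
    qed
    moreover have "C p k \<in> W" if p: "p \<in> set ?w" for p k
    proof -
      have "passage_pos ?w p < length ?w" by (rule passage_pos(1)[OF d p])
      then have "arc_in ?w p < max 1 (length ?w)" "arc_out ?w p < max 1 (length ?w)"
        by (auto simp: arc_in_def arc_out_def less_max_iff_disj intro: mod_less_divisor)
      then have "C p (snd p) \<in> W" "C p (flip (snd p)) \<in> W"
        using arc arc_in[OF p] arc_out[OF p] encloses_cong[OF W] by metis+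
      then show ?thesis by (cases "k = snd p") (use neq_flip[of "snd p" k] in auto)
    qed
    ultimately show ?thesis by (simp add: colours_in_def)
  qed
  with central rel show ?thesis by blast
qed

end

section \<open>Invariance of the polynomial\<close>

lemma idom_dvd_antisym: "(f::'a::idom) dvd g \<Longrightarrow> g dvd f \<Longrightarrow> \<exists>u. u dvd 1 \<and> g = u * f"
  by (metis dvd_def dvd_times_left_cancel_iff mult.commute mult_cancel_left2 mult_zero_left one_dvd dvd_triv_left)

lemma (in colour_module) transfers_same_diagram:
  assumes "same_diagram K K'" "closed_word (fst K)" "closed_word (fst K')"
  shows "transfers K K' \<and> transfers K' K"
  using assms(1)
proof cases
  case (rebase u v \<kappa>)
  with assms(2,3) show ?thesis by (simp add: transfers_rebase)
next
  case (relabel f w \<kappa>' \<kappa>)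
  have w: "closed_word w" "closed_word (map (map_prod f id) w)"
    using assms(2,3) relabel by simp_all
  show ?thesis
    unfolding relabel(1,2) using transfers_relabel[OF w relabel(3), of \<kappa>' \<kappa>] relabel(4) by blast
qed

lemma (in colour_module) transfers_diagram_move:
  assumes "diagram_move K K'" "closed_word (fst K)" "closed_word (fst K')"
  shows "transfers K K' \<and> transfers K' K"
  using assms(1)
proof cases
  case (move_I u v \<kappa> c s)
  with assms(2,3) transfers_move_I[of u v c s \<kappa>] show ?thesis by simp
next
  case (move_II_parallel \<kappa> a b s u1 u2 u3)
  with assms(2,3) transfers_move_II[of u1 u2 u3 a s b "[(a, flip s), (b, s)]" \<kappa>] show ?thesis by simp
next
  case (move_II_antiparallel \<kappa> a b s u1 u2 u3)
  with assms(2,3) transfers_move_II[of u1 u2 u3 a s b "[(b, s), (a, flip s)]" \<kappa>] show ?thesis by simp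
next
  case (move_III_IV \<kappa> d1 d2 d3 c12 c23 c31 p1 p2 p3 q2 q3 u1 u2 u3 u4)
  have third: "third_move d1 d2 d3 c12 c23 c31 u1 u2 u3 u4 p1 p2 p3 q2 q3 \<kappa>"
    using assms(2,3) move_III_IV by unfold_locales simp_all
  show ?thesis
    unfolding move_III_IV(1,2)
    using transfers_third_move[OF third] transfers_third_move[OF third_move_reverse[OF third]]
    by (simp only: rev_rev_ident simp_thms)
qed

definition moves_to :: "vdiagram \<Rightarrow> vdiagram \<Rightarrow> bool" where
  "moves_to K K' \<longleftrightarrow> virtual_knot_diagram K \<and> virtual_knot_diagram K' \<and>
     (same_diagram K K' \<or> diagram_move K K')"

text \<open>
  The generic colouring of \<open>K'\<close> by the generators of its own module is transferred to \<open>K\<close>.  The result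
  is a homomorphism \<open>\<phi>\<close> from the module of \<open>K\<close> to that of \<open>K'\<close>, and it is onto because the colours of
  \<open>K'\<close> are recovered from its values.
\<close>

lemma divides_fitting_move:
  fixes d :: laurent
  assumes K: "moves_to K K' \<or> moves_to K' K"
    and d: "divides_fitting d 1 (parity_group_gens K') (relation_module K')"
  shows "divides_fitting d 1 (parity_group_gens K) (relation_module K)"
proof -
  let ?\<delta> = "\<lambda>c. basis_vector (central_gen c) :: gen \<Rightarrow> laurent"
  interpret laurent_colours "relation_module K'" ?\<delta>
    by (rule laurent_colours_relation_module)
  have closed: "closed_word (fst K)" "closed_word (fst K')"
    using K by (auto simp: moves_to_def virtual_knot_diagram_def)
  have transfers: "transfers K' K"
    using K closed transfers_same_diagram transfers_diagram_move unfolding moves_to_def by blast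
  have "fox_extension basis_vector r \<in> relation_module K'" if "r \<in> set (parity_group_relators K')" for r
    using that unfolding fox_extension_basis relation_module_def by (intro span_fun_base imageI)
  then have col': "colouring K' (basis_vector (Arc 0))
    (\<lambda>p k. basis_vector (Arc (if k = snd p then arc_in (fst K') p else arc_out (fst K') p)))"
    (is "colouring K' ?x ?C")
    by (intro colouring_of_relations[OF closed(2), of basis_vector]) simp_all
  from transfers[unfolded transfers_def, rule_format, OF col'] obtain x C where col: "colouring K x C"
    and W: "\<And>W. encloses W \<Longrightarrow> colours_in W K x C \<Longrightarrow> colours_in W K' ?x ?C"
    by blast
  from relations_of_colouring[OF closed(1) col]
  obtain \<phi> where \<phi>: "\<And>c. \<phi> (central_gen c) = ?\<delta> c"
    and rel: "\<And>r. r \<in> set (parity_group_relators K) \<Longrightarrow> fox_extension \<phi> r \<in> relation_module K'"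
    and gen: "\<And>W. encloses W \<Longrightarrow> \<phi> ` set (parity_group_gens K) \<subseteq> W \<Longrightarrow> colours_in W K x C"
    by blast
  let ?gs = "parity_group_gens K" and ?gs' = "parity_group_gens K'"
  show ?thesis
  proof (rule divides_fitting_surjection[OF distinct_parity_group_gens d])
    fix v assume "v \<in> relation_module K"
    then have v: "v \<in> span_fun (fox_row ` set (parity_group_relators K))" by (simp add: relation_module_def)
    show "linear_extension ?gs \<phi> v \<in> relation_module K'"
    proof (rule linear_extension_span[OF submodule_N _ v])
      fix r assume "r \<in> fox_row ` set (parity_group_relators K)"
      then obtain r' where r': "r' \<in> set (parity_group_relators K)" "r = fox_row r'" by auto
      show "linear_extension ?gs \<phi> r \<in> relation_module K'"
        unfolding r'(2)
          linear_extension_fox_row[OF distinct_parity_group_gens relator_letters[OF closed(1) r'(1)]]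
        by (rule rel[OF r'(1)])
    qed
  next
    fix h assume h: "h \<in> set ?gs'"
    define R where "R = fox_row ` set (parity_group_relators K')"
    \<comment> \<open>The preimage of the image of the map induced by \<open>\<phi>\<close> on the modules.\<close>
    define W where "W = span_fun (\<phi> ` set ?gs \<union> R)"
    have sub: "submodule W" unfolding W_def by (rule submodule_span)
    have gs: "\<phi> ` set ?gs \<subseteq> W" unfolding W_def by (auto intro: span_fun_base)
    have "relation_module K' \<subseteq> W"
      unfolding relation_module_def R_def[symmetric]
      by (rule span_fun_minimal[OF _ sub]) (auto simp: W_def intro: span_fun_base)
    moreover have \<delta>W: "?\<delta> c \<in> W" for c
      using gs by (auto simp: \<phi>[symmetric] set_parity_group_gens)
    ultimately have enc: "encloses W" using sub by (auto simp: encloses_def)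
    have colours: "colours_in W K' ?x ?C" by (rule W[OF enc gen[OF enc gs]])
    have "basis_vector h \<in> W"
    proof (cases h)
      case (Arc i)
      show ?thesis
      proof (cases "fst K' = []")
        case True
        then have "i = 0" using h Arc by (auto simp: parity_group_gens_def)
        then show ?thesis using colours Arc by (simp add: colours_in_def)
      next
        case False
        then have "max 1 (length (fst K')) = length (fst K')" by (cases "fst K'") simp_all
        then have i: "i < length (fst K')" using h Arc by (auto simp: parity_group_gens_def)
        have "?C (fst K' ! i) (snd (fst K' ! i)) \<in> W"
          using colours i nth_mem unfolding colours_in_def by blast
        moreover have "passage_pos (fst K') (fst K' ! i) = i"
          using passage_pos_nth i closed(2) by (simp add: closed_word_def)
        ultimately show ?thesis by (simp add: Arc arc_in_def)
      qed
    qed (use \<delta>W[of CS] \<delta>W[of CQ] \<delta>W[of CT] in simp_all)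
    then obtain a b where ab: "basis_vector h = a + b" "a \<in> span_fun (\<phi> ` set ?gs)" "b \<in> span_fun R"
      unfolding W_def span_fun_Un by blast
    have "\<exists>v. a = linear_extension ?gs \<phi> v"
    proof (rule span_fun_induct[OF ab(2), where P = "\<lambda>a. \<exists>v. a = linear_extension ?gs \<phi> v"])
      show "submodule (Collect (\<lambda>a. \<exists>v. a = linear_extension ?gs \<phi> v))"
        by (rule submodule_range_linear_extension)
      fix a assume "a \<in> \<phi> ` set ?gs"
      then show "\<exists>v. a = linear_extension ?gs \<phi> v"
        using linear_extension_basis[OF distinct_parity_group_gens] by (metis imageE)
    qed
    then obtain v where "a = linear_extension ?gs \<phi> v" by blast
    then have "basis_vector h - linear_extension ?gs \<phi> v = b" using ab(1) by (simp only: add_diff_cancel_left')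
    then show "\<exists>v. basis_vector h - linear_extension ?gs \<phi> v \<in> relation_module K'"
      using ab(3) unfolding relation_module_def R_def by blast
  qed
qed

lemma divides_minors_iff:
  "(\<forall>a \<in> minors (length (parity_group_gens K) - 1) (fox_matrix K). d dvd a) \<longleftrightarrow>
     divides_fitting d 1 (parity_group_gens K) (relation_module K)"
proof -
  let ?gs = "parity_group_gens K" and ?rs = "map fox_row (parity_group_relators K)"
  have len: "length ?gs = Suc (length ?gs - 1)" by (simp add: parity_group_gens_def)
  have "fox_matrix K = mat (length ?rs) (length ?gs) (\<lambda>(i, j). (?rs ! i) (?gs ! j))"
    unfolding fox_matrix_def Let_def by (rule eq_matI) (auto simp: fox_row_def)
  moreover have "relation_module K = span_fun (set ?rs)" by (simp add: relation_module_def)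
  ultimately show ?thesis
    using divides_fitting_iff_minors[OF distinct_parity_group_gens len, of d ?rs] by simp
qed

lemma virtually_equivalent_divides_minors:
  assumes "virtually_equivalent K K'"
  shows "(\<forall>a \<in> minors (length (parity_group_gens K) - 1) (fox_matrix K). d dvd a) \<longleftrightarrow>
    (\<forall>a \<in> minors (length (parity_group_gens K') - 1) (fox_matrix K'). d dvd a)"
proof -
  have "equivclp moves_to K K'"
    using assms unfolding virtually_equivalent_def moves_to_def by simp
  then show ?thesis
    unfolding divides_minors_iff
  proof (induction rule: equivclp_induct)
    case (step y z)
    then show ?case using divides_fitting_move[of y z d] divides_fitting_move[of z y d] by blast
  qed simp
qed

theorem theorem2:
  fixes K K' :: vdiagram and f g :: laurent
  assumes "virtual_knot_diagram K" and "virtual_knot_diagram K'"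
    and "virtually_equivalent K K'"
    and "is_parity_virtual_alexander K f" and "is_parity_virtual_alexander K' g"
  shows "\<exists>u. u dvd 1 \<and> g = u * f"
proof (rule idom_dvd_antisym)
  note common = virtually_equivalent_divides_minors[OF assms(3)]
  show "f dvd g" "g dvd f"
    using assms(4,5) common unfolding is_parity_virtual_alexander_def is_gcd_of_def by blast+
qed

end
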